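(* Let $(\mathcal{X},\rho)$ be a Polish space (a complete separable metric space), let $T$ be $\mathbb{R}_+$ or $\mathbb{N}_+$, and let $\{P_t\}_{t\in T}$ be a Markov-Feller semigroup on $\mathcal{X}$. The following two statements are equivalent: (a) $\{P_t\}_{t\in T}$ is asymptotically stable with a unique invariant measure $\mu$. (b) $\{P_t\}_{t\in T}$ is eventually continuous, and there exists some $z\in\mathcal{X}$ such that for any $\epsilon>0$, $$\inf_{x\in\mathcal{X}}\liminf_{t\rightarrow\infty}P_t(x,B(z,\epsilon))>0.$$
   Context: Notation: $\mathcal{B}(\mathcal{X})$ is the Borel $\sigma$-field of $\mathcal{X}$; $B(x,r)$ is the open ball in $(\mathcal{X},\rho)$ of radius $r$ centred at $x$; $B_b(\mathcal{X})$, $C_b(\mathcal{X})$ and $L_b(\mathcal{X})$ are the spaces of bounded real-valued functions on $\mathcal{X}$ that are, respectively, Borel measurable, continuous, and Lipschitz (with respect to $\rho$); $\mathcal{M}_1(\mathcal{X})$ is the set of Borel probability measures on $\mathcal{X}$. A Markov semigroup $\{P_t\}_{t\in T}$ on $\mathcal{X}$ is a family of operators on $B_b(\mathcal{X})$ given by Markov transition kernels $P_t(x,\cdot)\in\mathcal{M}_1(\mathcal{X})$ (measurable in $x$) via $P_tf(x)=\int_{\mathcal{X}}f(y)\,P_t(x,dy)$, with $P_{t+s}=P_tP_s$ for $s,t\in T$ (and $P_0$ the identity if $0\in T$); in particular $P_t(x,B)=P_t\mathbf{1}_B(x)$. It is a Markov-Feller semigroup if in addition $P_t(C_b(\mathcal{X}))\subset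 C_b(\mathcal{X})$ for every $t\in T$. The dual semigroup acts on $\mathcal{M}_1(\mathcal{X})$ and is denoted by the same symbol: $P_t\nu(B)=\int_{\mathcal{X}}P_t\mathbf{1}_B\,d\nu$ for $\nu\in\mathcal{M}_1(\mathcal{X})$, $B\in\mathcal{B}(\mathcal{X})$. A measure $\mu\in\mathcal{M}_1(\mathcal{X})$ is invariant if $P_t\mu=\mu$ for all $t\in T$. Asymptotic stability: $\{P_t\}_{t\in T}$ is asymptotically stable if there exists a unique invariant measure $\mu\in\mathcal{M}_1(\mathcal{X})$, and $P_t\nu$ converges weakly to $\mu$ as $t\to\infty$ for every $\nu\in\mathcal{M}_1(\mathcal{X})$. Eventual continuity: $\{P_t\}_{t\in T}$ is eventually continuous if for any $z\in\mathcal{X}$ and any $f\in L_b(\mathcal{X})$, $$\lim_{x\to z}\limsup_{t\to\infty}|P_tf(x)-P_tf(z)|=0.$$ *)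

theory Defs
  imports "HOL-Probability.Probability"
begin

definition B_b :: "('a::metric_space \<Rightarrow> real) set" where
  "B_b = {f. f \<in> borel_measurable borel \<and> bounded (range f)}"

definition C_b :: "('a::metric_space \<Rightarrow> real) set" where
  "C_b = {f. continuous_on UNIV f \<and> bounded (range f)}"

definition L_b :: "('a::metric_space \<Rightarrow> real) set" where
  "L_b = {f. (\<exists>L. L-lipschitz_on UNIV f) \<and> bounded (range f)}"

abbreviation M_1 :: "'a::metric_space measure set" where
  "M_1 \<equiv> space (prob_algebra borel)"

definition kernel_op :: "('a::metric_space \<Rightarrow> 'a measure) \<Rightarrow> ('a \<Rightarrow> real) \<Rightarrow> 'a \<Rightarrow> real" where
  "kernel_op K f x = (\<integral>y. f y \<partial>K x)"

text \<open>The dual action on measures is the Giry bind; the lemma \<open>measure_dual_op\<close> below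
  confirms that it is given by integrating \<open>kernel_op K (indicator B)\<close> against the measure.\<close>

definition dual_op :: "('a::metric_space \<Rightarrow> 'a measure) \<Rightarrow> 'a measure \<Rightarrow> 'a measure" where
  "dual_op K \<nu> = \<nu> \<bind> K"

lemma measure_dual_op:
  fixes K :: "'a::metric_space \<Rightarrow> 'a measure"
  assumes K: "K \<in> borel \<rightarrow>\<^sub>M prob_algebra borel" and \<nu>: "\<nu> \<in> M_1" and B: "B \<in> sets borel"
  shows "measure (dual_op K \<nu>) B = (\<integral>x. kernel_op K (indicator B) x \<partial>\<nu>)"
proof -
  have s: "sets \<nu> = sets borel" and p: "prob_space \<nu>"
    using \<nu> by (auto simp: space_prob_algebra)
  interpret prob_space \<nu> by (rule p)
  have K': "K \<in> \<nu> \<rightarrow>\<^sub>M subprob_algebra borel"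
    using measurable_prob_algebraD[OF K] s by (simp cong: measurable_cong_sets)
  have sK: "sets (K x) = sets borel" for x
    using measurable_space[OF K, of x] by (auto simp: space_prob_algebra)
  have "measure (dual_op K \<nu>) B = (\<integral>x. measure (K x) B \<partial>\<nu>)"
    unfolding dual_op_def using subprob_space_axioms K' B
    by (intro subprob_space.measure_bind) auto
  also have "\<dots> = (\<integral>x. kernel_op K (indicator B) x \<partial>\<nu>)"
    unfolding kernel_op_def using sK sets_eq_imp_space_eq[OF sK] by simp
  finally show ?thesis .
qed

text \<open>Time sets are subsets \<open>T\<close> of the reals, so that continuous and discrete time are treated
  uniformly; \<open>P t\<close> is only constrained for \<open>t \<in> T\<close>.  The kernel \<open>P\<^sub>t(x, \<cdot>)\<close> is \<open>P t x\<close>.\<close>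

definition markov_semigroup :: "real set \<Rightarrow> (real \<Rightarrow> 'a::metric_space \<Rightarrow> 'a measure) \<Rightarrow> bool" where
  "markov_semigroup T P \<longleftrightarrow>
    (\<forall>t\<in>T. P t \<in> borel \<rightarrow>\<^sub>M prob_algebra borel) \<and>
    (\<forall>s\<in>T. \<forall>t\<in>T. \<forall>f\<in>B_b. kernel_op (P (t + s)) f = kernel_op (P t) (kernel_op (P s) f)) \<and>
    (0 \<in> T \<longrightarrow> (\<forall>f\<in>B_b. kernel_op (P 0) f = f))"

definition markov_feller_semigroup ::
    "real set \<Rightarrow> (real \<Rightarrow> 'a::metric_space \<Rightarrow> 'a measure) \<Rightarrow> bool" where
  "markov_feller_semigroup T P \<longleftrightarrow>
    markov_semigroup T P \<and> (\<forall>t\<in>T. kernel_op (P t) ` C_b \<subseteq> C_b)"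

text \<open>The filter for \<open>t \<rightarrow> \<infinity>\<close> with \<open>t\<close> ranging over \<open>T\<close>.\<close>

definition at_top_in :: "real set \<Rightarrow> real filter" where
  "at_top_in T = inf at_top (principal T)"

definition invariant_measure ::
    "real set \<Rightarrow> (real \<Rightarrow> 'a::metric_space \<Rightarrow> 'a measure) \<Rightarrow> 'a measure \<Rightarrow> bool" where
  "invariant_measure T P \<mu> \<longleftrightarrow> \<mu> \<in> M_1 \<and> (\<forall>t\<in>T. dual_op (P t) \<mu> = \<mu>)"

definition converges_weakly ::
    "('i \<Rightarrow> 'a::metric_space measure) \<Rightarrow> 'a measure \<Rightarrow> 'i filter \<Rightarrow> bool" where
  "converges_weakly N \<mu> F \<longleftrightarrow> (\<forall>f\<in>C_b. ((\<lambda>i. \<integral>x. f x \<partial>N i) \<longlongrightarrow> (\<integral>x. f x \<partial>\<mu>)) F)"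

definition asymptotically_stable ::
    "real set \<Rightarrow> (real \<Rightarrow> 'a::metric_space \<Rightarrow> 'a measure) \<Rightarrow> bool" where
  "asymptotically_stable T P \<longleftrightarrow>
    (\<exists>\<mu>. invariant_measure T P \<mu> \<and> (\<forall>\<mu>'. invariant_measure T P \<mu>' \<longrightarrow> \<mu>' = \<mu>) \<and>
         (\<forall>\<nu>\<in>M_1. converges_weakly (\<lambda>t. dual_op (P t) \<nu>) \<mu> (at_top_in T)))"

definition eventually_continuous ::
    "real set \<Rightarrow> (real \<Rightarrow> 'a::metric_space \<Rightarrow> 'a measure) \<Rightarrow> bool" where
  "eventually_continuous T P \<longleftrightarrow>
    (\<forall>z. \<forall>f\<in>L_b.
      ((\<lambda>x. Limsup (at_top_in T) (\<lambda>t. ereal \<bar>kernel_op (P t) f x - kernel_op (P t) f z\<bar>))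
        \<longlongrightarrow> 0) (at z))"

end

theory Submission
  imports Defs
begin

text \<open>
  The direction from stability to the two conditions is immediate: all evolved functions
  \<open>kernel_op (P t) f x\<close> converge to the same number \<open>\<integral> f \<partial>\<mu>\<close>, and any point \<open>z\<close> of the
  support of \<open>\<mu>\<close> satisfies the lower bound.

  Conversely, the lower bound at \<open>z\<close> lets two copies of the process, started from arbitrary laws,
  place a fixed fraction of their mass near \<open>z\<close> at a common time.  Eventual continuity at \<open>z\<close>
  makes these fractions indistinguishable for a given Lipschitz function later on, and the same
  argument applies again to the remainders.  Hence the process forgets its initial law (theorem
  \<open>forgetting\<close>), which gives uniqueness and, given an invariant measure, convergence.

  The existence of an invariant measure needs tightness of \<open>P t z\<close> for large \<open>t\<close> (theorem
  \<open>asymptotically_tight\<close>).  If mass kept escaping, one could catch portions of it in disjoint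
  Lipschitz bumps.  Forgetting, applied to the sums of all subfamilies of bumps, yields by a gliding
  hump argument (\<open>schur_diagonal\<close>) that every starting point feeds late bumps as much as \<open>z\<close>
  does; Baire's theorem makes this uniform on an open piece of the support, to which the
  process returns from \<open>z\<close> at all late times with probability bounded below.  Then many disjoint
  bumps would carry a fixed mass simultaneously, which is absurd.

  Tightness makes every limit of \<open>P t z\<close> along a subfilter a smooth positive functional
  (\<open>asymptotically_smooth\<close>), which is an integral by the Daniell construction
  (\<open>daniell_functional.representation\<close>), and the measure so obtained is invariant because
  the laws \<open>P s z\<close> and the point mass at \<open>z\<close> are both forgotten.
\<close>

section \<open>Bounded functions\<close>

lemma C_bI: "continuous_on UNIV f \<Longrightarrow> (\<And>x. \<bar>f x\<bar> \<le> C) \<Longrightarrow> f \<in> C_b"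
  unfolding C_b_def bounded_iff by auto

lemma L_bI: "L-lipschitz_on UNIV f \<Longrightarrow> (\<And>x. \<bar>f x\<bar> \<le> C) \<Longrightarrow> f \<in> L_b"
  unfolding L_b_def bounded_iff by auto

lemma C_b_cont: "f \<in> C_b \<Longrightarrow> continuous_on S f"
  unfolding C_b_def by (auto intro: continuous_on_subset)

lemma L_b_C_b: "f \<in> L_b \<Longrightarrow> f \<in> C_b"
  unfolding L_b_def C_b_def by (auto intro: lipschitz_on_continuous_on)

lemma C_b_B_b: "f \<in> C_b \<Longrightarrow> f \<in> B_b"
  unfolding B_b_def C_b_def by (auto intro: borel_measurable_continuous_onI)

lemma B_b_meas: "f \<in> B_b \<Longrightarrow> f \<in> borel_measurable borel"
  unfolding B_b_def by auto

lemma B_b_bound: "f \<in> B_b \<Longrightarrow> \<exists>C>0. \<forall>x. \<bar>f x\<bar> \<le> C"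
  unfolding B_b_def bounded_pos by auto

lemma B_bI: "f \<in> borel_measurable borel \<Longrightarrow> (\<And>x. \<bar>f x\<bar> \<le> C) \<Longrightarrow> f \<in> B_b"
  unfolding B_b_def bounded_iff by auto

lemma C_b_bound: "f \<in> C_b \<Longrightarrow> \<exists>C>0. \<forall>x. \<bar>f x\<bar> \<le> C"
  by (intro B_b_bound C_b_B_b)

lemma C_b_const: "(\<lambda>_. c) \<in> C_b"
  by (rule C_bI[of _ "\<bar>c\<bar>"]) auto

lemma C_b_add:
  assumes "f \<in> C_b" "g \<in> C_b" shows "(\<lambda>x. f x + g x) \<in> C_b"
proof -
  obtain C D where *: "\<And>x. \<bar>f x\<bar> \<le> C" "\<And>x. \<bar>g x\<bar> \<le> D"
    using C_b_bound[OF assms(1)] C_b_bound[OF assms(2)] by blast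
  then have "\<bar>f x + g x\<bar> \<le> C + D" for x using *[of x] by linarith
  then show ?thesis by (intro C_bI[of _ "C + D"] continuous_intros) (simp_all add: C_b_cont assms)
qed

lemma C_b_cmult:
  assumes "f \<in> C_b" shows "(\<lambda>x. c * f x) \<in> C_b"
proof -
  obtain C where *: "\<And>x. \<bar>f x\<bar> \<le> C" using C_b_bound[OF assms] by blast
  then have "\<bar>c * f x\<bar> \<le> \<bar>c\<bar> * C" for x using *[of x] by (simp add: abs_mult mult_left_mono)
  then show ?thesis by (intro C_bI[of _ "\<bar>c\<bar> * C"] continuous_intros) (simp_all add: C_b_cont assms)
qed

lemma C_b_diff:
  assumes "f \<in> C_b" "g \<in> C_b" shows "(\<lambda>x. f x - g x) \<in> C_b"
  using C_b_add[OF assms(1) C_b_cmult[OF assms(2), of "-1"]] by simp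

lemma C_b_max:
  assumes "f \<in> C_b" "g \<in> C_b" shows "(\<lambda>x. max (f x) (g x)) \<in> C_b"
proof -
  obtain C D where *: "\<And>x. \<bar>f x\<bar> \<le> C" "\<And>x. \<bar>g x\<bar> \<le> D"
    using C_b_bound[OF assms(1)] C_b_bound[OF assms(2)] by blast
  have "\<bar>max (f x) (g x)\<bar> \<le> C + D" for x using *[of x] by linarith
  then show ?thesis by (intro C_bI[of _ "C + D"] continuous_intros) (simp_all add: C_b_cont assms)
qed

lemma C_b_min:
  assumes "f \<in> C_b" "g \<in> C_b" shows "(\<lambda>x. min (f x) (g x)) \<in> C_b"
proof -
  obtain C D where *: "\<And>x. \<bar>f x\<bar> \<le> C" "\<And>x. \<bar>g x\<bar> \<le> D"
    using C_b_bound[OF assms(1)] C_b_bound[OF assms(2)] by blast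
  have "\<bar>min (f x) (g x)\<bar> \<le> C + D" for x using *[of x] by linarith
  then show ?thesis by (intro C_bI[of _ "C + D"] continuous_intros) (simp_all add: C_b_cont assms)
qed

lemma C_b_sum:
  assumes "\<And>i. i \<in> I \<Longrightarrow> f i \<in> C_b" shows "(\<lambda>x. \<Sum>i\<in>I. f i x) \<in> C_b"
  using assms by (induction I rule: infinite_finite_induct) (auto intro: C_b_const C_b_add)

lemma B_b_const: "(\<lambda>_. c) \<in> B_b" by (intro C_b_B_b C_b_const)

lemma B_b_indicator: "B \<in> sets borel \<Longrightarrow> indicator B \<in> B_b"
  by (rule B_bI[of _ 1]) (auto simp: indicator_def)

lemma B_b_times:
  assumes "f \<in> B_b" "g \<in> B_b" shows "(\<lambda>x. f x * g x) \<in> B_b"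
proof -
  obtain C D where *: "\<And>x. \<bar>f x\<bar> \<le> C" "\<And>x. \<bar>g x\<bar> \<le> D"
    using B_b_bound[OF assms(1)] B_b_bound[OF assms(2)] by blast
  then have "\<bar>f x * g x\<bar> \<le> C * D" for x
    unfolding abs_mult by (meson abs_ge_zero mult_mono order_trans)
  then show ?thesis
    using B_b_meas[OF assms(1)] B_b_meas[OF assms(2)] by (intro B_bI[of _ "C * D"]) measurable
qed

lemma B_b_diff:
  assumes "f \<in> B_b" "g \<in> B_b" shows "(\<lambda>x. f x - g x) \<in> B_b"
proof -
  obtain C D where *: "\<And>x. \<bar>f x\<bar> \<le> C" "\<And>x. \<bar>g x\<bar> \<le> D"
    using B_b_bound[OF assms(1)] B_b_bound[OF assms(2)] by blast
  have "\<bar>f x - g x\<bar> \<le> C + D" for x using *[of x] by linarith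
  then show ?thesis
    using B_b_meas[OF assms(1)] B_b_meas[OF assms(2)] by (intro B_bI[of _ "C + D"]) measurable
qed

section \<open>Daniell functionals on bounded continuous functions\<close>

lemma open_approx_lipschitz:
  fixes U :: "'a::metric_space set"
  assumes "open U"
  obtains h :: "nat \<Rightarrow> 'a \<Rightarrow> real" where
    "\<And>n. h n \<in> L_b" "\<And>n x. 0 \<le> h n x" "\<And>n x. h n x \<le> 1" "\<And>n x. x \<notin> U \<Longrightarrow> h n x = 0"
    "\<And>x. incseq (\<lambda>n. h n x)" "\<And>x. (\<lambda>n. h n x) \<longlonglongrightarrow> indicator U x"
proof (cases "U = UNIV")
  case True
  show ?thesis
    by (rule that[of "\<lambda>_ _. 1"]) (auto simp: True incseq_def intro!: L_bI[of 0 _ 1] lipschitz_intros)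
next
  case False
  define h where "h n x = min 1 (real n * infdist x (-U))" for n x
  show ?thesis
  proof (rule that[of h])
    fix n x
    show "h n \<in> L_b" for n
    proof (rule L_bI[of "real n" _ 1])
      show "(real n)-lipschitz_on UNIV (h n)"
      proof (rule lipschitz_onI)
        fix x y
        have "\<bar>infdist x (-U) - infdist y (-U)\<bar> \<le> dist x y" by (rule infdist_triangle_abs)
        then have "\<bar>real n * infdist x (-U) - real n * infdist y (-U)\<bar> \<le> real n * dist x y"
          by (metis abs_mult abs_of_nat mult_left_mono of_nat_0_le_iff right_diff_distrib)
        then show "dist (h n x) (h n y) \<le> real n * dist x y"
          unfolding h_def dist_real_def by linarith
      qed auto
      show "\<bar>h n x\<bar> \<le> 1" for x unfolding h_def by (simp add: infdist_nonneg)
    qed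
    show "0 \<le> h n x" "h n x \<le> 1" for n x unfolding h_def by (auto simp: infdist_nonneg)
    show "h n x = 0" if "x \<notin> U" for n x using that unfolding h_def by simp
    show "incseq (\<lambda>n. h n x)" for x unfolding h_def incseq_def
      by (intro allI impI min.mono mult_right_mono) (auto simp: infdist_nonneg)
    show "(\<lambda>n. h n x) \<longlonglongrightarrow> indicator U x" for x
    proof (cases "x \<in> U")
      case True
      have "closed (-U)" "-U \<noteq> {}" using assms False by auto
      then have "infdist x (-U) > 0"
        using True by (metis ComplD infdist_nonneg in_closed_iff_infdist_zero less_eq_real_def)
      moreover obtain N where "real N > 1 / infdist x (-U)" using reals_Archimedean2 by blast
      ultimately have N: "real N * infdist x (-U) > 1" by (simp add: divide_less_eq)
      have "h n x = 1" if "n \<ge> N" for n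
      proof -
        have "real N * infdist x (-U) \<le> real n * infdist x (-U)"
          using that by (intro mult_right_mono) (auto simp: infdist_nonneg)
        then show ?thesis using N unfolding h_def by simp
      qed
      then show ?thesis using True
        by (intro tendsto_eventually) (auto simp: eventually_sequentially)
    qed (simp add: h_def)
  qed
qed

definition open_content :: "(('a::metric_space \<Rightarrow> real) \<Rightarrow> real) \<Rightarrow> 'a set \<Rightarrow> ennreal" where
  "open_content \<Lambda> U = (SUP f\<in>{f\<in>C_b. \<forall>x. 0 \<le> f x \<and> f x \<le> indicator U x}. ennreal (\<Lambda> f))"

definition outer_content :: "(('a::metric_space \<Rightarrow> real) \<Rightarrow> real) \<Rightarrow> 'a set \<Rightarrow> ennreal" where
  "outer_content \<Lambda> A = (INF U\<in>{U. open U \<and> A \<subseteq> U}. open_content \<Lambda> U)"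

text \<open>
  The functional plays the role of an integral against a measure still to be found: axiom \<open>smooth\<close>,
  continuity along sequences decreasing to zero, is what turns into countable additivity.  The measure
  is built from outside in, open sets first, then infima over open supersets; Caratheodory's lemma does
  the rest once open sets are shown to split every set additively.
\<close>

locale daniell_functional =
  fixes \<Lambda> :: "('a::metric_space \<Rightarrow> real) \<Rightarrow> real"
  assumes add: "\<And>f g. f \<in> C_b \<Longrightarrow> g \<in> C_b \<Longrightarrow> \<Lambda> (\<lambda>x. f x + g x) = \<Lambda> f + \<Lambda> g"
    and cmult: "\<And>f c. f \<in> C_b \<Longrightarrow> \<Lambda> (\<lambda>x. c * f x) = c * \<Lambda> f"
    and mono: "\<And>f g. f \<in> C_b \<Longrightarrow> g \<in> C_b \<Longrightarrow> (\<And>x. f x \<le> g x) \<Longrightarrow> \<Lambda> f \<le> \<Lambda> g"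
    and one: "\<Lambda> (\<lambda>_. 1) = 1"
    and smooth: "\<And>F. (\<And>n::nat. F n \<in> C_b) \<Longrightarrow> (\<And>x. decseq (\<lambda>n. F n x)) \<Longrightarrow>
        (\<And>x. (\<lambda>n. F n x) \<longlonglongrightarrow> 0) \<Longrightarrow> (\<lambda>n. \<Lambda> (F n)) \<longlonglongrightarrow> 0"
begin

lemma const: "\<Lambda> (\<lambda>_. c) = c"
  using cmult[OF C_b_const[of 1], of c] one by simp

lemma diff: "f \<in> C_b \<Longrightarrow> g \<in> C_b \<Longrightarrow> \<Lambda> (\<lambda>x. f x - g x) = \<Lambda> f - \<Lambda> g"
  using add[OF _ C_b_cmult[of g "-1"]] cmult[of g "-1"] by simp

lemma nonneg: "f \<in> C_b \<Longrightarrow> (\<And>x. 0 \<le> f x) \<Longrightarrow> 0 \<le> \<Lambda> f"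
  using mono[OF C_b_const[of 0], of f] const[of 0] by simp

lemma sum: "(\<And>i. i \<in> I \<Longrightarrow> f i \<in> C_b) \<Longrightarrow> \<Lambda> (\<lambda>x. \<Sum>i\<in>I. f i x) = (\<Sum>i\<in>I. \<Lambda> (f i))"
  by (induction I rule: infinite_finite_induct) (auto simp: const add C_b_sum)

lemma content_upper:
  "f \<in> C_b \<Longrightarrow> (\<And>x. 0 \<le> f x) \<Longrightarrow> (\<And>x. f x \<le> indicator U x) \<Longrightarrow> ennreal (\<Lambda> f) \<le> open_content \<Lambda> U"
  unfolding open_content_def by (intro SUP_upper) auto

lemma content_least:
  "(\<And>f. f \<in> C_b \<Longrightarrow> (\<And>x. 0 \<le> f x) \<Longrightarrow> (\<And>x. f x \<le> indicator U x) \<Longrightarrow> ennreal (\<Lambda> f) \<le> b) \<Longrightarrow>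
    open_content \<Lambda> U \<le> b"
  unfolding open_content_def by (intro SUP_least) auto

lemma content_mono: "U \<subseteq> V \<Longrightarrow> open_content \<Lambda> U \<le> open_content \<Lambda> V"
proof (intro content_least content_upper)
  fix f :: "'a \<Rightarrow> real" and x assume UV: "U \<subseteq> V" and f: "\<And>x. f x \<le> indicator U x"
  have "f x \<le> indicator U x" by (rule f)
  also have "\<dots> \<le> indicator V x" using UV by (auto simp: indicator_def)
  finally show "f x \<le> indicator V x" .
qed

lemma content_empty: "open_content \<Lambda> {} = 0"
proof -
  have "open_content \<Lambda> {} \<le> 0"
  proof (rule content_least)
    fix f :: "'a \<Rightarrow> real" assume "\<And>x. 0 \<le> f x" "\<And>x. f x \<le> indicator {} x"
    then have "f = (\<lambda>_. 0)" by (intro ext) (simp add: order_antisym)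
    then show "ennreal (\<Lambda> f) \<le> 0" using const[of 0] by simp
  qed
  then show ?thesis by simp
qed

lemma content_UNIV: "open_content \<Lambda> UNIV = 1"
proof (rule antisym)
  show "open_content \<Lambda> UNIV \<le> 1"
  proof (rule content_least)
    fix f :: "'a \<Rightarrow> real" assume "f \<in> C_b" "\<And>x. f x \<le> indicator UNIV x"
    then show "ennreal (\<Lambda> f) \<le> 1" using mono[of f "\<lambda>_. 1"] C_b_const[of 1] one by simp
  qed
  show "1 \<le> open_content \<Lambda> UNIV"
    using content_upper[OF C_b_const[of 1], of UNIV] one by simp
qed

text \<open>
  If \<open>f\<close> lies below the indicator of a countable union, then the minima of \<open>f\<close> with finite sums of
  continuous approximations to the indicators of the pieces increase to \<open>f\<close>.  The error thus
  decreases to zero pointwise, and \<open>smooth\<close> makes its \<open>\<Lambda>\<close>-value negligible.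
\<close>

lemma content_subadditive:
  assumes op: "\<And>i::nat. open (U i)"
  shows "open_content \<Lambda> (\<Union>i. U i) \<le> (\<Sum>i. open_content \<Lambda> (U i))"
proof (rule content_least)
  fix f :: "'a \<Rightarrow> real"
  assume f: "f \<in> C_b" "\<And>x. 0 \<le> f x" "\<And>x. f x \<le> indicator (\<Union>i. U i) x"
  have "\<exists>h. (\<forall>n. h n \<in> C_b) \<and> (\<forall>n x. 0 \<le> h n x) \<and> (\<forall>n x. h n x \<le> 1) \<and>
      (\<forall>n x. x \<notin> U i \<longrightarrow> h n x = 0) \<and> (\<forall>x. incseq (\<lambda>n. h n x)) \<and>
      (\<forall>x. (\<lambda>n. h n x) \<longlonglongrightarrow> indicator (U i) x)" for i
    by (rule open_approx_lipschitz[OF op[of i]]) (metis L_b_C_b)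
  then obtain h :: "nat \<Rightarrow> nat \<Rightarrow> 'a \<Rightarrow> real"
    where h: "\<And>i n. h i n \<in> C_b" "\<And>i n x. 0 \<le> h i n x" "\<And>i n x. h i n x \<le> 1"
      "\<And>i n x. x \<notin> U i \<Longrightarrow> h i n x = 0" "\<And>i x. incseq (\<lambda>n. h i n x)"
      "\<And>i x. (\<lambda>n. h i n x) \<longlonglongrightarrow> indicator (U i) x" by metis
  define S where "S n x = (\<Sum>i<n. h i n x)" for n x
  define \<Phi> where "\<Phi> n x = min (f x) (S n x)" for n x
  have S: "S n \<in> C_b" for n unfolding S_def[abs_def] by (intro C_b_sum h)
  have \<Phi>: "\<Phi> n \<in> C_b" for n unfolding \<Phi>_def[abs_def] by (intro C_b_min f S)
  have S_mono: "S m x \<le> S n x" if "m \<le> n" for m n x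
  proof -
    have "S m x \<le> (\<Sum>i<m. h i n x)" unfolding S_def
      by (intro sum_mono incseqD[OF h(5)] that)
    also have "\<dots> \<le> S n x" unfolding S_def using that h(2) by (intro sum_mono2) auto
    finally show ?thesis .
  qed
  have "(\<lambda>n. \<Lambda> (\<lambda>x. f x - \<Phi> n x)) \<longlonglongrightarrow> 0"
  proof (rule smooth)
    show "(\<lambda>x. f x - \<Phi> n x) \<in> C_b" for n by (intro C_b_diff f \<Phi>)
    show "decseq (\<lambda>n. f x - \<Phi> n x)" for x
    proof (rule decseq_SucI)
      fix n show "f x - \<Phi> (Suc n) x \<le> f x - \<Phi> n x"
        using S_mono[of n "Suc n" x] unfolding \<Phi>_def by linarith
    qed
    show "(\<lambda>n. f x - \<Phi> n x) \<longlonglongrightarrow> 0" for x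
    proof (cases "x \<in> (\<Union>i. U i)")
      case True
      then obtain i where i: "x \<in> U i" by auto
      have "(\<lambda>n. 1 - h i n x) \<longlonglongrightarrow> 0"
        using tendsto_diff[OF tendsto_const[of 1] h(6)[of i x]] i by simp
      then show ?thesis
      proof (rule tendsto_sandwich[OF _ _ tendsto_const, rotated 2])
        show "\<forall>\<^sub>F n in sequentially. 0 \<le> f x - \<Phi> n x" unfolding \<Phi>_def by auto
        have "f x - \<Phi> n x \<le> 1 - h i n x" if "n > i" for n
        proof -
          have "h i n x \<le> S n x" unfolding S_def
            using that h(2) by (intro member_le_sum[of i "{..<n}" "\<lambda>i. h i n x"]) auto
          moreover have "f x \<le> 1" using f(3)[of x] by (meson indicator_le_1 order_trans)
          ultimately show ?thesis using h(3)[of i n x] unfolding \<Phi>_def by linarith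
        qed
        then show "\<forall>\<^sub>F n in sequentially. f x - \<Phi> n x \<le> 1 - h i n x"
          unfolding eventually_sequentially by (meson Suc_le_lessD)
      qed
    next
      case False
      then have "f x = 0" using f(2)[of x] f(3)[of x] by auto
      moreover have "S n x \<ge> 0" for n unfolding S_def by (intro sum_nonneg h)
      ultimately show ?thesis unfolding \<Phi>_def by (simp add: min_def)
    qed
  qed
  then have lim: "(\<lambda>n. ennreal (\<Lambda> (\<lambda>x. f x - \<Phi> n x)) + (\<Sum>i. open_content \<Lambda> (U i)))
      \<longlonglongrightarrow> ennreal 0 + (\<Sum>i. open_content \<Lambda> (U i))"
    by (intro tendsto_intros) auto
  have "ennreal (\<Lambda> f) \<le> ennreal (\<Lambda> (\<lambda>x. f x - \<Phi> n x)) + (\<Sum>i. open_content \<Lambda> (U i))" for n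
  proof -
    have "\<Lambda> f = \<Lambda> (\<lambda>x. f x - \<Phi> n x) + \<Lambda> (\<Phi> n)" using diff[OF f(1) \<Phi>] by simp
    also have "\<Lambda> (\<Phi> n) \<le> \<Lambda> (S n)" by (intro mono \<Phi> S) (simp add: \<Phi>_def)
    also have "\<Lambda> (S n) = (\<Sum>i<n. \<Lambda> (h i n))" unfolding S_def[abs_def] by (intro sum h)
    finally have *: "\<Lambda> f \<le> \<Lambda> (\<lambda>x. f x - \<Phi> n x) + (\<Sum>i<n. \<Lambda> (h i n))" by simp
    have 0: "0 \<le> \<Lambda> (h i n)" for i by (intro nonneg h)
    have 1: "0 \<le> \<Lambda> (\<lambda>x. f x - \<Phi> n x)" by (intro nonneg C_b_diff f \<Phi>) (simp add: \<Phi>_def)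
    have "ennreal (\<Lambda> f) \<le> ennreal (\<Lambda> (\<lambda>x. f x - \<Phi> n x)) + (\<Sum>i<n. ennreal (\<Lambda> (h i n)))"
      using * 0 1 by (simp add: sum_nonneg flip: ennreal_plus)
    also have "(\<Sum>i<n. ennreal (\<Lambda> (h i n))) \<le> (\<Sum>i<n. open_content \<Lambda> (U i))"
    proof (intro sum_mono content_upper h)
      fix i x show "h i n x \<le> indicator (U i) x"
        using h(3)[of i n x] h(4)[of x i n] by (cases "x \<in> U i") auto
    qed
    also have "\<dots> \<le> (\<Sum>i. open_content \<Lambda> (U i))" by (intro sum_le_suminf) auto
    finally show ?thesis by (simp add: add_left_mono)
  qed
  then show "ennreal (\<Lambda> f) \<le> (\<Sum>i. open_content \<Lambda> (U i))"
    using LIMSEQ_le_const[OF lim, of "ennreal (\<Lambda> f)"] by auto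
qed

lemma outer_content_open: "open U \<Longrightarrow> outer_content \<Lambda> U = open_content \<Lambda> U"
  unfolding outer_content_def
  by (intro antisym INF_lower INF_greatest content_mono) auto

lemma outer_content_mono: "A \<subseteq> B \<Longrightarrow> outer_content \<Lambda> A \<le> outer_content \<Lambda> B"
  unfolding outer_content_def by (intro INF_superset_mono) auto

lemma outer_content_approx:
  assumes "e > 0"
  obtains U where "open U" "A \<subseteq> U" "open_content \<Lambda> U \<le> outer_content \<Lambda> A + ennreal e"
proof -
  have "outer_content \<Lambda> A \<le> 1"
    using outer_content_mono[of A UNIV] content_UNIV outer_content_open[of UNIV] by simp
  then have "outer_content \<Lambda> A < outer_content \<Lambda> A + ennreal e"
    using assms by (metis ennreal_add_left_cancel_less ennreal_less_zero_iff
      ennreal_one_less_top infinity_ennreal_def leD le_zero_eq add.right_neutral less_le not_less top.not_eq_extremum zero_less_iff_neq_zero)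
  then show ?thesis
    using that unfolding outer_content_def INF_less_iff by (metis (mono_tags, lifting) less_imp_le mem_Collect_eq)
qed

lemma outer_content_outer_measure: "outer_measure_space (Pow UNIV) (outer_content \<Lambda>)"
  unfolding outer_measure_space_def
proof (intro conjI)
  show "positive (Pow UNIV) (outer_content \<Lambda>)"
    unfolding positive_def using outer_content_open[of "{}"] content_empty by simp
  show "increasing (Pow UNIV) (outer_content \<Lambda>)"
    unfolding increasing_def using outer_content_mono by auto
  show "countably_subadditive (Pow UNIV) (outer_content \<Lambda>)"
    unfolding countably_subadditive_def
  proof safe
    fix A :: "nat \<Rightarrow> 'a set"
    show "outer_content \<Lambda> (\<Union>i. A i) \<le> (\<Sum>i. outer_content \<Lambda> (A i))"
    proof (rule ennreal_le_epsilon)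
      fix e :: real assume e: "0 < e"
      have "\<exists>U. open U \<and> A n \<subseteq> U \<and> open_content \<Lambda> U \<le> outer_content \<Lambda> (A n) + ennreal (e * (1/2)^Suc n)" for n
        using e outer_content_approx[of "e * (1/2)^Suc n" "A n"] by (metis mult_pos_pos zero_less_power half_gt_zero zero_less_one)
      then obtain U where U: "\<And>n. open (U n)" "\<And>n. A n \<subseteq> U n"
        "\<And>n. open_content \<Lambda> (U n) \<le> outer_content \<Lambda> (A n) + ennreal (e * (1/2)^Suc n)" by metis
      have "outer_content \<Lambda> (\<Union>i. A i) \<le> outer_content \<Lambda> (\<Union>i. U i)"
        using U(2) by (intro outer_content_mono) blast
      also have "\<dots> = open_content \<Lambda> (\<Union>i. U i)" using U(1) by (intro outer_content_open) auto
      also have "\<dots> \<le> (\<Sum>i. open_content \<Lambda> (U i))" by (rule content_subadditive[OF U(1)])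
      also have "\<dots> \<le> (\<Sum>n. outer_content \<Lambda> (A n) + ennreal (e * (1/2)^Suc n))"
        by (intro suminf_le U) auto
      also have "\<dots> = (\<Sum>n. outer_content \<Lambda> (A n)) + (\<Sum>n. ennreal e * ennreal ((1/2) ^ Suc n))"
        using e by (subst suminf_add[symmetric])
          (auto simp del: ennreal_suminf_cmult simp add: ennreal_mult[symmetric])
      also have "\<dots> = (\<Sum>n. outer_content \<Lambda> (A n)) + e"
        unfolding ennreal_suminf_cmult
        by (subst suminf_ennreal_eq[OF zero_le_power power_half_series]) auto
      finally show "outer_content \<Lambda> (\<Union>i. A i) \<le> (\<Sum>i. outer_content \<Lambda> (A i)) + ennreal e" .
    qed
  qed
qed

text \<open>
  Let \<open>f\<close> lie below the indicator of \<open>V \<inter> U\<close>.  Lowering \<open>f\<close> by \<open>e\<close> moves its support into the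
  closed set \<open>f \<ge> e\<close>, which leaves room for a second function supported in the open set
  \<open>V \<inter> {f < e}\<close>; this set still contains \<open>V - U\<close>, and the sum of the two stays below the
  indicator of \<open>V\<close>.
\<close>

lemma outer_content_split_open:
  assumes U: "open U" and V: "open V"
  shows "outer_content \<Lambda> (V \<inter> U) + outer_content \<Lambda> (V - U) \<le> open_content \<Lambda> V"
proof -
  have *: "ennreal (\<Lambda> f) + outer_content \<Lambda> (V - U) \<le> open_content \<Lambda> V"
    if f: "f \<in> C_b" "\<And>x. 0 \<le> f x" "\<And>x. f x \<le> indicator (V \<inter> U) x" for f :: "'a \<Rightarrow> real"
  proof (rule ennreal_le_epsilon)
    fix e :: real assume e: "e > 0"
    define f' where "f' x = max 0 (f x - e)" for x
    have f': "f' \<in> C_b" unfolding f'_def[abs_def] by (intro C_b_max C_b_diff C_b_const f)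
    define W where "W = V \<inter> {x. f x < e}"
    have W: "open W" unfolding W_def
      using V by (intro open_Int open_Collect_less C_b_cont f continuous_intros)
    have sub: "V - U \<subseteq> W"
    proof
      fix x assume "x \<in> V - U"
      then have "f x \<le> 0" using f(3)[of x] by simp
      then show "x \<in> W" using \<open>x \<in> V - U\<close> e unfolding W_def by auto
    qed
    have g: "ennreal (\<Lambda> g) \<le> open_content \<Lambda> V - ennreal (\<Lambda> f')"
      if g: "g \<in> C_b" "\<And>x. 0 \<le> g x" "\<And>x. g x \<le> indicator W x" for g :: "'a \<Rightarrow> real"
    proof -
      have "ennreal (\<Lambda> (\<lambda>x. f' x + g x)) \<le> open_content \<Lambda> V"
      proof (rule content_upper)
        show "(\<lambda>x. f' x + g x) \<in> C_b" by (intro C_b_add f' g)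
        show "0 \<le> f' x + g x" for x using g(2)[of x] unfolding f'_def by simp
        show "f' x + g x \<le> indicator V x" for x
          using g(2)[of x] g(3)[of x] f(2)[of x] f(3)[of x] e unfolding f'_def W_def
          by (auto simp: indicator_def of_bool_def max_def split: if_splits)
      qed
      moreover have "\<Lambda> (\<lambda>x. f' x + g x) = \<Lambda> f' + \<Lambda> g" by (intro add f' g)
      moreover have "0 \<le> \<Lambda> f'" "0 \<le> \<Lambda> g" by (auto intro!: nonneg f' g simp: f'_def)
      ultimately have "ennreal (\<Lambda> f') + ennreal (\<Lambda> g) \<le> open_content \<Lambda> V" by simp
      then show ?thesis
        by (metis add.commute ennreal_add_diff_cancel_right ennreal_minus_mono ennreal_neq_top infinity_ennreal_def order_refl)
    qed
    have le: "ennreal (\<Lambda> f') \<le> open_content \<Lambda> V"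
    proof (rule content_upper[OF f'])
      show "0 \<le> f' x" for x by (simp add: f'_def)
      show "f' x \<le> indicator V x" for x
        using f(2)[of x] f(3)[of x] e by (auto simp: f'_def indicator_def of_bool_def split: if_splits)
    qed
    have "outer_content \<Lambda> (V - U) \<le> open_content \<Lambda> W"
      using outer_content_mono[OF sub] outer_content_open[OF W] by simp
    also have "\<dots> \<le> open_content \<Lambda> V - ennreal (\<Lambda> f')" by (rule content_least) (rule g)
    finally have "ennreal (\<Lambda> f') + outer_content \<Lambda> (V - U) \<le> open_content \<Lambda> V"
      using le by (metis add_left_mono add_diff_inverse_ennreal)
    moreover have "\<Lambda> f \<le> \<Lambda> f' + e"
    proof -
      have "\<Lambda> f \<le> \<Lambda> (\<lambda>x. f' x + e)" by (intro mono f C_b_add f' C_b_const) (simp add: f'_def)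
      then show ?thesis using add[OF f' C_b_const, of e] const[of e] by simp
    qed
    moreover have "0 \<le> \<Lambda> f'" by (auto intro!: nonneg f' simp: f'_def)
    ultimately have "ennreal (\<Lambda> f) \<le> ennreal (\<Lambda> f') + ennreal e"
      using e by (simp flip: ennreal_plus)
    then have "ennreal (\<Lambda> f) + outer_content \<Lambda> (V - U) \<le> (ennreal (\<Lambda> f') + ennreal e) + outer_content \<Lambda> (V - U)"
      by (rule add_right_mono)
    also have "\<dots> = (ennreal (\<Lambda> f') + outer_content \<Lambda> (V - U)) + ennreal e" by (simp add: ac_simps)
    also have "\<dots> \<le> open_content \<Lambda> V + ennreal e"
      using \<open>ennreal (\<Lambda> f') + outer_content \<Lambda> (V - U) \<le> open_content \<Lambda> V\<close> by (rule add_right_mono)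
    finally show "ennreal (\<Lambda> f) + outer_content \<Lambda> (V - U) \<le> open_content \<Lambda> V + ennreal e" .
  qed
  have fin: "outer_content \<Lambda> (V - U) \<noteq> \<top>"
    using outer_content_mono[of "V - U" UNIV] content_UNIV outer_content_open[of UNIV]
    by (auto simp: top_unique)
  have "open_content \<Lambda> (V \<inter> U) \<le> open_content \<Lambda> V - outer_content \<Lambda> (V - U)"
    by (rule content_least) (use * fin in \<open>metis ennreal_add_diff_cancel_right ennreal_minus_mono order_refl\<close>)
  moreover have "outer_content \<Lambda> (V - U) \<le> open_content \<Lambda> V"
    using outer_content_mono[of "V - U" V] outer_content_open[OF V] by auto
  ultimately show ?thesis
    using outer_content_open[of "V \<inter> U"] U V
    by (metis add.commute add_left_mono add_diff_inverse_ennreal open_Int)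
qed

lemma open_in_lambda_system:
  assumes "open U" shows "U \<in> lambda_system UNIV (Pow UNIV) (outer_content \<Lambda>)"
  unfolding lambda_system_def
proof safe
  fix A :: "'a set"
  show "outer_content \<Lambda> (U \<inter> A) + outer_content \<Lambda> ((UNIV - U) \<inter> A) = outer_content \<Lambda> A"
  proof (rule antisym)
    have "outer_content \<Lambda> (U \<inter> A) + outer_content \<Lambda> ((UNIV - U) \<inter> A) \<le> open_content \<Lambda> V"
      if V: "open V" "A \<subseteq> V" for V
    proof -
      have "outer_content \<Lambda> (U \<inter> A) + outer_content \<Lambda> ((UNIV - U) \<inter> A)
          \<le> outer_content \<Lambda> (V \<inter> U) + outer_content \<Lambda> (V - U)"
        using V(2) by (intro add_mono outer_content_mono) auto
      then show ?thesis using outer_content_split_open[OF assms V(1)] by simp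
    qed
    then show "outer_content \<Lambda> (U \<inter> A) + outer_content \<Lambda> ((UNIV - U) \<inter> A) \<le> outer_content \<Lambda> A"
      unfolding outer_content_def[of \<Lambda> A] by (intro INF_greatest) auto
    interpret sigma_algebra UNIV "Pow (UNIV :: 'a set)" by (rule sigma_algebra_Pow)
    have "subadditive (Pow UNIV) (outer_content \<Lambda>)"
      using outer_content_outer_measure unfolding outer_measure_space_def
      by (intro countably_subadditive_subadditive) auto
    from subadditiveD[OF this, of "U \<inter> A" "(UNIV - U) \<inter> A"]
    have "outer_content \<Lambda> ((U \<inter> A) \<union> ((UNIV - U) \<inter> A)) \<le> outer_content \<Lambda> (U \<inter> A) + outer_content \<Lambda> ((UNIV - U) \<inter> A)"
      by auto
    moreover have "(U \<inter> A) \<union> ((UNIV - U) \<inter> A) = A" by auto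
    ultimately show "outer_content \<Lambda> A \<le> outer_content \<Lambda> (U \<inter> A) + outer_content \<Lambda> ((UNIV - U) \<inter> A)"
      by simp
  qed
qed auto


text \<open>
  Layer-cake estimate: \<open>n f\<close> is the sum of its \<open>n\<close> unit slices, and the slice between the
  levels \<open>i/n\<close> and \<open>(i+1)/n\<close> is supported where \<open>f\<close> exceeds \<open>i/n\<close>.
\<close>

lemma content_slices:
  assumes f: "f \<in> C_b" "\<And>x. 0 \<le> f x" "\<And>x. f x \<le> 1" and n: "n > 0"
  shows "ennreal (\<Lambda> f) \<le> (\<Sum>i<n. ennreal (1 / real n) * open_content \<Lambda> {x. real i / real n < f x})"
proof -
  define s where "s i x = min 1 (max 0 (real n * f x - real i))" for i x
  have s: "s i \<in> C_b" for i
    unfolding s_def[abs_def] by (intro C_b_min C_b_max C_b_diff C_b_cmult C_b_const f)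
  have *: "(\<Sum>i<k. s i x) = min (real k) (real n * f x)" for k x
  proof (induction k)
    case 0 then show ?case using f(2)[of x] by simp
  next
    case (Suc k)
    then have "(\<Sum>i<Suc k. s i x) = min (real k) (real n * f x) + s k x" by simp
    also have "\<dots> = min (real (Suc k)) (real n * f x)" unfolding s_def by (auto simp: min_def max_def)
    finally show ?case .
  qed
  have "real n * f x \<le> real n" for x using f(3)[of x] mult_left_le[of "f x" "real n"] by simp
  then have "(\<Sum>i<n. s i x) = real n * f x" for x using *[where k = n and x = x] by simp
  then have "real n * \<Lambda> f = (\<Sum>i<n. \<Lambda> (s i))"
    using sum[of "{..<n}" s] s cmult[OF f(1), of "real n"] by simp
  then have "\<Lambda> f = (\<Sum>i<n. 1 / real n * \<Lambda> (s i))"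
    using n by (simp add: field_simps flip: sum_distrib_left sum_divide_distrib)
  then have "ennreal (\<Lambda> f) = (\<Sum>i<n. ennreal (1 / real n) * ennreal (\<Lambda> (s i)))"
    using nonneg[OF s] by (subst ennreal_mult[symmetric]) (auto simp: s_def)
  also have "\<dots> \<le> (\<Sum>i<n. ennreal (1 / real n) * open_content \<Lambda> {x. real i / real n < f x})"
  proof (intro sum_mono mult_left_mono content_upper s)
    fix i x
    show "s i x \<le> indicator {x. real i / real n < f x} x"
      using n by (auto simp: s_def indicator_def field_simps)
  qed (auto simp: s_def)
  finally show ?thesis .
qed

text \<open>
  The slices give \<open>\<Lambda> f \<le> \<integral> f \<partial>\<mu>\<close> for \<open>0 \<le> f \<le> 1\<close>; the same inequality for \<open>1 - f\<close>
  turns it into an equality because both sides have total mass one.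
\<close>

theorem representation: "\<exists>\<mu>\<in>M_1. \<forall>f\<in>C_b. (\<integral>x. f x \<partial>\<mu>) = \<Lambda> f"
proof -
  interpret P: sigma_algebra UNIV "Pow (UNIV :: 'a set)" by (rule sigma_algebra_Pow)
  define L where "L = lambda_system (UNIV :: 'a set) (Pow UNIV) (outer_content \<Lambda>)"
  have ms: "measure_space UNIV L (outer_content \<Lambda>)"
    unfolding L_def by (rule P.caratheodory_lemma[OF outer_content_outer_measure])
  then have sL: "sigma_algebra UNIV L" unfolding measure_space_def by auto
  have "sigma_sets UNIV {S. open S} \<subseteq> L"
    by (rule sigma_algebra.sigma_sets_subset[OF sL]) (use open_in_lambda_system in \<open>auto simp: L_def\<close>)
  then have "sets (borel :: 'a measure) \<subseteq> L" unfolding borel_def by (subst sets_measure_of) auto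
  then have ms': "measure_space UNIV (sets (borel :: 'a measure)) (outer_content \<Lambda>)"
    using measure_down[OF ms] sets.sigma_algebra_axioms[of "borel :: 'a measure"] by simp
  define \<mu> where "\<mu> = measure_of UNIV (sets (borel :: 'a measure)) (outer_content \<Lambda>)"
  have sets_\<mu>: "sets \<mu> = sets borel" unfolding \<mu>_def
    using sets.sigma_sets_eq[of "borel :: 'a measure"] by (subst sets_measure_of) auto
  have space_\<mu>: "space \<mu> = UNIV" unfolding \<mu>_def by (subst space_measure_of) auto
  have em: "emeasure \<mu> A = outer_content \<Lambda> A" if "A \<in> sets borel" for A
    using ms' that unfolding \<mu>_def measure_space_def
    by (intro emeasure_measure_of_sigma) auto
  have em_open: "emeasure \<mu> U = open_content \<Lambda> U" if "open U" for U
    using em[of U] outer_content_open[OF that] that by simp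
  have pr: "prob_space \<mu>"
    by (rule prob_spaceI) (simp add: space_\<mu> em_open content_UNIV)
  interpret prob_space \<mu> by (rule pr)
  have M1: "\<mu> \<in> M_1" using pr sets_\<mu> by (simp add: space_prob_algebra)
  have meas: "f \<in> borel_measurable \<mu>" if "f \<in> C_b" for f :: "'a \<Rightarrow> real"
    using B_b_meas[OF C_b_B_b[OF that]] measurable_cong_sets[OF sets_\<mu> refl] by blast
  have int: "integrable \<mu> f" if f: "f \<in> C_b" for f :: "'a \<Rightarrow> real"
  proof -
    obtain C where "\<And>x. \<bar>f x\<bar> \<le> C" using C_b_bound[OF f] by blast
    then show ?thesis by (intro integrable_const_bound[of _ C] meas f) auto
  qed
  have le: "\<Lambda> f \<le> (\<integral>x. f x \<partial>\<mu>)"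
    if f: "f \<in> C_b" "\<And>x. 0 \<le> f x" "\<And>x. f x \<le> 1" for f :: "'a \<Rightarrow> real"
  proof (rule field_le_epsilon)
    fix e :: real assume "e > 0"
    then obtain m where "1 / real (Suc m) < e" using nat_approx_posE by blast
    define n where "n = Suc m"
    have n: "n > 0" "1 / real n < e" using \<open>1 / real (Suc m) < e\<close> unfolding n_def by auto
    have op: "open {x. real i / real n < f x}" for i
      by (intro open_Collect_less C_b_cont f continuous_intros)
    have "ennreal (\<Lambda> f) \<le> (\<Sum>i<n. ennreal (1 / real n) * emeasure \<mu> {x. real i / real n < f x})"
      using content_slices[OF f n(1)] by (simp add: em_open op)
    also have "\<dots> = (\<Sum>i<n. ennreal (1 / real n * measure \<mu> {x. real i / real n < f x}))"
      by (intro sum.cong refl, subst ennreal_mult) (simp_all add: emeasure_eq_measure)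
    also have "\<dots> = ennreal (\<Sum>i<n. 1 / real n * measure \<mu> {x. real i / real n < f x})"
      by (intro sum_ennreal) auto
    finally have "\<Lambda> f \<le> (\<Sum>i<n. 1 / real n * measure \<mu> {x. real i / real n < f x})"
      by (subst (asm) ennreal_le_iff) (auto intro!: sum_nonneg)
    also have "\<dots> = (\<Sum>i<n. \<integral>x. 1 / real n * indicator {x. real i / real n < f x} x \<partial>\<mu>)"
      using op by (simp add: space_\<mu>)
    also have "\<dots> = (\<integral>x. (\<Sum>i<n. 1 / real n * indicator {x. real i / real n < f x} x) \<partial>\<mu>)"
      using op by (intro Bochner_Integration.integral_sum[symmetric] integrable_mult_right integrable_real_indicator)
        (auto simp: sets_\<mu> emeasure_eq_measure)
    also have "\<dots> \<le> (\<integral>x. f x + 1 / real n \<partial>\<mu>)"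
    proof (intro integral_mono)
      show "integrable \<mu> (\<lambda>x. \<Sum>i<n. 1 / real n * indicator {x. real i / real n < f x} x)"
        using op by (intro Bochner_Integration.integrable_sum integrable_mult_right integrable_real_indicator)
          (auto simp: sets_\<mu> emeasure_eq_measure)
      show "integrable \<mu> (\<lambda>x. f x + 1 / real n)" using int[OF f(1)] by auto
      fix x
      have "{i. i < n \<and> real i / real n < f x} \<subseteq> {..<nat \<lceil>real n * f x\<rceil>}"
      proof (rule subsetI)
        fix i assume "i \<in> {i. i < n \<and> real i / real n < f x}"
        then have "real i < real n * f x" using n by (simp add: field_simps)
        then show "i \<in> {..<nat \<lceil>real n * f x\<rceil>}" by (simp add: less_ceiling_iff zless_nat_eq_int_zless)
      qed
      then have "card {i. i < n \<and> real i / real n < f x} \<le> nat \<lceil>real n * f x\<rceil>"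
        using card_mono[OF finite_lessThan] by fastforce
      also have "real (nat \<lceil>real n * f x\<rceil>) \<le> real n * f x + 1"
        using f(2)[of x] by simp
      finally have "real (card {i. i < n \<and> real i / real n < f x}) / real n \<le> f x + 1 / real n"
        using n by (simp add: field_simps)
      moreover have "(\<Sum>i<n. 1 / real n * indicator {x. real i / real n < f x} x)
          = real (card {i. i < n \<and> real i / real n < f x}) / real n"
      proof -
        have "(\<Sum>i<n. indicator {x. real i / real n < f x} x) = (\<Sum>i\<in>{i. i < n \<and> real i / real n < f x}. 1::real)"
          by (rule sum.mono_neutral_cong_right) (auto simp: indicator_def)
        then show ?thesis by (simp flip: sum_distrib_left sum_divide_distrib)
      qed
      ultimately show "(\<Sum>i<n. 1 / real n * indicator {x. real i / real n < f x} x) \<le> f x + 1 / real n"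
        by simp
    qed
    also have "\<dots> = (\<integral>x. f x \<partial>\<mu>) + 1 / real n" using int[OF f(1)] by (simp add: prob_space)
    also have "\<dots> \<le> (\<integral>x. f x \<partial>\<mu>) + e" using n by simp
    finally show "\<Lambda> f \<le> (\<integral>x. f x \<partial>\<mu>) + e" .
  qed
  have unit: "(\<integral>x. f x \<partial>\<mu>) = \<Lambda> f"
    if f: "f \<in> C_b" "\<And>x. 0 \<le> f x" "\<And>x. f x \<le> 1" for f :: "'a \<Rightarrow> real"
  proof (rule antisym)
    have "\<Lambda> (\<lambda>x. 1 - f x) \<le> (\<integral>x. 1 - f x \<partial>\<mu>)"
      by (rule le) (auto intro!: C_b_diff C_b_const f simp: f)
    then show "(\<integral>x. f x \<partial>\<mu>) \<le> \<Lambda> f"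
      using diff[OF C_b_const f(1), of 1] one int[OF f(1)] by (simp add: prob_space)
  qed (rule le[OF f])
  have "(\<integral>x. f x \<partial>\<mu>) = \<Lambda> f" if f: "f \<in> C_b" for f :: "'a \<Rightarrow> real"
  proof -
    obtain C where C: "C > 0" "\<And>x. \<bar>f x\<bar> \<le> C" using C_b_bound[OF f] by blast
    define g where "g x = 1 / (2 * C) * (f x + C)" for x
    have g: "g \<in> C_b" unfolding g_def[abs_def] by (intro C_b_cmult C_b_add C_b_const f)
    have "0 \<le> g x" "g x \<le> 1" for x
      using C(1) C(2)[of x] unfolding g_def by (auto simp: field_simps)
    then have eq: "(\<integral>x. g x \<partial>\<mu>) = \<Lambda> g" by (intro unit g)
    have f_eq: "f = (\<lambda>x. 2 * C * g x - C)" using C(1) unfolding g_def by (auto simp: field_simps)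
    have "\<Lambda> f = 2 * C * \<Lambda> g - C"
      by (subst f_eq) (simp add: diff C_b_cmult C_b_const g cmult const)
    moreover have "(\<integral>x. f x \<partial>\<mu>) = 2 * C * (\<integral>x. g x \<partial>\<mu>) - C"
      by (subst f_eq) (simp add: int[OF g] prob_space)
    ultimately show ?thesis using eq by simp
  qed
  then show ?thesis using M1 by blast
qed

end

section \<open>Diagonals of summable matrices\<close>

text \<open>
  This is the gliding hump argument behind Schur's theorem that weak and norm convergence of sequences
  in \<open>l\<^sup>1\<close> coincide.  If the diagonal stayed above \<open>e\<close> infinitely often, one could select rows
  sparsely enough that on the set \<open>J\<close> of selected indices each selected row is dominated by its
  diagonal entry: the earlier columns contribute little because every single column tends to zero, the
  later ones because the row is summable.
\<close>

lemma schur_diagonal: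
  fixes a :: "nat \<Rightarrow> nat \<Rightarrow> real"
  assumes sm: "\<And>i. summable (\<lambda>j. \<bar>a i j\<bar>)"
    and lim: "\<And>J. (\<lambda>i. \<Sum>j. a i j * indicator J j) \<longlonglongrightarrow> 0"
  shows "(\<lambda>i. a i i) \<longlonglongrightarrow> 0"
proof (rule ccontr)
  assume "\<not> (\<lambda>i. a i i) \<longlonglongrightarrow> 0"
  then obtain e where e: "e > 0" "\<And>N. \<exists>i\<ge>N. \<bar>a i i\<bar> \<ge> e"
    unfolding LIMSEQ_iff by (auto simp: not_less)
  have col: "(\<lambda>i. a i j) \<longlonglongrightarrow> 0" for j
  proof -
    have "(\<Sum>k. a i k * indicator {j} k) = a i j" for i
      using suminf_finite[of "{j}" "\<lambda>k. a i k * indicator {j} k"] by simp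
    then show ?thesis using lim[of "{j}"] by simp
  qed
  (* The relation between consecutive selected rows: the new diagonal entry is large, the new row is
     small on the columns up to the old index, and the old row is small from the new index on. *)
  define R where "R i i' \<longleftrightarrow> i < i' \<and> e \<le> \<bar>a i' i'\<bar> \<and> (\<Sum>j\<le>i. \<bar>a i' j\<bar>) < e/4 \<and> (\<Sum>j. \<bar>a i (j + i')\<bar>) < e/4" for i i'
  have "\<exists>i'. R i i'" for i
  proof -
    have "(\<lambda>i'. \<Sum>j\<le>i. \<bar>a i' j\<bar>) \<longlonglongrightarrow> (\<Sum>j\<le>i. \<bar>0\<bar>)" by (intro tendsto_intros col)
    then have "\<forall>\<^sub>F i' in sequentially. (\<Sum>j\<le>i. \<bar>a i' j\<bar>) < e/4"
      using e(1) by (intro order_tendstoD(2)[of _ 0]) auto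
    moreover have "\<forall>\<^sub>F i' in sequentially. (\<Sum>j. \<bar>a i (j + i')\<bar>) < e/4"
      using suminf_exist_split2[OF sm[of i]] e(1) by (intro order_tendstoD(2)[of _ 0]) auto
    ultimately have "\<forall>\<^sub>F i' in sequentially. (\<Sum>j\<le>i. \<bar>a i' j\<bar>) < e/4 \<and> (\<Sum>j. \<bar>a i (j + i')\<bar>) < e/4 \<and> i < i'"
      using eventually_gt_at_top[of i] by eventually_elim auto
    then obtain N where "\<And>i'. i' \<ge> N \<Longrightarrow> (\<Sum>j\<le>i. \<bar>a i' j\<bar>) < e/4 \<and> (\<Sum>j. \<bar>a i (j + i')\<bar>) < e/4 \<and> i < i'"
      unfolding eventually_sequentially by blast
    then show ?thesis using e(2)[of N] unfolding R_def by blast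
  qed
  then obtain r :: "nat \<Rightarrow> nat" where r: "\<And>k. R (r k) (r (Suc k))"
    using dependent_nat_choice[of "\<lambda>_ _. True" "\<lambda>_. R"] by auto
  have mono: "strict_mono r" using r unfolding R_def by (auto intro!: strict_mono_Suc_iff[THEN iffD2])
  define J where "J = range r"
  have big: "\<bar>\<Sum>j. a (r (Suc k)) j * indicator J j\<bar> \<ge> e/2" for k
  proof -
    define i where "i = r (Suc k)"
    define n where "n = r (Suc (Suc k))"
    have 1: "e \<le> \<bar>a i i\<bar>" "(\<Sum>j\<le>r k. \<bar>a i j\<bar>) < e/4" "r k < i" using r[of k] unfolding R_def i_def by auto
    have 2: "(\<Sum>j. \<bar>a i (j + n)\<bar>) < e/4" "i < n" using r[of "Suc k"] unfolding R_def i_def n_def by auto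
    have J: "j \<le> r k \<or> j = i \<or> j \<ge> n" if jJ: "j \<in> J" for j
    proof -
      obtain l where l: "j = r l" using jJ unfolding J_def by blast
      then consider "l \<le> k" | "l = Suc k" | "l \<ge> Suc (Suc k)" by linarith
      then show ?thesis
        using strict_mono_less_eq[OF mono] unfolding l i_def n_def by cases auto
    qed
    have s1: "summable (\<lambda>j. a i j * indicator J j)"
      by (rule summable_comparison_test'[OF sm[of i], of 0]) (auto simp: indicator_def)
    have s3: "summable (\<lambda>j. \<bar>a i (j + n)\<bar>)" by (rule summable_ignore_initial_segment[OF sm])
    have "(\<Sum>j. a i j * indicator J j) = (\<Sum>j. a i (j + n) * indicator J (j + n)) + (\<Sum>j<n. a i j * indicator J j)"
      by (rule suminf_split_initial_segment[OF s1])
    moreover have "(\<Sum>j<n. a i j * indicator J j) = a i i + (\<Sum>j\<le>r k. a i j * indicator J j)"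
    proof -
      have "(\<Sum>j<n. a i j * indicator J j) = (\<Sum>j\<in>insert i {..r k}. a i j * indicator J j)"
      proof (rule sum.mono_neutral_right)
        show "\<forall>j\<in>{..<n} - insert i {..r k}. a i j * indicator J j = 0"
          using J by (force simp: indicator_def)
      qed (use 1(3) 2(2) in auto)
      also have "\<dots> = a i i + (\<Sum>j\<le>r k. a i j * indicator J j)"
        using 1(3) by (subst sum.insert) (auto simp: J_def i_def)
      finally show ?thesis .
    qed
    moreover have "\<bar>\<Sum>j\<le>r k. a i j * indicator J j\<bar> \<le> (\<Sum>j\<le>r k. \<bar>a i j\<bar>)"
      by (rule order_trans[OF sum_abs sum_mono]) (auto simp: indicator_def)
    moreover have "\<bar>\<Sum>j. a i (j + n) * indicator J (j + n)\<bar> \<le> (\<Sum>j. \<bar>a i (j + n)\<bar>)"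
    proof -
      have s4: "summable (\<lambda>j. \<bar>a i (j + n) * indicator J (j + n)\<bar>)"
        by (rule summable_comparison_test'[OF s3, of 0]) (auto simp: indicator_def)
      have "\<bar>\<Sum>j. a i (j + n) * indicator J (j + n)\<bar> \<le> (\<Sum>j. \<bar>a i (j + n) * indicator J (j + n)\<bar>)"
        by (rule summable_rabs[OF s4])
      also have "\<dots> \<le> (\<Sum>j. \<bar>a i (j + n)\<bar>)" by (rule suminf_le[OF _ s4 s3]) (auto simp: indicator_def)
      finally show ?thesis .
    qed
    ultimately show ?thesis using 1 2 unfolding i_def by linarith
  qed
  have "strict_mono (\<lambda>k. r (Suc k))" using mono by (simp add: strict_mono_def)
  from LIMSEQ_subseq_LIMSEQ[OF lim[of J] this]
  have "\<forall>\<^sub>F k in sequentially. \<bar>\<Sum>j. a (r (Suc k)) j * indicator J j\<bar> < e/2"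
    using e(1) by (auto simp: o_def dest!: tendstoD[where e = "e/2"])
  then show False using big by (auto simp: eventually_sequentially not_less[symmetric])
qed

section \<open>Disjoint Lipschitz bumps\<close>

text \<open>
  At each point at most one bump is active, so the sum of a subfamily is also its pointwise supremum,
  and a supremum of \<open>L\<close>-Lipschitz functions is again \<open>L\<close>-Lipschitz.
\<close>

lemma lipschitz_bump_sum:
  fixes \<phi> :: "nat \<Rightarrow> 'a::metric_space \<Rightarrow> real"
  assumes lip: "\<And>i. L-lipschitz_on UNIV (\<phi> i)" and nn: "\<And>i x. 0 \<le> \<phi> i x" and le: "\<And>i x. \<phi> i x \<le> 1"
    and disj: "\<And>i j x. 0 < \<phi> i x \<and> 0 < \<phi> j x \<longrightarrow> i = j"
  shows "(\<lambda>x. \<Sum>i. \<phi> i x * indicator J i) \<in> L_b"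
    and "summable (\<lambda>i. \<phi> i x)" and "(\<Sum>i. \<phi> i x) \<le> 1"
proof -
  define F where "F J x = (\<Sum>i. \<phi> i x * indicator J i)" for J x
  have zero: "\<phi> j x = 0" if "\<phi> i x > 0" "j \<noteq> i" for i j x
    using disj[of i x j] that nn[of j x] by force
  have val: "F J x = \<phi> i x * indicator J i" if "\<phi> i x > 0" for i x J
  proof -
    have "F J x = (\<Sum>i\<in>{i}. \<phi> i x * indicator J i)"
      unfolding F_def by (rule suminf_finite) (use zero[OF that] in auto)
    then show ?thesis by (subst (asm) sum.insert) auto
  qed
  have val0: "F J x = 0" if "\<And>i. \<phi> i x = 0" for x J using that by (simp add: F_def)
  have ex: "(\<exists>i. \<phi> i x > 0) \<or> (\<forall>i. \<phi> i x = 0)" for x using nn[of _ x] by (metis less_eq_real_def)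
  have L: "L \<ge> 0" using lip[of 0] by (rule lipschitz_on_nonneg)
  have bnd: "0 \<le> F J x" "F J x \<le> 1" for J x
    using ex[of x] val[where x = x and J = J] val0[of x J] nn[of _ x] le[of _ x] by (auto simp: indicator_def) 
  have one: "F J x - F J y \<le> L * dist x y" for x y
  proof (cases "F J x > 0")
    case True
    then obtain i where i: "\<phi> i x > 0" using ex[of x] val0[of x J] by fastforce
    have fx: "F J x = \<phi> i x" "i \<in> J" using val[OF i, of J] True by (cases "i \<in> J"; simp)+
    have "F J y \<ge> \<phi> i y"
      using val[of i y J] bnd(1)[of J y] nn[of i y] fx(2) by (cases "\<phi> i y > 0") auto
    moreover have "\<phi> i x - \<phi> i y \<le> L * dist x y"
      using lipschitz_onD[OF lip[of i], of x y] by (simp add: dist_real_def)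
    ultimately show ?thesis using fx by linarith
  next
    case False
    then have "F J x = 0" using bnd(1)[of J x] by linarith
    then show ?thesis using bnd(1)[of J y] L by (smt (verit) mult_nonneg_nonneg zero_le_dist)
  qed
  have "F J \<in> L_b"
  proof (rule L_bI[of L _ 1])
    show "L-lipschitz_on UNIV (F J)"
    proof (rule lipschitz_onI[OF _ L])
      fix x y show "dist (F J x) (F J y) \<le> L * dist x y"
        using one[of x y] one[of y x] by (simp add: dist_real_def dist_commute abs_le_iff)
    qed
    show "\<bar>F J x\<bar> \<le> 1" for x using bnd[of J x] by simp
  qed
  then show "(\<lambda>x. \<Sum>i. \<phi> i x * indicator J i) \<in> L_b" unfolding F_def[abs_def] .
  show "(\<Sum>i. \<phi> i x) \<le> 1" using bnd(2)[of UNIV x] by (simp add: F_def)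
  show "summable (\<lambda>i. \<phi> i x)"
    using ex[of x]
  proof
    assume "\<exists>i. \<phi> i x > 0"
    then obtain i where "\<phi> i x > 0" ..
    then show ?thesis using zero by (intro summable_finite[of "{i}"]) auto
  qed simp
qed

text \<open>
  The bump detects mass that the net \<open>A\<close> misses and the larger net \<open>B\<close> captures.  It vanishes both
  where \<open>infdist x A \<le> \<eta>\<close> and where \<open>infdist x B \<ge> \<eta>\<close>; the common threshold makes bumps between
  successive members of an increasing sequence of nets disjoint.
\<close>

definition shell_bump :: "real \<Rightarrow> 'a::metric_space set \<Rightarrow> 'a set \<Rightarrow> 'a \<Rightarrow> real" where
  "shell_bump \<eta> A B x = max 0 (min 1 (min (infdist x A / \<eta> - 1) (2 - 2 * infdist x B / \<eta>)))"

lemma shell_bump_range: "0 \<le> shell_bump \<eta> A B x" "shell_bump \<eta> A B x \<le> 1"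
  unfolding shell_bump_def by auto

lemma shell_bump_eq_1:
  "\<eta> > 0 \<Longrightarrow> infdist x A \<ge> 2 * \<eta> \<Longrightarrow> infdist x B \<le> \<eta> / 2 \<Longrightarrow> shell_bump \<eta> A B x = 1"
  unfolding shell_bump_def by (auto simp: field_simps min_def max_def)

lemma shell_bump_pos:
  assumes "\<eta> > 0" "shell_bump \<eta> A B x > 0" shows "infdist x A > \<eta>" "infdist x B < \<eta>"
proof -
  have "infdist x A / \<eta> - 1 > 0" "2 - 2 * infdist x B / \<eta> > 0"
    using assms(2) unfolding shell_bump_def by (auto simp: less_max_iff_disj)
  then show "infdist x A > \<eta>" "infdist x B < \<eta>" using assms(1) by (simp_all add: field_simps)
qed

lemma shell_bump_lipschitz:
  assumes "\<eta> > 0" shows "(2/\<eta>)-lipschitz_on UNIV (shell_bump \<eta> A B)"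
proof (rule lipschitz_onI)
  fix x y :: 'a
  have "\<bar>infdist x A - infdist y A\<bar> / \<eta> \<le> dist x y / \<eta>" "\<bar>infdist x B - infdist y B\<bar> / \<eta> \<le> dist x y / \<eta>"
    using assms by (intro divide_right_mono infdist_triangle_abs; simp)+
  then have "\<bar>infdist x A / \<eta> - infdist y A / \<eta>\<bar> \<le> dist x y / \<eta>" "\<bar>infdist x B / \<eta> - infdist y B / \<eta>\<bar> \<le> dist x y / \<eta>"
    using assms by (simp_all add: abs_divide flip: diff_divide_distrib)
  moreover have "0 \<le> dist x y / \<eta>" using assms by simp
  ultimately have "\<bar>shell_bump \<eta> A B x - shell_bump \<eta> A B y\<bar> \<le> 2 * (dist x y / \<eta>)"
    unfolding shell_bump_def times_divide_eq_right[symmetric] by linarith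
  then show "dist (shell_bump \<eta> A B x) (shell_bump \<eta> A B y) \<le> 2 / \<eta> * dist x y"
    by (simp add: dist_real_def)
qed (use assms in auto)

section \<open>Expectations of bounded functions\<close>

lemma M_1D: "\<nu> \<in> M_1 \<Longrightarrow> prob_space \<nu>" "\<nu> \<in> M_1 \<Longrightarrow> sets \<nu> = sets borel" "\<nu> \<in> M_1 \<Longrightarrow> space \<nu> = UNIV"
  by (auto simp: space_prob_algebra dest: sets_eq_imp_space_eq)

lemma B_b_measurable: "\<nu> \<in> M_1 \<Longrightarrow> f \<in> B_b \<Longrightarrow> f \<in> borel_measurable \<nu>"
  using B_b_meas[of f] measurable_cong_sets[OF M_1D(2) refl] by blast

lemma B_b_integrable:
  assumes "\<nu> \<in> M_1" "f \<in> B_b" shows "integrable \<nu> f"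
proof -
  interpret prob_space \<nu> using assms(1) by (rule M_1D)
  obtain C where "\<And>x. \<bar>f x\<bar> \<le> C" using B_b_bound[OF assms(2)] by blast
  then show ?thesis by (intro integrable_const_bound[of _ C] B_b_measurable assms) auto
qed

lemma expectation_const: "\<nu> \<in> M_1 \<Longrightarrow> (\<integral>x. c \<partial>\<nu>) = (c::real)"
  using prob_space.prob_space[OF M_1D(1), of \<nu>] by simp

lemma expectation_mono:
  "\<nu> \<in> M_1 \<Longrightarrow> f \<in> B_b \<Longrightarrow> g \<in> B_b \<Longrightarrow> (\<And>x. f x \<le> g x) \<Longrightarrow> (\<integral>x. f x \<partial>\<nu>) \<le> (\<integral>x. g x \<partial>\<nu>)"
  by (intro integral_mono B_b_integrable)

lemma expectation_bound:
  assumes "\<nu> \<in> M_1" "f \<in> B_b" "\<And>x. \<bar>f x\<bar> \<le> C" shows "\<bar>\<integral>x. f x \<partial>\<nu>\<bar> \<le> C"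
proof -
  have "f x \<le> C" "- C \<le> f x" for x using assms(3)[of x] by auto
  then have "(\<integral>x. f x \<partial>\<nu>) \<le> (\<integral>x. C \<partial>\<nu>)" "(\<integral>x. - C \<partial>\<nu>) \<le> (\<integral>x. f x \<partial>\<nu>)"
    by (intro expectation_mono assms B_b_const; simp)+
  then show ?thesis unfolding expectation_const[OF assms(1)] by linarith
qed

lemma expectation_indicator: "\<nu> \<in> M_1 \<Longrightarrow> (\<integral>x. indicator B x \<partial>\<nu>) = measure \<nu> B"
  using M_1D(3)[of \<nu>] by simp

lemma expectation_dominated:
  assumes \<nu>: "\<nu> \<in> M_1" and m: "\<And>n. F n \<in> B_b" and b: "\<And>n x. \<bar>F n x\<bar> \<le> C"
    and lim: "\<And>x. (\<lambda>n. F n x) \<longlonglongrightarrow> f x" and f: "f \<in> borel_measurable borel"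
  shows "(\<lambda>n. \<integral>x. F n x \<partial>\<nu>) \<longlonglongrightarrow> (\<integral>x. f x \<partial>\<nu>)"
proof (rule integral_dominated_convergence[where w = "\<lambda>_. C"])
  show "f \<in> borel_measurable \<nu>" using f measurable_cong_sets[OF M_1D(2)[OF \<nu>] refl] by blast
qed (use assms in \<open>auto intro: B_b_measurable simp: B_b_integrable B_b_const\<close>)

lemma M_1_eqI:
  fixes \<mu> \<nu> :: "'a::metric_space measure"
  assumes \<mu>: "\<mu> \<in> M_1" and \<nu>: "\<nu> \<in> M_1" and eq: "\<And>f. f \<in> L_b \<Longrightarrow> (\<integral>x. f x \<partial>\<mu>) = (\<integral>x. f x \<partial>\<nu>)"
  shows "\<mu> = \<nu>"
proof -
  have op: "measure \<mu> U = measure \<nu> U" if U: "open U" for U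
  proof -
    have "\<exists>h. (\<forall>n. h n \<in> L_b) \<and> (\<forall>n x. 0 \<le> h n x) \<and> (\<forall>n x. h n x \<le> 1) \<and>
        (\<forall>x. (\<lambda>n. h n x) \<longlonglongrightarrow> indicator U x)"
      by (rule open_approx_lipschitz[OF U]) metis
    then obtain h :: "nat \<Rightarrow> 'a \<Rightarrow> real" where h: "\<And>n. h n \<in> L_b" "\<And>n x. 0 \<le> h n x"
      "\<And>n x. h n x \<le> 1" "\<And>x. (\<lambda>n. h n x) \<longlonglongrightarrow> indicator U x"
      by metis
    have "(\<lambda>n. \<integral>x. h n x \<partial>\<kappa>) \<longlonglongrightarrow> (\<integral>x. indicator U x \<partial>\<kappa>)" if "\<kappa> \<in> M_1" for \<kappa> :: "'a measure"
      by (rule expectation_dominated[OF that, of _ 1]) (use h U in \<open>auto intro: C_b_B_b L_b_C_b\<close>)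
    note lim = this
    have "(\<lambda>n. \<integral>x. h n x \<partial>\<nu>) \<longlonglongrightarrow> measure \<mu> U"
      using lim[OF \<mu>] unfolding eq[OF h(1)] expectation_indicator[OF \<mu>] .
    moreover have "(\<lambda>n. \<integral>x. h n x \<partial>\<nu>) \<longlonglongrightarrow> measure \<nu> U"
      using lim[OF \<nu>] unfolding expectation_indicator[OF \<nu>] .
    ultimately show ?thesis by (rule LIMSEQ_unique)
  qed
  interpret M: prob_space \<mu> by (rule M_1D[OF \<mu>])
  interpret N: prob_space \<nu> by (rule M_1D[OF \<nu>])
  show ?thesis
  proof (rule measure_eqI_generator_eq[where E = "{S. open S}" and \<Omega> = UNIV and A = "\<lambda>_. UNIV"])
    show "Int_stable {S::'a set. open S}" by (auto simp: Int_stable_def)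
    show "sets \<mu> = sigma_sets UNIV {S. open S}" "sets \<nu> = sigma_sets UNIV {S. open S}"
      using M_1D(2)[OF \<mu>] M_1D(2)[OF \<nu>] by (auto simp: borel_def)
  qed (auto simp: M.emeasure_eq_measure N.emeasure_eq_measure op)
qed

text \<open>
  The functions \<open>g n x = (INF y. f y + n * dist x y)\<close> increase to \<open>f\<close>: far from \<open>x\<close> the
  penalty exceeds the oscillation of \<open>f\<close>, near \<open>x\<close> continuity controls it.
\<close>

lemma lipschitz_approx_below:
  fixes f :: "'a::metric_space \<Rightarrow> real"
  assumes f: "f \<in> C_b"
  obtains g :: "nat \<Rightarrow> 'a \<Rightarrow> real" where "\<And>n. g n \<in> L_b" "\<And>n x. g n x \<le> f x"
    "\<And>x. (\<lambda>n. g n x) \<longlonglongrightarrow> f x" "\<exists>C. \<forall>n x. \<bar>g n x\<bar> \<le> C"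
proof -
  obtain C where C: "\<And>x. \<bar>f x\<bar> \<le> C" using C_b_bound[OF f] by blast
  define g where "g n x = (INF y. f y + real n * dist x y)" for n :: nat and x
  have bdd: "bdd_below (range (\<lambda>y. f y + real n * dist x y))" for n x
  proof (rule bdd_belowI2)
    fix y show "- C \<le> f y + real n * dist x y"
      using C[of y] by (smt (verit) mult_nonneg_nonneg of_nat_0_le_iff zero_le_dist)
  qed
  have le: "g n x \<le> f x" for n x
    unfolding g_def using cINF_lower[OF bdd[of n x], of x] by simp
  have ge: "- C \<le> g n x" for n x
    unfolding g_def
    by (rule cINF_greatest) (use C in \<open>auto, smt (verit) mult_nonneg_nonneg of_nat_0_le_iff zero_le_dist\<close>)
  have bnd: "\<bar>g n x\<bar> \<le> C" for n x using le[of n x] ge[of n x] C[of x] by linarith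
  have lip: "g n x \<le> g n x' + real n * dist x x'" for n x x'
  proof -
    have "g n x - real n * dist x x' \<le> g n x'"
      unfolding g_def[of n x']
    proof (rule cINF_greatest)
      fix y
      have "g n x \<le> f y + real n * dist x y" unfolding g_def by (rule cINF_lower[OF bdd]) auto
      also have "\<dots> \<le> f y + real n * (dist x x' + dist x' y)"
        by (intro add_left_mono mult_left_mono dist_triangle) auto
      finally show "g n x - real n * dist x x' \<le> f y + real n * dist x' y" by (simp add: algebra_simps)
    qed auto
    then show ?thesis by simp
  qed
  show ?thesis
  proof (rule that[of g])
    show "g n \<in> L_b" for n
    proof (rule L_bI[of "real n" _ C])
      show "(real n)-lipschitz_on UNIV (g n)"
      proof (rule lipschitz_onI)
        fix x y show "dist (g n x) (g n y) \<le> real n * dist x y"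
          using lip[of n x y] lip[of n y x] by (simp add: dist_real_def dist_commute abs_le_iff)
      qed auto
    qed (rule bnd)
    show "(\<lambda>n. g n x) \<longlonglongrightarrow> f x" for x
    proof (rule LIMSEQ_I)
      fix e :: real assume e: "e > 0"
      have "isCont f x" using C_b_cont[OF f, of UNIV] by (simp add: continuous_on_eq_continuous_at)
      then obtain d where d: "d > 0" "\<And>y. dist y x < d \<Longrightarrow> dist (f y) (f x) < e/2"
        using e unfolding continuous_at_eps_delta by (metis half_gt_zero)
      obtain N where N: "real N > 2 * C / d" using reals_Archimedean2 by blast
      have "\<bar>g n x - f x\<bar> < e" if "n \<ge> N" for n
      proof -
        have "f x - e/2 \<le> g n x"
          unfolding g_def
        proof (rule cINF_greatest)
          fix y
          show "f x - e/2 \<le> f y + real n * dist x y"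
          proof (cases "dist y x < d")
            case True
            then show ?thesis using d(2)[OF True] unfolding dist_real_def
              by (smt (verit) mult_nonneg_nonneg of_nat_0_le_iff zero_le_dist field_sum_of_halves)
          next
            case False
            have "2 * C \<le> real N * d" using N d(1) by (simp add: field_simps)
            also have "\<dots> \<le> real n * dist x y" using that False d(1) by (intro mult_mono) (auto simp: dist_commute)
            finally show ?thesis using C[of x] C[of y] e by linarith
          qed
        qed auto
        then show ?thesis using le[of n x] e by linarith
      qed
      then show "\<exists>N. \<forall>n\<ge>N. norm (g n x - f x) < e" by auto
    qed
  qed (use le bnd in auto)
qed

section \<open>Limits along the time set\<close>

lemma eventually_at_top_in: "eventually Q (at_top_in T) \<longleftrightarrow> (\<exists>N. \<forall>t\<in>T. t \<ge> N \<longrightarrow> Q t)"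
  unfolding at_top_in_def eventually_inf_principal eventually_at_top_linorder by auto

lemma filterlim_at_top_inI:
  "(\<And>n. X n \<in> T) \<Longrightarrow> filterlim X at_top F \<Longrightarrow> filterlim X (at_top_in T) F"
  unfolding at_top_in_def filterlim_inf filterlim_principal by auto

text \<open>
  Passing to sequences makes dominated convergence applicable for continuous time as well, where no
  measurability in the time variable is available.
\<close>

lemma tendsto_at_top_in_seqI:
  fixes f :: "real \<Rightarrow> real"
  assumes "\<And>X. (\<And>n. X n \<in> T) \<Longrightarrow> filterlim X at_top sequentially \<Longrightarrow> (\<lambda>n. f (X n)) \<longlonglongrightarrow> L"
  shows "(f \<longlongrightarrow> L) (at_top_in T)"
proof (rule tendstoI, rule ccontr)
  fix e :: real assume e: "e > 0" and "\<not> (\<forall>\<^sub>F t in at_top_in T. dist (f t) L < e)"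
  then have "\<forall>n::nat. \<exists>t. t \<in> T \<and> t \<ge> real n \<and> \<not> dist (f t) L < e"
    unfolding eventually_at_top_in by blast
  then obtain X where X: "\<And>n::nat. X n \<in> T" "\<And>n. X n \<ge> real n" "\<And>n. \<not> dist (f (X n)) L < e" by metis
  have "filterlim X at_top sequentially"
    by (rule filterlim_at_top_mono[OF filterlim_real_sequentially]) (use X(2) in auto)
  from tendstoD[OF assms[OF X(1) this] e] show False
    using X(3) by (auto simp: eventually_sequentially)
qed

lemma expectation_dominated_at_top_in:
  assumes \<nu>: "\<nu> \<in> M_1" and m: "\<And>t. t \<in> T \<Longrightarrow> F t \<in> B_b" and b: "\<And>t x. t \<in> T \<Longrightarrow> \<bar>F t x\<bar> \<le> C"
    and lim: "\<And>x. ((\<lambda>t. F t x) \<longlongrightarrow> f x) (at_top_in T)" and f: "f \<in> borel_measurable borel"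
  shows "((\<lambda>t. \<integral>x. F t x \<partial>\<nu>) \<longlongrightarrow> (\<integral>x. f x \<partial>\<nu>)) (at_top_in T)"
proof (rule tendsto_at_top_in_seqI)
  fix X :: "nat \<Rightarrow> real" assume X: "\<And>n. X n \<in> T" "filterlim X at_top sequentially"
  show "(\<lambda>n. \<integral>x. F (X n) x \<partial>\<nu>) \<longlonglongrightarrow> (\<integral>x. f x \<partial>\<nu>)"
    by (rule expectation_dominated[OF \<nu>, of _ C])
      (use m b f X filterlim_compose[OF lim filterlim_at_top_inI[OF X]] in auto)
qed

text \<open>
  Approximation from below by Lipschitz functions yields lower semicontinuity of the integral of every
  bounded continuous \<open>f\<close>; the same for \<open>- f\<close> gives convergence.
\<close>

lemma converges_weakly_lipschitzI:
  fixes N :: "'i \<Rightarrow> 'a::metric_space measure"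
  assumes N: "\<forall>\<^sub>F i in F. N i \<in> M_1" and \<mu>: "\<mu> \<in> M_1"
    and lim: "\<And>f. f \<in> L_b \<Longrightarrow> ((\<lambda>i. \<integral>x. f x \<partial>N i) \<longlongrightarrow> (\<integral>x. f x \<partial>\<mu>)) F"
  shows "converges_weakly N \<mu> F"
  unfolding converges_weakly_def
proof
  have low: "\<forall>\<^sub>F i in F. (\<integral>x. f x \<partial>\<mu>) - e < (\<integral>x. f x \<partial>N i)" if f: "f \<in> C_b" and e: "e > 0" for f :: "'a \<Rightarrow> real" and e
  proof -
    have "\<exists>g C. (\<forall>n. g n \<in> L_b) \<and> (\<forall>n x. g n x \<le> f x) \<and> (\<forall>x. (\<lambda>n. g n x) \<longlonglongrightarrow> f x) \<and> (\<forall>n x. \<bar>g n x\<bar> \<le> C)"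
      by (rule lipschitz_approx_below[OF f]) metis
    then obtain g :: "nat \<Rightarrow> 'a \<Rightarrow> real" and C where g: "\<And>n. g n \<in> L_b" "\<And>n x. g n x \<le> f x"
      "\<And>x. (\<lambda>n. g n x) \<longlonglongrightarrow> f x" "\<And>n x. \<bar>g n x\<bar> \<le> C" by metis
    have gB: "g n \<in> B_b" for n using g(1) by (intro C_b_B_b L_b_C_b)
    have "(\<lambda>n. \<integral>x. g n x \<partial>\<mu>) \<longlonglongrightarrow> (\<integral>x. f x \<partial>\<mu>)"
      by (rule expectation_dominated[OF \<mu> gB g(4) g(3)]) (intro B_b_meas C_b_B_b f)
    then have "\<forall>\<^sub>F n in sequentially. (\<integral>x. f x \<partial>\<mu>) - e < (\<integral>x. g n x \<partial>\<mu>)"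
      using e by (intro order_tendstoD) auto
    then obtain n where "(\<integral>x. f x \<partial>\<mu>) - e < (\<integral>x. g n x \<partial>\<mu>)" by (auto simp: eventually_sequentially)
    from order_tendstoD(1)[OF lim[OF g(1)] this] N show ?thesis
    proof eventually_elim
      case (elim i)
      then show ?case using expectation_mono[of "N i" "g n" f, OF _ gB C_b_B_b[OF f] g(2)] by linarith
    qed
  qed
  fix f :: "'a \<Rightarrow> real" assume f: "f \<in> C_b"
  have f': "(\<lambda>x. - f x) \<in> C_b" using C_b_cmult[OF f, of "-1"] by simp
  show "((\<lambda>i. \<integral>x. f x \<partial>N i) \<longlongrightarrow> (\<integral>x. f x \<partial>\<mu>)) F"
  proof (rule tendstoI)
    fix e :: real assume "e > 0"
    from low[OF f this] low[OF f' this]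
    show "\<forall>\<^sub>F i in F. dist (\<integral>x. f x \<partial>N i) (\<integral>x. f x \<partial>\<mu>) < e"
      by eventually_elim (auto simp: dist_real_def abs_less_iff)
  qed
qed

text \<open>
  By Tychonoff's theorem the functions \<open>g i\<close> live in a compact product of intervals, so the image of
  \<open>F\<close> clusters at some point.  A subfilter replaces a diagonal subsequence here, which would
  require a countable index type.
\<close>

lemma convergent_subfilter:
  fixes g :: "'i \<Rightarrow> 'b \<Rightarrow> real"
  assumes F: "F \<noteq> bot" and bound: "\<And>i b. \<bar>g i b\<bar> \<le> C b"
  obtains G where "G \<le> F" "G \<noteq> bot" "\<And>b. \<exists>l. ((\<lambda>i. g i b) \<longlongrightarrow> l) G"
proof -
  define K where "K = PiE UNIV (\<lambda>b. cball (0::real) (C b))"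
  have "compact K"
    using compactin_PiE[of "\<lambda>_. euclidean" UNIV "\<lambda>b. cball (0::real) (C b)"]
    unfolding K_def euclidean_product_topology by (simp add: compactin_euclidean_iff)
  moreover have "filtermap g F \<noteq> bot" using F by (simp add: filtermap_bot_iff)
  moreover have "eventually (\<lambda>y. y \<in> K) (filtermap g F)"
    unfolding eventually_filtermap K_def using bound by (auto simp: PiE_def Pi_def intro: always_eventually)
  ultimately obtain y where y: "inf (nhds y) (filtermap g F) \<noteq> bot"
    unfolding compact_filter by blast
  define G where "G = inf (filtercomap g (nhds y)) F"
  show ?thesis
  proof (rule that[of G])
    show "G \<le> F" unfolding G_def by simp
    show "G \<noteq> bot"
    proof
      assume "G = bot"
      then have "eventually (\<lambda>_. False) G" by simp
      then obtain A B where "eventually A (filtercomap g (nhds y))" and B: "eventually B F"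
        and AB: "\<And>i. A i \<Longrightarrow> B i \<Longrightarrow> False"
        unfolding G_def eventually_inf by auto
      then obtain Q where Q: "eventually Q (nhds y)" "\<And>i. Q (g i) \<Longrightarrow> A i"
        unfolding eventually_filtercomap by auto
      have "eventually (\<lambda>z. \<not> Q z) (filtermap g F)"
        unfolding eventually_filtermap using B by eventually_elim (use AB Q(2) in blast)
      then have "eventually (\<lambda>_. False) (inf (nhds y) (filtermap g F))"
        using Q(1) unfolding eventually_inf by blast
      then show False using y by (simp add: trivial_limit_def)
    qed
    fix b
    have "filterlim g (nhds y) (filtercomap g (nhds y))" by (rule filterlim_filtercomap)
    then have "filterlim g (nhds y) G" unfolding G_def by (rule filterlim_mono) auto
    have "((\<lambda>i. g i b) \<longlongrightarrow> y b) G"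
    proof (rule topological_tendstoI)
      fix S :: "real set" assume S: "open S" "y b \<in> S"
      have "open ((\<lambda>z. z b) -` S)"
        by (intro open_vimage S continuous_on_product_coordinates)
      then have "eventually (\<lambda>z. z b \<in> S) (nhds y)"
        unfolding eventually_nhds using S(2) by (intro exI[of _ "(\<lambda>z. z b) -` S"]) auto
      then show "eventually (\<lambda>i. g i b \<in> S) G"
        using eventually_compose_filterlim[OF _ \<open>filterlim g (nhds y) G\<close>] by fast
    qed
    then show "\<exists>l. ((\<lambda>i. g i b) \<longlongrightarrow> l) G" ..
  qed
qed

section \<open>Splitting a probability measure\<close>

lemma density_M_1:
  assumes m: "m \<in> M_1" and w: "w \<in> B_b" "\<And>x. 0 \<le> w x" "(\<integral>x. w x \<partial>m) = 1"
  shows "density m (\<lambda>x. ennreal (w x)) \<in> M_1"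
    and "g \<in> B_b \<Longrightarrow> (\<integral>x. g x \<partial>density m (\<lambda>x. ennreal (w x))) = (\<integral>x. w x * g x \<partial>m)"
proof -
  have wm: "w \<in> borel_measurable m" by (rule B_b_measurable[OF m w(1)])
  have "emeasure (density m (\<lambda>x. ennreal (w x))) (space m) = (\<integral>\<^sup>+x. ennreal (w x) \<partial>m)"
    using wm by (subst emeasure_density) (auto intro!: nn_integral_cong)
  also have "\<dots> = 1" using nn_integral_eq_integral[OF B_b_integrable[OF m w(1)]] w by simp
  finally have "prob_space (density m (\<lambda>x. ennreal (w x)))" by (intro prob_spaceI) simp
  then show "density m (\<lambda>x. ennreal (w x)) \<in> M_1"
    using M_1D(2)[OF m] by (simp add: space_prob_algebra)
  show "g \<in> B_b \<Longrightarrow> (\<integral>x. g x \<partial>density m (\<lambda>x. ennreal (w x))) = (\<integral>x. w x * g x \<partial>m)"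
    using integral_density[OF B_b_measurable[OF m] wm, of g] w(2) by simp
qed

text \<open>
  Subtract from \<open>m\<close> the fraction \<open>a\<close> of its normalised restriction to \<open>B\<close>; the remainder has
  the density \<open>(1 - a u) / (1 - a)\<close>, which is nonnegative because \<open>a \<le> measure m B\<close>.
\<close>

lemma split_probability:
  assumes m: "m \<in> M_1" and B: "B \<in> sets borel" and a: "0 < a" "a < 1" "a \<le> measure m B"
  obtains p q where "p \<in> M_1" "q \<in> M_1" "measure p B = 1"
    "\<And>g. g \<in> B_b \<Longrightarrow> (\<integral>x. g x \<partial>m) = a * (\<integral>x. g x \<partial>p) + (1 - a) * (\<integral>x. g x \<partial>q)"
proof -
  define \<beta> where "\<beta> = measure m B"
  have \<beta>: "\<beta> > 0" "a \<le> \<beta>" using a unfolding \<beta>_def by auto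
  define u where "u x = 1 / \<beta> * indicator B x" for x
  define v where "v x = 1 / (1 - a) * (1 - a * u x)" for x
  have uB: "u \<in> B_b" unfolding u_def[abs_def] by (intro B_b_times B_b_const B_b_indicator B)
  have vB: "v \<in> B_b" unfolding v_def[abs_def] by (intro B_b_times B_b_diff B_b_const uB)
  have u0: "0 \<le> u x" for x using \<beta> unfolding u_def by simp
  have "a * u x \<le> 1" for x using \<beta> by (auto simp: u_def indicator_def)
  then have v0: "0 \<le> v x" for x using a unfolding v_def by simp
  have u1: "(\<integral>x. u x \<partial>m) = 1"
    using \<beta> unfolding u_def integral_mult_right_zero expectation_indicator[OF m] by (simp add: \<beta>_def)
  have v1: "(\<integral>x. v x \<partial>m) = 1"
  proof -
    have "(\<integral>x. 1 - a * u x \<partial>m) = (\<integral>x. 1 \<partial>m) - (\<integral>x. a * u x \<partial>m)"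
      by (intro Bochner_Integration.integral_diff B_b_integrable[OF m] B_b_const B_b_times uB)
    then have "(\<integral>x. 1 - a * u x \<partial>m) = 1 - a" unfolding expectation_const[OF m] integral_mult_right_zero u1 by simp
    then show ?thesis unfolding v_def integral_mult_right_zero using a by simp
  qed
  define p where "p = density m (\<lambda>x. ennreal (u x))"
  define q where "q = density m (\<lambda>x. ennreal (v x))"
  note pq = density_M_1[OF m uB u0 u1, folded p_def] density_M_1[OF m vB v0 v1, folded q_def]
  show ?thesis
  proof (rule that[OF pq(1,3)])
    have "measure p B = (\<integral>x. indicator B x \<partial>p)" using expectation_indicator[OF pq(1)] by simp
    also have "\<dots> = (\<integral>x. u x * indicator B x \<partial>m)" by (rule pq(2)[OF B_b_indicator[OF B]])
    also have "\<dots> = (\<integral>x. u x \<partial>m)" by (intro Bochner_Integration.integral_cong) (auto simp: u_def indicator_def)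
    finally show "measure p B = 1" using u1 by simp
    fix g :: "'a \<Rightarrow> real" assume g: "g \<in> B_b"
    have "a * (\<integral>x. g x \<partial>p) + (1 - a) * (\<integral>x. g x \<partial>q) = (\<integral>x. a * (u x * g x) \<partial>m) + (\<integral>x. (1 - a) * (v x * g x) \<partial>m)"
      unfolding pq(2)[OF g] pq(4)[OF g] integral_mult_right_zero ..
    also have "\<dots> = (\<integral>x. a * (u x * g x) + (1 - a) * (v x * g x) \<partial>m)"
      by (intro Bochner_Integration.integral_add[symmetric] B_b_integrable[OF m] B_b_times B_b_const uB vB g)
    also have "\<dots> = (\<integral>x. g x \<partial>m)"
    proof (intro Bochner_Integration.integral_cong refl)
      fix x
      have "(1 - a) * v x = 1 - a * u x" using a unfolding v_def by simp
      then have "(1 - a) * (v x * g x) = (1 - a * u x) * g x" by (metis mult.assoc)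
      then show "a * (u x * g x) + (1 - a) * (v x * g x) = g x" by (simp add: algebra_simps)
    qed
    finally show "(\<integral>x. g x \<partial>m) = a * (\<integral>x. g x \<partial>p) + (1 - a) * (\<integral>x. g x \<partial>q)" ..
  qed
qed

section \<open>Markov-Feller semigroups\<close>

locale markov_feller =
  fixes T :: "real set" and P :: "real \<Rightarrow> 'a::polish_space \<Rightarrow> 'a measure"
  assumes time: "T = {0..} \<or> T = real ` {1..}"
    and feller: "markov_feller_semigroup T P"
begin

lemma T_diff:
  assumes "s \<in> T" "t \<in> T" "s + 1 \<le> t" shows "t - s \<in> T"
  using time
proof
  assume "T = real ` {1..}"
  then obtain m n where mn: "s = real m" "t = real n" using assms by auto
  then have "n - m \<ge> 1" "real (n - m) = t - s" using assms(3) by auto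
  then show ?thesis using \<open>T = _\<close> by (metis atLeast_iff imageI)
qed (use assms in auto)

lemma T_Suc: "real (Suc n) \<in> T"
  using time by (auto intro: image_eqI[of _ real "Suc n"] simp del: of_nat_Suc)

lemma at_top_in_nonbot: "at_top_in T \<noteq> bot"
proof
  assume "at_top_in T = bot"
  then have "eventually (\<lambda>_. False) (at_top_in T)" by simp
  then obtain N where N: "\<forall>t\<in>T. \<not> N \<le> t" unfolding eventually_at_top_in by auto
  obtain n where "real n \<ge> N" using real_arch_simple by blast
  then show False using N T_Suc[of n] by force
qed

lemma eventually_in_T: "eventually (\<lambda>t. t \<in> T) (at_top_in T)"
  by (auto simp: eventually_at_top_in)

text \<open>
  The margin of one time unit in \<open>T_diff\<close> covers discrete time, where the difference of two times
  must again be at least one.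
\<close>

lemma eventually_shift:
  assumes s: "s \<in> T" and Q: "eventually Q (at_top_in T)"
  shows "eventually (\<lambda>t. t - s \<in> T \<and> Q (t - s)) (at_top_in T)"
proof -
  obtain N where N: "\<And>t. t \<in> T \<Longrightarrow> t \<ge> N \<Longrightarrow> Q t" using Q unfolding eventually_at_top_in by blast
  show ?thesis unfolding eventually_at_top_in
    by (rule exI[of _ "max (s + 1) (s + N)"]) (use s T_diff N in auto)
qed

lemma kernel_measurable: "t \<in> T \<Longrightarrow> P t \<in> borel \<rightarrow>\<^sub>M prob_algebra borel"
  using feller unfolding markov_feller_semigroup_def markov_semigroup_def by auto

lemma kernel_M_1: "t \<in> T \<Longrightarrow> P t x \<in> M_1"
  using measurable_space[OF kernel_measurable, of t x] by simp

lemma op_C_b: "t \<in> T \<Longrightarrow> f \<in> C_b \<Longrightarrow> kernel_op (P t) f \<in> C_b"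
  using feller unfolding markov_feller_semigroup_def by auto

lemma op_add: "s \<in> T \<Longrightarrow> t \<in> T \<Longrightarrow> f \<in> B_b \<Longrightarrow> kernel_op (P (t + s)) f = kernel_op (P t) (kernel_op (P s) f)"
  using feller unfolding markov_feller_semigroup_def markov_semigroup_def by auto

lemma op_split:
  assumes "s \<in> T" "t - s \<in> T" "f \<in> B_b"
  shows "kernel_op (P t) f = kernel_op (P (t - s)) (kernel_op (P s) f)"
    and "kernel_op (P t) f = kernel_op (P s) (kernel_op (P (t - s)) f)"
  using op_add[OF assms(1,2,3)] op_add[OF assms(2,1,3)] by simp_all

lemma op_bound: "t \<in> T \<Longrightarrow> f \<in> B_b \<Longrightarrow> (\<And>x. \<bar>f x\<bar> \<le> C) \<Longrightarrow> \<bar>kernel_op (P t) f x\<bar> \<le> C"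
  unfolding kernel_op_def by (intro expectation_bound kernel_M_1)

lemma op_mono: "t \<in> T \<Longrightarrow> f \<in> B_b \<Longrightarrow> g \<in> B_b \<Longrightarrow> (\<And>x. f x \<le> g x) \<Longrightarrow> kernel_op (P t) f x \<le> kernel_op (P t) g x"
  unfolding kernel_op_def by (intro expectation_mono kernel_M_1)

lemma op_indicator: "t \<in> T \<Longrightarrow> kernel_op (P t) (indicator B) x = measure (P t x) B"
  unfolding kernel_op_def by (intro expectation_indicator kernel_M_1)

lemma op_B_b:
  assumes t: "t \<in> T" and f: "f \<in> B_b" shows "kernel_op (P t) f \<in> B_b"
proof -
  obtain C where C: "\<And>x. \<bar>f x\<bar> \<le> C" using B_b_bound[OF f] by blast
  have "(\<lambda>x. integral\<^sup>L (P t x) f) \<in> borel_measurable borel"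
    using measurable_compose[OF measurable_prob_algebraD[OF kernel_measurable[OF t]]
        integral_measurable_subprob_algebra[OF B_b_meas[OF f]]] .
  moreover have "kernel_op (P t) f = (\<lambda>x. integral\<^sup>L (P t x) f)"
    by (rule ext) (simp add: kernel_op_def)
  ultimately have "kernel_op (P t) f \<in> borel_measurable borel" by simp
  then show ?thesis using op_bound[OF t f C] by (rule B_bI)
qed

lemma dual_M_1:
  assumes t: "t \<in> T" and \<nu>: "\<nu> \<in> M_1" shows "dual_op (P t) \<nu> \<in> M_1"
  using prob_space_bind'[OF \<nu> kernel_measurable[OF t]] sets_bind'[OF \<nu> kernel_measurable[OF t]]
  by (simp add: dual_op_def space_prob_algebra)

lemma expectation_dual:
  assumes t: "t \<in> T" and \<nu>: "\<nu> \<in> M_1" and f: "f \<in> B_b"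
  shows "(\<integral>x. f x \<partial>dual_op (P t) \<nu>) = (\<integral>x. kernel_op (P t) f x \<partial>\<nu>)"
proof -
  interpret prob_space \<nu> by (rule M_1D[OF \<nu>])
  obtain C where C: "\<And>x. \<bar>f x\<bar> \<le> C" using B_b_bound[OF f] by blast
  have K: "P t \<in> \<nu> \<rightarrow>\<^sub>M subprob_algebra borel"
    using measurable_prob_algebraD[OF kernel_measurable[OF t]] measurable_cong_sets[OF M_1D(2)[OF \<nu>] refl] by blast
  show ?thesis unfolding dual_op_def kernel_op_def
  proof (rule integral_bind[OF B_b_meas[OF f] _ K])
    show "\<bar>f x\<bar> \<le> C" for x by (rule C)
    show "AE x in \<nu>. emeasure (P t x) (space (P t x)) \<le> ennreal 1"
      using prob_space.emeasure_space_1[OF M_1D(1)[OF kernel_M_1[OF t]]] by simp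
  qed (rule finite_measure_axioms)
qed

lemma return_M_1: "return borel x \<in> M_1"
  by (simp add: space_prob_algebra prob_space_return)

lemma expectation_return: "f \<in> B_b \<Longrightarrow> (\<integral>y. f y \<partial>return borel x) = f x"
  by (intro integral_return B_b_meas) auto

section \<open>The two hypotheses at a point\<close>

text \<open>
  The order of the quantifiers matters: the bound \<open>\<alpha>\<close> is uniform in the starting point, the time from
  which it holds is not.
\<close>

definition recurrent_at :: "'a \<Rightarrow> bool" where
  "recurrent_at z \<longleftrightarrow> (\<forall>\<epsilon>>0. \<exists>\<alpha>>0. \<forall>x. \<forall>\<^sub>F t in at_top_in T. \<alpha> < measure (P t x) (ball z \<epsilon>))"

definition eventually_continuous_at :: "'a \<Rightarrow> bool" where
  "eventually_continuous_at z \<longleftrightarrow> (\<forall>f\<in>L_b. \<forall>\<delta>>0. \<exists>\<epsilon>>0. \<forall>x\<in>ball z \<epsilon>.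
     \<forall>\<^sub>F t in at_top_in T. \<bar>kernel_op (P t) f x - kernel_op (P t) f z\<bar> < \<delta>)"

lemma recurrent_atI:
  assumes "\<forall>\<epsilon>>0. (INF x. Liminf (at_top_in T) (\<lambda>t. ereal (measure (P t x) (ball z \<epsilon>)))) > 0"
  shows "recurrent_at z"
  unfolding recurrent_at_def
proof (intro allI impI)
  fix \<epsilon> :: real assume "\<epsilon> > 0"
  with assms have "0 < (INF x. Liminf (at_top_in T) (\<lambda>t. ereal (measure (P t x) (ball z \<epsilon>))))" by blast
  from ereal_dense2[OF this] obtain \<alpha> :: real
    where \<alpha>: "0 < ereal \<alpha>" "ereal \<alpha> < (INF x. Liminf (at_top_in T) (\<lambda>t. ereal (measure (P t x) (ball z \<epsilon>))))"
    by auto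
  have "\<forall>\<^sub>F t in at_top_in T. \<alpha> < measure (P t x) (ball z \<epsilon>)" for x
  proof -
    have "ereal \<alpha> < Liminf (at_top_in T) (\<lambda>t. ereal (measure (P t x) (ball z \<epsilon>)))"
      by (rule less_le_trans[OF \<alpha>(2)]) (rule INF_lower, simp)
    from less_LiminfD[OF this] show ?thesis by simp
  qed
  then show "\<exists>\<alpha>>0. \<forall>x. \<forall>\<^sub>F t in at_top_in T. \<alpha> < measure (P t x) (ball z \<epsilon>)" using \<alpha>(1) by auto
qed

lemma eventually_continuous_atI:
  assumes "eventually_continuous T P" shows "eventually_continuous_at z"
  unfolding eventually_continuous_at_def
proof (intro ballI allI impI)
  fix f :: "'a \<Rightarrow> real" and \<delta> :: real assume f: "f \<in> L_b" and \<delta>: "\<delta> > 0"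
  define l where "l x = Limsup (at_top_in T) (\<lambda>t. ereal \<bar>kernel_op (P t) f x - kernel_op (P t) f z\<bar>)" for x
  have "(l \<longlongrightarrow> 0) (at z)" using assms f unfolding eventually_continuous_def l_def[abs_def] by blast
  then have "\<forall>\<^sub>F x in at z. l x < ereal \<delta>" using \<delta> by (intro order_tendstoD) auto
  then obtain \<epsilon> where \<epsilon>: "\<epsilon> > 0" "\<And>x. x \<noteq> z \<Longrightarrow> dist x z < \<epsilon> \<Longrightarrow> l x < ereal \<delta>"
    unfolding eventually_at by auto
  have "\<forall>\<^sub>F t in at_top_in T. \<bar>kernel_op (P t) f x - kernel_op (P t) f z\<bar> < \<delta>" if "x \<in> ball z \<epsilon>" for x
  proof (cases "x = z")
    case False
    then have "l x < ereal \<delta>" using \<epsilon>(2) that by (simp add: dist_commute)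
    from Limsup_lessD[OF this[unfolded l_def]] show ?thesis by simp
  qed (use \<delta> in simp)
  then show "\<exists>\<epsilon>>0. \<forall>x\<in>ball z \<epsilon>. \<forall>\<^sub>F t in at_top_in T. \<bar>kernel_op (P t) f x - kernel_op (P t) f z\<bar> < \<delta>"
    using \<epsilon>(1) by blast
qed

section \<open>Forgetting the initial distribution\<close>

text \<open>
  Truncating the transition probabilities at \<open>\<alpha>\<close> makes them converge to the constant \<open>\<alpha>\<close>
  pointwise, so dominated convergence integrates the lower bound although the time at which it sets in
  depends on the starting point.
\<close>

lemma eventually_mass_near:
  assumes \<nu>: "\<nu> \<in> M_1" and lb: "\<And>x. \<forall>\<^sub>F t in at_top_in T. \<alpha> < measure (P t x) B" and B: "B \<in> sets borel"
    and a: "0 < a" "a < \<alpha>"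
  shows "\<forall>\<^sub>F t in at_top_in T. a < measure (dual_op (P t) \<nu>) B"
proof -
  define F where "F t x = min (kernel_op (P t) (indicator B) x) \<alpha>" for t x
  have k01: "0 \<le> kernel_op (P t) (indicator B) x" "kernel_op (P t) (indicator B) x \<le> 1" if "t \<in> T" for t x
    unfolding op_indicator[OF that] using prob_space.prob_le_1[OF M_1D(1)[OF kernel_M_1[OF that]]] by auto
  have FB: "F t \<in> B_b" if "t \<in> T" for t
  proof (rule B_bI[of _ "1 + \<alpha>"])
    show "F t \<in> borel_measurable borel" unfolding F_def[abs_def]
      using B_b_meas[OF op_B_b[OF that B_b_indicator[OF B]]] by measurable
    show "\<bar>F t x\<bar> \<le> 1 + \<alpha>" for x using k01[OF that, of x] a unfolding F_def by linarith
  qed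
  have "((\<lambda>t. \<integral>x. F t x \<partial>\<nu>) \<longlongrightarrow> (\<integral>x. \<alpha> \<partial>\<nu>)) (at_top_in T)"
  proof (rule expectation_dominated_at_top_in[OF \<nu>, of T _ "1 + \<alpha>"])
    show "F t \<in> B_b" if "t \<in> T" for t by (rule FB[OF that])
    show "\<bar>F t x\<bar> \<le> 1 + \<alpha>" if "t \<in> T" for t x using k01[OF that, of x] a unfolding F_def by linarith
    show "((\<lambda>t. F t x) \<longlongrightarrow> \<alpha>) (at_top_in T)" for x
    proof (rule tendsto_eventually)
      show "\<forall>\<^sub>F t in at_top_in T. F t x = \<alpha>"
        using lb[of x] eventually_in_T by eventually_elim (simp add: F_def op_indicator)
    qed
  qed simp
  then have "\<forall>\<^sub>F t in at_top_in T. a < (\<integral>x. F t x \<partial>\<nu>)"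
    unfolding expectation_const[OF \<nu>] using a by (intro order_tendstoD)
  with eventually_in_T show ?thesis
  proof eventually_elim
    case (elim t)
    have "(\<integral>x. F t x \<partial>\<nu>) \<le> (\<integral>x. kernel_op (P t) (indicator B) x \<partial>\<nu>)"
      using elim B by (intro expectation_mono \<nu> FB op_B_b B_b_indicator) (auto simp: F_def)
    also have "\<dots> = measure (dual_op (P t) \<nu>) B"
      by (rule measure_dual_op[OF kernel_measurable[OF elim(1)] \<nu> B, symmetric])
    finally show ?case using elim by simp
  qed
qed

text \<open>
  The excess of \<open>\<bar>D t x\<bar>\<close> over \<open>\<delta>\<close> vanishes eventually for each \<open>x\<close> in \<open>B\<close>, hence its
  mean vanishes in the limit; the factor two absorbs the remainder.
\<close>

lemma concentrated_expectation:
  assumes p: "p \<in> M_1" "measure p B = 1" and B: "B \<in> sets borel" and f: "f \<in> B_b" and \<delta>: "\<delta> > 0"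
    and near: "\<And>x. x \<in> B \<Longrightarrow> \<forall>\<^sub>F t in at_top_in T. \<bar>kernel_op (P t) f x - kernel_op (P t) f z\<bar> < \<delta>"
  shows "\<forall>\<^sub>F t in at_top_in T. \<bar>(\<integral>x. kernel_op (P t) f x \<partial>p) - kernel_op (P t) f z\<bar> < 2 * \<delta>"
proof -
  interpret prob_space p by (rule M_1D[OF p(1)])
  obtain C where C: "C > 0" "\<And>x. \<bar>f x\<bar> \<le> C" using B_b_bound[OF f] by blast
  define D where "D t x = kernel_op (P t) f x - kernel_op (P t) f z" for t x
  define F where "F t x = max 0 (\<bar>D t x\<bar> - \<delta>) * indicator B x" for t x
  have DB: "D t \<in> B_b" if "t \<in> T" for t
    unfolding D_def[abs_def] by (intro B_b_diff op_B_b that f B_b_const)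
  have Fb: "\<bar>F t x\<bar> \<le> 2 * C" if "t \<in> T" for t x
  proof -
    have "\<bar>D t x\<bar> \<le> 2 * C"
      using op_bound[OF that f C(2), of x] op_bound[OF that f C(2), of z] unfolding D_def by linarith
    then show ?thesis using C(1) \<delta> unfolding F_def by (auto simp: indicator_def)
  qed
  have FB: "F t \<in> B_b" if "t \<in> T" for t
  proof (rule B_bI[OF _ Fb[OF that]])
    show "F t \<in> borel_measurable borel" unfolding F_def[abs_def]
      using B_b_meas[OF DB[OF that]] B by measurable
  qed
  have "((\<lambda>t. \<integral>x. F t x \<partial>p) \<longlongrightarrow> (\<integral>x. 0 \<partial>p)) (at_top_in T)"
  proof (rule expectation_dominated_at_top_in[OF p(1) FB Fb])
    show "((\<lambda>t. F t x) \<longlongrightarrow> 0) (at_top_in T)" for x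
    proof (cases "x \<in> B")
      case True
      from near[OF True] have "\<forall>\<^sub>F t in at_top_in T. F t x = 0"
        by eventually_elim (simp add: F_def D_def)
      then show ?thesis by (rule tendsto_eventually)
    qed (simp add: F_def)
  qed auto
  then have "\<forall>\<^sub>F t in at_top_in T. (\<integral>x. F t x \<partial>p) < \<delta>"
    using \<delta> by (intro order_tendstoD) auto
  with eventually_in_T show ?thesis
  proof eventually_elim
    case (elim t)
    have int: "integrable p (kernel_op (P t) f)" "integrable p (F t)" "integrable p (D t)"
      using B_b_integrable[OF p(1)] op_B_b[OF elim(1) f] FB DB elim by auto
    have "(\<integral>x. kernel_op (P t) f x \<partial>p) - kernel_op (P t) f z = (\<integral>x. D t x \<partial>p)"
      unfolding D_def by (simp add: int prob_space)
    also have "\<bar>\<dots>\<bar> \<le> (\<integral>x. \<bar>D t x\<bar> \<partial>p)" by (rule integral_abs_bound)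
    also have "\<dots> \<le> (\<integral>x. \<delta> + F t x \<partial>p)"
    proof (rule integral_mono_AE)
      have "AE x in p. x \<in> B"
        using p(2) B M_1D(2)[OF p(1)] by (subst (asm) prob_eq_1) auto
      then show "AE x in p. \<bar>D t x\<bar> \<le> \<delta> + F t x"
        by eventually_elim (simp add: F_def)
    qed (use int in auto)
    also have "\<dots> = \<delta> + (\<integral>x. F t x \<partial>p)" using int by (simp add: prob_space)
    finally show ?case using elim by linarith
  qed
qed

text \<open>
  A coupling argument.  At a common time \<open>s\<close> both laws charge \<open>B\<close> with mass at least \<open>a\<close>.
  Started from the parts inside \<open>B\<close>, both evolutions of \<open>f\<close> follow the one from \<open>z\<close>; the
  remaining parts are again probability measures, so the previous bound \<open>c\<close> applies to them with
  weight \<open>1 - a\<close>.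
\<close>

lemma contraction_step:
  assumes f: "f \<in> B_b" and B: "B \<in> sets borel" and \<delta>: "\<delta> > 0" and a: "0 < a" "a < 1" "a < \<alpha>"
    and lb: "\<And>x. \<forall>\<^sub>F t in at_top_in T. \<alpha> < measure (P t x) B"
    and near: "\<And>x. x \<in> B \<Longrightarrow> \<forall>\<^sub>F t in at_top_in T. \<bar>kernel_op (P t) f x - kernel_op (P t) f z\<bar> < \<delta>"
    and c: "\<And>\<nu> \<nu>'. \<nu> \<in> M_1 \<Longrightarrow> \<nu>' \<in> M_1 \<Longrightarrow>
      \<forall>\<^sub>F t in at_top_in T. \<bar>(\<integral>x. kernel_op (P t) f x \<partial>\<nu>) - (\<integral>x. kernel_op (P t) f x \<partial>\<nu>')\<bar> \<le> c"
    and \<nu>: "\<nu> \<in> M_1" and \<nu>': "\<nu>' \<in> M_1"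
  shows "\<forall>\<^sub>F t in at_top_in T. \<bar>(\<integral>x. kernel_op (P t) f x \<partial>\<nu>) - (\<integral>x. kernel_op (P t) f x \<partial>\<nu>')\<bar> \<le> a * (4 * \<delta>) + (1 - a) * c"
proof -
  have "\<forall>\<^sub>F s in at_top_in T. s \<in> T \<and> a < measure (dual_op (P s) \<nu>) B \<and> a < measure (dual_op (P s) \<nu>') B"
    using eventually_in_T eventually_mass_near[OF \<nu> lb B a(1,3)] eventually_mass_near[OF \<nu>' lb B a(1,3)]
    by eventually_elim auto
  then obtain s where s: "s \<in> T" "a < measure (dual_op (P s) \<nu>) B" "a < measure (dual_op (P s) \<nu>') B"
    using at_top_in_nonbot by (metis (mono_tags, lifting) eventually_happens')
  have ex: "\<exists>p q. p \<in> M_1 \<and> q \<in> M_1 \<and> measure p B = 1 \<and>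
      (\<forall>g\<in>B_b. (\<integral>x. g x \<partial>m) = a * (\<integral>x. g x \<partial>p) + (1 - a) * (\<integral>x. g x \<partial>q))"
    if m: "m \<in> M_1" "a < measure m B" for m :: "'a measure"
    by (rule split_probability[OF m(1) B a(1,2) less_imp_le[OF m(2)]]) metis
  obtain p q where p: "p \<in> M_1" "measure p B = 1" and q: "q \<in> M_1"
    and pq: "\<And>g. g \<in> B_b \<Longrightarrow> (\<integral>x. g x \<partial>dual_op (P s) \<nu>) = a * (\<integral>x. g x \<partial>p) + (1 - a) * (\<integral>x. g x \<partial>q)"
    using ex[OF dual_M_1[OF s(1) \<nu>] s(2)] by metis
  obtain p' q' where p': "p' \<in> M_1" "measure p' B = 1" and q': "q' \<in> M_1"
    and pq': "\<And>g. g \<in> B_b \<Longrightarrow> (\<integral>x. g x \<partial>dual_op (P s) \<nu>') = a * (\<integral>x. g x \<partial>p') + (1 - a) * (\<integral>x. g x \<partial>q')"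
    using ex[OF dual_M_1[OF s(1) \<nu>'] s(3)] by metis
  have near_p: "\<forall>\<^sub>F t in at_top_in T. \<bar>(\<integral>x. kernel_op (P t) f x \<partial>p) - kernel_op (P t) f z\<bar> < 2 * \<delta>"
    by (rule concentrated_expectation[OF p B f \<delta> near])
  have near_p': "\<forall>\<^sub>F t in at_top_in T. \<bar>(\<integral>x. kernel_op (P t) f x \<partial>p') - kernel_op (P t) f z\<bar> < 2 * \<delta>"
    by (rule concentrated_expectation[OF p' B f \<delta> near])
  have *: "\<forall>\<^sub>F t in at_top_in T. \<bar>(\<integral>x. kernel_op (P t) f x \<partial>dual_op (P s) \<nu>) - (\<integral>x. kernel_op (P t) f x \<partial>dual_op (P s) \<nu>')\<bar>
      \<le> a * (4 * \<delta>) + (1 - a) * c"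
    using eventually_in_T near_p near_p' c[OF q q']
  proof eventually_elim
    case (elim t)
    define x where "x = (\<integral>x. kernel_op (P t) f x \<partial>p) - (\<integral>x. kernel_op (P t) f x \<partial>p')"
    define y where "y = (\<integral>x. kernel_op (P t) f x \<partial>q) - (\<integral>x. kernel_op (P t) f x \<partial>q')"
    have "\<bar>x\<bar> \<le> 4 * \<delta>" "\<bar>y\<bar> \<le> c" using elim unfolding x_def y_def by linarith+
    then have "\<bar>a * x\<bar> \<le> a * (4 * \<delta>)" "\<bar>(1 - a) * y\<bar> \<le> (1 - a) * c"
      using a by (simp_all add: abs_mult)
    moreover have "(\<integral>x. kernel_op (P t) f x \<partial>dual_op (P s) \<nu>) - (\<integral>x. kernel_op (P t) f x \<partial>dual_op (P s) \<nu>') = a * x + (1 - a) * y"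
      unfolding pq[OF op_B_b[OF elim(1) f]] pq'[OF op_B_b[OF elim(1) f]] x_def y_def by (simp add: algebra_simps)
    ultimately show ?case by linarith
  qed
  from eventually_shift[OF s(1) *] show ?thesis
  proof eventually_elim
    case (elim t)
    then have t: "t - s \<in> T" by simp
    show ?case
      using elim unfolding expectation_dual[OF s(1) \<nu> op_B_b[OF t f]] expectation_dual[OF s(1) \<nu>' op_B_b[OF t f]]
        op_split(2)[OF s(1) t f, symmetric] by simp
  qed
qed

text \<open>
  Iterating the contraction drives the bound for the asymptotic discrepancy from \<open>2 C\<close> down to
  \<open>4 \<delta>\<close>, where \<open>\<delta>\<close> measures the oscillation of the evolved \<open>f\<close> near \<open>z\<close> and is
  arbitrary.
\<close>

theorem forgetting:
  assumes rec: "recurrent_at z" and ec: "eventually_continuous_at z"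
    and f: "f \<in> L_b" and \<nu>: "\<nu> \<in> M_1" and \<nu>': "\<nu>' \<in> M_1"
  shows "((\<lambda>t. (\<integral>x. kernel_op (P t) f x \<partial>\<nu>) - (\<integral>x. kernel_op (P t) f x \<partial>\<nu>')) \<longlongrightarrow> 0) (at_top_in T)"
proof (rule tendstoI)
  fix e :: real assume e: "e > 0"
  (* The limit bound 4 * \<delta> has to stay strictly below e. *)
  define \<delta> where "\<delta> = e / 8"
  have \<delta>: "\<delta> > 0" "4 * \<delta> = e / 2" using e unfolding \<delta>_def by auto
  have fB: "f \<in> B_b" using f by (intro C_b_B_b L_b_C_b)
  obtain C where C: "C > 0" "\<And>x. \<bar>f x\<bar> \<le> C" using B_b_bound[OF fB] by blast
  obtain \<epsilon> where \<epsilon>: "\<epsilon> > 0" "\<And>x. x \<in> ball z \<epsilon> \<Longrightarrow>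
      \<forall>\<^sub>F t in at_top_in T. \<bar>kernel_op (P t) f x - kernel_op (P t) f z\<bar> < \<delta>"
    using ec f \<delta>(1) unfolding eventually_continuous_at_def by blast
  obtain \<alpha> where \<alpha>: "\<alpha> > 0" "\<And>x. \<forall>\<^sub>F t in at_top_in T. \<alpha> < measure (P t x) (ball z \<epsilon>)"
    using rec \<epsilon>(1) unfolding recurrent_at_def by blast
  define a where "a = min \<alpha> 1 / 2"
  have a: "0 < a" "a < 1" "a < \<alpha>" using \<alpha>(1) unfolding a_def by auto
  have claim: "\<forall>\<nu>\<in>M_1. \<forall>\<nu>'\<in>M_1. \<forall>\<^sub>F t in at_top_in T.
      \<bar>(\<integral>x. kernel_op (P t) f x \<partial>\<nu>) - (\<integral>x. kernel_op (P t) f x \<partial>\<nu>')\<bar> \<le> 4 * \<delta> + (1 - a) ^ k * (2 * C)" for k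
  proof (induction k)
    case 0
    show ?case
    proof (intro ballI)
      fix \<nu> \<nu>' :: "'a measure" assume *: "\<nu> \<in> M_1" "\<nu>' \<in> M_1"
      show "\<forall>\<^sub>F t in at_top_in T. \<bar>(\<integral>x. kernel_op (P t) f x \<partial>\<nu>) - (\<integral>x. kernel_op (P t) f x \<partial>\<nu>')\<bar> \<le> 4 * \<delta> + (1 - a) ^ 0 * (2 * C)"
        using eventually_in_T
      proof eventually_elim
        case (elim t)
        have "\<bar>\<integral>x. kernel_op (P t) f x \<partial>m\<bar> \<le> C" if "m \<in> M_1" for m
          by (intro expectation_bound that op_B_b elim fB op_bound C)
        from this[OF *(1)] this[OF *(2)] show ?case using \<delta>(1) by simp
      qed
    qed
  next
    case (Suc k)
    have "a * (4 * \<delta>) + (1 - a) * (4 * \<delta> + (1 - a) ^ k * (2 * C)) = 4 * \<delta> + (1 - a) ^ Suc k * (2 * C)"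
      by (simp add: algebra_simps)
    note eq = this
    show ?case
    proof (intro ballI)
      fix \<nu> \<nu>' :: "'a measure" assume *: "\<nu> \<in> M_1" "\<nu>' \<in> M_1"
      show "\<forall>\<^sub>F t in at_top_in T. \<bar>(\<integral>x. kernel_op (P t) f x \<partial>\<nu>) - (\<integral>x. kernel_op (P t) f x \<partial>\<nu>')\<bar>
          \<le> 4 * \<delta> + (1 - a) ^ Suc k * (2 * C)"
        unfolding eq[symmetric] by (rule contraction_step[OF fB _ \<delta>(1) a \<alpha>(2) \<epsilon>(2) _ *]) (use Suc in auto)
    qed
  qed
  have "(\<lambda>k. 4 * \<delta> + (1 - a) ^ k * (2 * C)) \<longlonglongrightarrow> 4 * \<delta> + 0 * (2 * C)"
    using a by (intro tendsto_intros LIMSEQ_power_zero) auto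
  moreover have "4 * \<delta> + 0 * (2 * C) < e" using e \<delta>(2) by simp
  ultimately have "\<forall>\<^sub>F k in sequentially. 4 * \<delta> + (1 - a) ^ k * (2 * C) < e"
    by (rule order_tendstoD(2))
  then obtain k where k: "4 * \<delta> + (1 - a) ^ k * (2 * C) < e" by (auto simp: eventually_sequentially)
  have "\<forall>\<^sub>F t in at_top_in T. \<bar>(\<integral>x. kernel_op (P t) f x \<partial>\<nu>) - (\<integral>x. kernel_op (P t) f x \<partial>\<nu>')\<bar> \<le> 4 * \<delta> + (1 - a) ^ k * (2 * C)"
    using claim \<nu> \<nu>' by blast
  then show "\<forall>\<^sub>F t in at_top_in T. dist ((\<integral>x. kernel_op (P t) f x \<partial>\<nu>) - (\<integral>x. kernel_op (P t) f x \<partial>\<nu>')) 0 < e"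
    by eventually_elim (use k in simp)
qed

end

section \<open>Asymptotic tightness\<close>

lemma bump_sum_expectation:
  fixes \<phi> :: "nat \<Rightarrow> 'a::metric_space \<Rightarrow> real"
  assumes lip: "\<And>i. L-lipschitz_on UNIV (\<phi> i)" and nn: "\<And>i x. 0 \<le> \<phi> i x" and le: "\<And>i x. \<phi> i x \<le> 1"
    and disj: "\<And>i j x. 0 < \<phi> i x \<and> 0 < \<phi> j x \<longrightarrow> i = j" and \<nu>: "\<nu> \<in> M_1"
  shows "(\<lambda>i. (\<integral>x. \<phi> i x \<partial>\<nu>) * indicator J i) sums (\<integral>x. (\<Sum>i. \<phi> i x * indicator J i) \<partial>\<nu>)"
proof -
  note bs = lipschitz_bump_sum[where \<phi> = \<phi>, OF lip nn le disj]
  have \<phi>: "\<phi> i \<in> C_b" for i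
    by (rule C_bI[OF lipschitz_on_continuous_on[OF lip], of _ 1]) (simp add: nn le)
  have sm: "summable (\<lambda>i. \<phi> i x * indicator J i)" for x
    by (rule summable_comparison_test'[OF bs(2)[where x = x], where N = 0]) (auto simp: indicator_def nn)
  have part: "(\<Sum>i<n. \<phi> i x * indicator J i) \<le> 1" for n x
  proof -
    have "(\<Sum>i<n. \<phi> i x * indicator J i) \<le> (\<Sum>i<n. \<phi> i x)" by (intro sum_mono) (auto simp: indicator_def nn)
    also have "\<dots> \<le> (\<Sum>i. \<phi> i x)" by (rule sum_le_suminf[OF bs(2)]) (auto simp: nn)
    finally show ?thesis using bs(3)[where x = x] by linarith
  qed
  have sB: "(\<lambda>x. \<Sum>i<n. \<phi> i x * indicator J i) \<in> B_b" for n
    using C_b_sum[of "{..<n}" "\<lambda>i x. indicator J i * \<phi> i x"] C_b_cmult[OF \<phi>] by (simp add: mult.commute C_b_B_b)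
  have "(\<lambda>n. \<integral>x. (\<Sum>i<n. \<phi> i x * indicator J i) \<partial>\<nu>) \<longlonglongrightarrow> (\<integral>x. (\<Sum>i. \<phi> i x * indicator J i) \<partial>\<nu>)"
  proof (rule expectation_dominated[OF \<nu> sB, where C = 1])
    show "\<bar>\<Sum>i<n. \<phi> i x * indicator J i\<bar> \<le> 1" for n x
      using part[where n = n and x = x] sum_nonneg[of "{..<n}" "\<lambda>i. \<phi> i x * indicator J i"] nn by simp
    show "(\<lambda>n. \<Sum>i<n. \<phi> i x * indicator J i) \<longlonglongrightarrow> (\<Sum>i. \<phi> i x * indicator J i)" for x
      by (rule summable_LIMSEQ[OF sm])
    show "(\<lambda>x. \<Sum>i. \<phi> i x * indicator J i) \<in> borel_measurable borel"
      by (rule B_b_meas[OF C_b_B_b[OF L_b_C_b[OF bs(1)]]])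
  qed
  moreover have "(\<integral>x. (\<Sum>i<n. \<phi> i x * indicator J i) \<partial>\<nu>) = (\<Sum>i<n. (\<integral>x. \<phi> i x \<partial>\<nu>) * indicator J i)" for n
    using B_b_integrable[OF \<nu> C_b_B_b[OF \<phi>]] by (subst Bochner_Integration.integral_sum) auto
  ultimately show ?thesis unfolding sums_def by simp
qed

lemma finite_net_exhausts:
  fixes q :: "nat \<Rightarrow> 'a::metric_space"
  assumes \<nu>: "\<nu> \<in> M_1" and q: "\<And>U. open U \<Longrightarrow> U \<noteq> {} \<Longrightarrow> \<exists>i. q i \<in> U" and r: "r > 0"
  shows "(\<lambda>j. measure \<nu> {x. infdist x (q ` {..j}) \<ge> r}) \<longlonglongrightarrow> 0"
proof -
  interpret prob_space \<nu> by (rule M_1D[OF \<nu>])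
  have "(\<lambda>j. measure \<nu> {x. infdist x (q ` {..j}) \<ge> r}) \<longlonglongrightarrow> measure \<nu> (\<Inter>j. {x. infdist x (q ` {..j}) \<ge> r})"
  proof (rule finite_Lim_measure_decseq)
    have "closed {x. infdist x (q ` {..j}) \<ge> r}" for j
      by (intro closed_Collect_le continuous_intros)
    then show "range (\<lambda>j. {x. infdist x (q ` {..j}) \<ge> r}) \<subseteq> events"
      by (auto simp: M_1D(2)[OF \<nu>])
    show "decseq (\<lambda>j. {x. infdist x (q ` {..j}) \<ge> r})"
    proof (rule decseq_SucI, rule subsetI)
      fix j x assume "x \<in> {x. infdist x (q ` {..Suc j}) \<ge> r}"
      moreover have "infdist x (q ` {..Suc j}) \<le> infdist x (q ` {..j})" by (intro infdist_mono image_mono) auto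
      ultimately show "x \<in> {x. infdist x (q ` {..j}) \<ge> r}" by simp
    qed
  qed
  moreover have "(\<Inter>j. {x. infdist x (q ` {..j}) \<ge> r}) = {}"
  proof (rule ccontr)
    assume "\<not> ?thesis"
    then obtain x where x: "\<And>j. infdist x (q ` {..j}) \<ge> r" by auto
    obtain i where "q i \<in> ball x r" using q[of "ball x r"] r by auto
    then have "infdist x (q ` {..i}) < r" using infdist_le[of "q i" "q ` {..i}" x] by auto
    then show False using x[of i] by simp
  qed
  ultimately show ?thesis by simp
qed

text \<open>
  The closed set \<open>S\<close> is itself completely metrizable, so Baire's theorem holds in its relative
  topology.
\<close>

lemma baire_closed_cover:
  fixes A :: "nat \<Rightarrow> 'a::polish_space set"
  assumes S: "closed S" "S \<noteq> {}" and A: "\<And>m. closed (A m)" "S \<subseteq> (\<Union>m. A m)"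
  obtains m V where "open V" "V \<inter> S \<noteq> {}" "V \<inter> S \<subseteq> A m"
proof -
  have "\<exists>m. (top_of_set S) interior_of (S \<inter> A m) \<noteq> {}"
  proof (rule ccontr)
    assume *: "\<not> ?thesis"
    have "(top_of_set S) interior_of (\<Union> (range (\<lambda>m. S \<inter> A m))) = {}"
    proof (rule Baire_category_alt)
      have "completely_metrizable_space (top_of_set S)"
        using S(1) by (intro completely_metrizable_space_closedin completely_metrizable_space_euclidean) simp
      then show "completely_metrizable_space (top_of_set S) \<or> locally_compact_space (top_of_set S) \<and> regular_space (top_of_set S)" ..
      fix C assume "C \<in> range (\<lambda>m. S \<inter> A m)"
      then show "closedin (top_of_set S) C \<and> top_of_set S interior_of C = {}"
        using * A(1) by (auto intro: closedin_closed_Int)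
    qed simp
    moreover have "\<Union> (range (\<lambda>m. S \<inter> A m)) = S" using A(2) by auto
    moreover have "(top_of_set S) interior_of S = S" using interior_of_topspace[of "top_of_set S"] by simp
    ultimately show False using S(2) by simp
  qed
  then obtain m x where "x \<in> (top_of_set S) interior_of (S \<inter> A m)" by auto
  then obtain W where W: "openin (top_of_set S) W" "x \<in> W" "W \<subseteq> S \<inter> A m"
    unfolding interior_of_def by auto
  then obtain V where "open V" "W = S \<inter> V" unfolding openin_open by auto
  then show ?thesis using W by (intro that[of V m]) auto
qed

context markov_feller
begin

text \<open>
  By the Feller property the probability of entering \<open>V\<close> after \<open>s\<close> time units is bounded below
  near \<open>z\<close>, not just at \<open>z\<close>; and the process is near \<open>z\<close> at all late times with a
  probability bounded below.
\<close>

lemma charged_open_recurrent: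
  assumes rec: "recurrent_at z" and V: "open V" and s: "s \<in> T" "measure (P s z) V > 0"
  obtains \<alpha> where "\<alpha> > 0" "\<forall>\<^sub>F t in at_top_in T. \<alpha> \<le> measure (P t z) V"
proof -
  have "\<exists>h. (\<forall>n. h n \<in> L_b) \<and> (\<forall>n x. 0 \<le> h n x) \<and> (\<forall>n x. h n x \<le> 1) \<and> (\<forall>n x. x \<notin> V \<longrightarrow> h n x = 0) \<and>
      (\<forall>x. (\<lambda>n. h n x) \<longlonglongrightarrow> indicator V x)"
    by (rule open_approx_lipschitz[OF V]) metis
  then obtain h :: "nat \<Rightarrow> 'a \<Rightarrow> real" where h: "\<And>n. h n \<in> L_b" "\<And>n x. 0 \<le> h n x"
    "\<And>n x. h n x \<le> 1" "\<And>n x. x \<notin> V \<Longrightarrow> h n x = 0" "\<And>x. (\<lambda>n. h n x) \<longlonglongrightarrow> indicator V x"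
    by metis
  have hC: "h n \<in> C_b" for n by (intro L_b_C_b h)
  have hV: "h n x \<le> indicator V x" for n x using h(3)[of n x] h(4)[of x n] by (cases "x \<in> V") auto
  have "(\<lambda>n. kernel_op (P s) (h n) z) \<longlonglongrightarrow> kernel_op (P s) (indicator V) z"
    unfolding kernel_op_def
    by (rule expectation_dominated[OF kernel_M_1[OF s(1)] C_b_B_b[OF hC], where C = 1]) (use h V in auto)
  then have "(\<lambda>n. kernel_op (P s) (h n) z) \<longlonglongrightarrow> measure (P s z) V" unfolding op_indicator[OF s(1)] .
  from order_tendstoD(1)[OF this s(2)] obtain n where n: "0 < kernel_op (P s) (h n) z"
    by (auto simp: eventually_sequentially)
  define g where "g = kernel_op (P s) (h n)"
  define c where "c = g z / 2"
  have gC: "g \<in> C_b" unfolding g_def by (intro op_C_b s hC)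
  have c: "0 < c" "c < g z" using n unfolding c_def g_def by auto
  have g0: "0 \<le> g x" for x
    unfolding g_def kernel_op_def by (intro integral_nonneg_AE) (simp add: h)
  have "open {x. c < g x}" by (intro open_Collect_less C_b_cont gC continuous_intros)
  then obtain \<epsilon> where \<epsilon>: "\<epsilon> > 0" "ball z \<epsilon> \<subseteq> {x. c < g x}"
    using c unfolding open_contains_ball by blast
  obtain \<beta> where \<beta>: "\<beta> > 0" "\<forall>\<^sub>F t in at_top_in T. \<beta> < measure (P t z) (ball z \<epsilon>)"
    using rec \<epsilon>(1) unfolding recurrent_at_def by blast
  show ?thesis
  proof (rule that[of "c * \<beta>"])
    show "c * \<beta> > 0" using c \<beta> by simp
    from eventually_shift[OF s(1) \<beta>(2)] eventually_in_T
    show "\<forall>\<^sub>F t in at_top_in T. c * \<beta> \<le> measure (P t z) V"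
    proof eventually_elim
      case (elim t)
      then have t: "t - s \<in> T" "\<beta> < measure (P (t - s) z) (ball z \<epsilon>)" by auto
      have "c * \<beta> \<le> c * measure (P (t - s) z) (ball z \<epsilon>)" using c t by simp
      also have "\<dots> = (\<integral>x. c * indicator (ball z \<epsilon>) x \<partial>P (t - s) z)"
        unfolding integral_mult_right_zero expectation_indicator[OF kernel_M_1[OF t(1)]] ..
      also have "\<dots> \<le> kernel_op (P (t - s)) g z"
        unfolding kernel_op_def
      proof (intro expectation_mono kernel_M_1 t(1) B_b_times B_b_const B_b_indicator C_b_B_b[OF gC])
        show "c * indicator (ball z \<epsilon>) x \<le> g x" for x using \<epsilon>(2) g0[of x] by (auto simp: indicator_def less_imp_le)
      qed auto
      also have "\<dots> = kernel_op (P t) (h n) z"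
        unfolding g_def op_split(1)[OF s(1) t(1) C_b_B_b[OF hC]] ..
      also have "\<dots> \<le> kernel_op (P t) (indicator V) z"
        using elim V by (intro op_mono C_b_B_b[OF hC] B_b_indicator hV) auto
      finally show ?case using op_indicator elim by simp
    qed
  qed
qed

text \<open>
  \<open>S\<close> is the common support of the family \<open>P s z\<close>: by the Lindelof property the union of all
  open sets that are null for every \<open>s\<close> is itself null.
\<close>

lemma charged_support:
  obtains S where "closed S" "S \<noteq> {}" "\<And>s. s \<in> T \<Longrightarrow> measure (P s z) (- S) = 0"
    "\<And>V. open V \<Longrightarrow> V \<inter> S \<noteq> {} \<Longrightarrow> \<exists>s\<in>T. measure (P s z) V > 0"
proof -
  define \<F> where "\<F> = {U. open U \<and> (\<forall>s\<in>T. measure (P s z) U = 0)}"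
  obtain \<F>' where \<F>': "\<F>' \<subseteq> \<F>" "countable \<F>'" "\<Union>\<F>' = \<Union>\<F>"
    using Lindelof[of \<F>] unfolding \<F>_def by blast
  have null: "measure (P s z) (\<Union>\<F>) = 0" if s: "s \<in> T" for s
  proof -
    interpret prob_space "P s z" by (rule M_1D[OF kernel_M_1[OF s]])
    have "U \<in> null_sets (P s z)" if "U \<in> \<F>'" for U
      using that \<F>'(1) s M_1D(2)[OF kernel_M_1[OF s], of z] unfolding \<F>_def
      by (auto simp: null_sets_def emeasure_eq_measure)
    then have "\<Union>\<F>' \<in> null_sets (P s z)" using null_sets_UN'[OF \<F>'(2), of id] by simp
    then show ?thesis unfolding \<F>'(3) by (simp add: null_sets_def emeasure_eq_measure)
  qed
  show ?thesis
  proof (rule that[of "- \<Union>\<F>"])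
    show "closed (- \<Union>\<F>)" unfolding \<F>_def by (auto intro!: closed_Compl)
    show "- \<Union>\<F> \<noteq> {}"
    proof
      assume "- \<Union>\<F> = {}"
      then have "\<Union>\<F> = UNIV" by auto
      then show False
        using null[OF T_Suc[of 0]] prob_space.prob_space[OF M_1D(1)[OF kernel_M_1[OF T_Suc]], of 0 z]
          M_1D(3)[OF kernel_M_1[OF T_Suc], of 0 z] by simp
    qed
    show "measure (P s z) (- (- \<Union>\<F>)) = 0" if "s \<in> T" for s using null[OF that] by simp
    show "\<exists>s\<in>T. measure (P s z) V > 0" if V: "open V" "V \<inter> - \<Union>\<F> \<noteq> {}" for V
    proof (rule ccontr)
      assume "\<not> ?thesis"
      then have "V \<in> \<F>" using V(1) unfolding \<F>_def by (auto simp: zero_less_measure_iff)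
      then show False using V(2) by auto
    qed
  qed
qed

text \<open>
  This is where both hypotheses interact.  If mass \<open>b\<close> kept escaping from every finite net, there
  would be times \<open>\<theta> i\<close> tending to infinity and disjoint Lipschitz bumps \<open>\<phi> i\<close> that receive mass at
  least \<open>b/2\<close> from \<open>z\<close> at time \<open>\<theta> i\<close>.  All sums of subfamilies of the bumps are Lipschitz, so
  forgetting applies to each of them and \<open>schur_diagonal\<close> shows that, for every fixed starting
  point, the mass in \<open>\<phi> i\<close> at time \<open>\<theta> i\<close> is eventually at least \<open>b/4\<close>.
  
  The index from which this holds depends on the point, but Baire's theorem supplies a relatively open
  piece of the support on which it does not.  That piece is visited from \<open>z\<close> at all late times with
  probability at least \<open>\<alpha>\<close>.  Hence at all late times any given number of bumps of large index carry
  mass at least \<open>\<alpha> b/4\<close> each, which in the end exceeds the total mass one.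
\<close>

theorem asymptotically_tight:
  fixes q :: "nat \<Rightarrow> 'a"
  assumes rec: "recurrent_at z" and ec: "eventually_continuous_at z"
    and q: "\<And>U. open U \<Longrightarrow> U \<noteq> {} \<Longrightarrow> \<exists>i. q i \<in> U" and \<eta>: "\<eta> > 0" and b: "b > 0"
  shows "\<exists>j. \<forall>\<^sub>F t in at_top_in T. measure (P t z) {x. infdist x (q ` {..j}) \<ge> 2 * \<eta>} < b"
proof (rule ccontr)
  assume neg: "\<not> ?thesis"
  define E where "E j = q ` {..j}" for j
  have E_mono: "infdist x (E k) \<le> infdist x (E j)" if "j \<le> k" for j k x
    unfolding E_def using that by (intro infdist_mono image_mono) auto
  have step: "\<exists>t j'. t \<in> T \<and> t \<ge> N \<and> j' > j \<and> b / 2 \<le> kernel_op (P t) (shell_bump \<eta> (E j) (E j')) z" for j :: nat and N :: real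
  proof -
    obtain t where t: "t \<in> T" "t \<ge> N" "measure (P t z) {x. infdist x (E j) \<ge> 2 * \<eta>} \<ge> b"
      using neg unfolding eventually_at_top_in E_def by (auto simp: not_less)
    have "\<forall>\<^sub>F j' in sequentially. measure (P t z) {x. infdist x (E j') \<ge> \<eta> / 2} < b / 2"
      using finite_net_exhausts[OF kernel_M_1[OF t(1)] q, of "\<eta> / 2" z] \<eta> b unfolding E_def
      by (intro order_tendstoD) auto
    with eventually_gt_at_top[of j] have "\<forall>\<^sub>F j' in sequentially. j < j' \<and> measure (P t z) {x. infdist x (E j') \<ge> \<eta> / 2} < b / 2"
      by eventually_elim simp
    then obtain j' where j': "j < j'" "measure (P t z) {x. infdist x (E j') \<ge> \<eta> / 2} < b / 2"
      by (auto simp: eventually_sequentially)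
    have cl: "closed {x. infdist x (E i) \<ge> r}" for i r by (intro closed_Collect_le continuous_intros)
    have bB: "shell_bump \<eta> (E j) (E j') \<in> B_b"
      by (rule C_b_B_b[OF C_bI[OF lipschitz_on_continuous_on[OF shell_bump_lipschitz[OF \<eta>]], where C = 1]])
        (simp add: shell_bump_range)
    let ?u = "indicator {x. infdist x (E j) \<ge> 2 * \<eta>} :: 'a \<Rightarrow> real"
    let ?v = "indicator {x. infdist x (E j') \<ge> \<eta> / 2} :: 'a \<Rightarrow> real"
    have uv: "?u \<in> B_b" "?v \<in> B_b" by (intro B_b_indicator borel_closed cl)+
    have "b / 2 \<le> measure (P t z) {x. infdist x (E j) \<ge> 2 * \<eta>} - measure (P t z) {x. infdist x (E j') \<ge> \<eta> / 2}"
      using t(3) j'(2) by linarith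
    also have "\<dots> = (\<integral>x. ?u x - ?v x \<partial>P t z)"
      unfolding Bochner_Integration.integral_diff[OF B_b_integrable[OF kernel_M_1[OF t(1)] uv(1)] B_b_integrable[OF kernel_M_1[OF t(1)] uv(2)]]
        expectation_indicator[OF kernel_M_1[OF t(1)]] ..
    also have "\<dots> \<le> kernel_op (P t) (shell_bump \<eta> (E j) (E j')) z"
      unfolding kernel_op_def
    proof (intro expectation_mono kernel_M_1 t(1) B_b_diff uv bB)
      fix x
      show "?u x - ?v x \<le> shell_bump \<eta> (E j) (E j') x"
        using shell_bump_range[of \<eta> "E j" "E j'" x] shell_bump_eq_1[OF \<eta>, of x "E j" "E j'"]
        by (auto simp: indicator_def)
    qed
    finally show ?thesis using t j' by blast
  qed
  (* The finite net number j misses mass b at some time t beyond N; a later net j' captures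
     half of that mass, which is what the bump between the two nets sees. *)
  define Q where "Q j N t j' \<longleftrightarrow> t \<in> T \<and> t \<ge> N \<and> j' > j \<and> b / 2 \<le> kernel_op (P t) (shell_bump \<eta> (E j) (E j')) z"
    for j j' :: nat and N t :: real
  have "\<forall>j N. \<exists>t j'. Q j N t j'" unfolding Q_def using step by blast
  then obtain \<tau> \<kappa> where "\<And>j N. Q j N (\<tau> j N) (\<kappa> j N)" by metis
  then have \<tau>\<kappa>: "\<And>j N. \<tau> j N \<in> T" "\<And>j N. \<tau> j N \<ge> N" "\<And>j N. \<kappa> j N > j"
    "\<And>j N. b / 2 \<le> kernel_op (P (\<tau> j N)) (shell_bump \<eta> (E j) (E (\<kappa> j N))) z"
    unfolding Q_def by auto
  define J where "J = rec_nat 0 (\<lambda>i j. \<kappa> j (real i))"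
  have J_Suc: "J (Suc i) = \<kappa> (J i) (real i)" for i unfolding J_def by simp
  have J: "strict_mono J" by (rule strict_mono_Suc_iff[THEN iffD2]) (simp add: J_Suc \<tau>\<kappa>)
  define \<phi> where "\<phi> i = shell_bump \<eta> (E (J i)) (E (J (Suc i)))" for i
  define \<theta> where "\<theta> i = \<tau> (J i) (real i)" for i
  have \<theta>: "\<theta> i \<in> T" "\<theta> i \<ge> real i" "b / 2 \<le> kernel_op (P (\<theta> i)) (\<phi> i) z" for i
    unfolding \<theta>_def \<phi>_def J_Suc by (rule \<tau>\<kappa>)+
  have \<theta>_lim: "filterlim \<theta> (at_top_in T) sequentially"
    by (rule filterlim_at_top_inI[OF \<theta>(1) filterlim_at_top_mono[OF filterlim_real_sequentially]]) (use \<theta>(2) in auto)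
  have lip: "(2/\<eta>)-lipschitz_on UNIV (\<phi> i)" for i unfolding \<phi>_def by (rule shell_bump_lipschitz[OF \<eta>])
  have nn: "0 \<le> \<phi> i x" and le: "\<phi> i x \<le> 1" for i x unfolding \<phi>_def by (rule shell_bump_range)+
  have lt: False if "i < k" "0 < \<phi> i x" "0 < \<phi> k x" for i k x
  proof -
    have "infdist x (E (J (Suc i))) < \<eta>" using shell_bump_pos(2)[OF \<eta>] that(2) unfolding \<phi>_def by blast
    moreover have "\<eta> < infdist x (E (J k))" using shell_bump_pos(1)[OF \<eta>] that(3) unfolding \<phi>_def by blast
    moreover have "infdist x (E (J k)) \<le> infdist x (E (J (Suc i)))"
      using that(1) J by (intro E_mono) (simp add: strict_mono_less_eq)
    ultimately show False by linarith
  qed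
  have disj: "0 < \<phi> i x \<and> 0 < \<phi> k x \<longrightarrow> i = k" for i k x
    using lt[of i k x] lt[of k i x] by (cases i k rule: linorder_cases) auto
  have \<phi>C: "\<phi> i \<in> C_b" for i
    by (rule C_bI[OF lipschitz_on_continuous_on[OF lip], of _ 1]) (simp add: nn le)
  note \<phi>B = C_b_B_b[OF \<phi>C]
  note bs = lipschitz_bump_sum[where \<phi> = \<phi>, OF lip nn le disj]
  have bsum: "(\<lambda>i. kernel_op (P t) (\<phi> i) x * indicator I i) sums kernel_op (P t) (\<lambda>x. \<Sum>i. \<phi> i x * indicator I i) x"
    if "t \<in> T" for t x I
    unfolding kernel_op_def by (rule bump_sum_expectation[where \<phi> = \<phi>, OF lip nn le disj kernel_M_1[OF that]])
  have op_nn: "0 \<le> kernel_op (P t) (\<phi> i) x" for t i x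
    unfolding kernel_op_def by (intro integral_nonneg_AE) (simp add: nn)
  (* Rows are indexed by times, columns by bumps; subsets of columns correspond to Lipschitz
     functions by disjointness. *)
  have diag: "(\<lambda>i. kernel_op (P (\<theta> i)) (\<phi> i) x - kernel_op (P (\<theta> i)) (\<phi> i) z) \<longlonglongrightarrow> 0" for x
  proof (rule schur_diagonal[of "\<lambda>i j. kernel_op (P (\<theta> i)) (\<phi> j) x - kernel_op (P (\<theta> i)) (\<phi> j) z"])
    fix i
    have "summable (\<lambda>j. kernel_op (P (\<theta> i)) (\<phi> j) y)" for y
      using sums_summable[OF bsum[OF \<theta>(1)[of i], where I = UNIV and x = y]] by simp
    then have "summable (\<lambda>j. kernel_op (P (\<theta> i)) (\<phi> j) x + kernel_op (P (\<theta> i)) (\<phi> j) z)" by (intro summable_add)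
    then show "summable (\<lambda>j. \<bar>kernel_op (P (\<theta> i)) (\<phi> j) x - kernel_op (P (\<theta> i)) (\<phi> j) z\<bar>)"
    proof (rule summable_comparison_test'[where N = 0])
      fix j
      show "norm \<bar>kernel_op (P (\<theta> i)) (\<phi> j) x - kernel_op (P (\<theta> i)) (\<phi> j) z\<bar>
          \<le> kernel_op (P (\<theta> i)) (\<phi> j) x + kernel_op (P (\<theta> i)) (\<phi> j) z"
        using op_nn[of "\<theta> i" j x] op_nn[of "\<theta> i" j z] by simp
    qed
  next
    fix I :: "nat set"
    define f where "f = (\<lambda>x. \<Sum>i. \<phi> i x * indicator I i)"
    have f: "f \<in> L_b" unfolding f_def by (rule bs(1))
    have "(\<Sum>j. (kernel_op (P (\<theta> i)) (\<phi> j) x - kernel_op (P (\<theta> i)) (\<phi> j) z) * indicator I j)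
        = kernel_op (P (\<theta> i)) f x - kernel_op (P (\<theta> i)) f z" for i
      using sums_unique[OF sums_diff[OF bsum[OF \<theta>(1)[of i], where I = I and x = x] bsum[OF \<theta>(1)[of i], where I = I and x = z]]]
      unfolding f_def by (simp add: left_diff_distrib)
    moreover have "((\<lambda>t. kernel_op (P t) f x - kernel_op (P t) f z) \<longlongrightarrow> 0) (at_top_in T)"
    proof (rule Lim_transform_eventually[OF forgetting[OF rec ec f return_M_1[of x] return_M_1[of z]]])
      show "\<forall>\<^sub>F t in at_top_in T. (\<integral>y. kernel_op (P t) f y \<partial>return borel x) - (\<integral>y. kernel_op (P t) f y \<partial>return borel z)
          = kernel_op (P t) f x - kernel_op (P t) f z"
        using eventually_in_T
      proof eventually_elim
        case (elim t)
        have "kernel_op (P t) f \<in> B_b" by (intro op_B_b elim C_b_B_b L_b_C_b f)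
        then show ?case by (simp add: expectation_return)
      qed
    qed
    from filterlim_compose[OF this \<theta>_lim]
    have "(\<lambda>i. kernel_op (P (\<theta> i)) f x - kernel_op (P (\<theta> i)) f z) \<longlonglongrightarrow> 0" .
    ultimately show "(\<lambda>i. \<Sum>j. (kernel_op (P (\<theta> i)) (\<phi> j) x - kernel_op (P (\<theta> i)) (\<phi> j) z) * indicator I j) \<longlonglongrightarrow> 0"
      by simp
  qed
  (* The Feller property makes these sets closed, and by the diagonal limit they exhaust the
     space. *)
  define A where "A m = (\<Inter>i\<in>{m..}. {x. b / 4 \<le> kernel_op (P (\<theta> i)) (\<phi> i) x})" for m
  have clA: "closed (A m)" for m unfolding A_def
    by (intro closed_INT ballI closed_Collect_le C_b_cont op_C_b \<theta> \<phi>C continuous_intros)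
  have covA: "x \<in> (\<Union>m. A m)" for x
  proof -
    have "\<forall>\<^sub>F i in sequentially. dist (kernel_op (P (\<theta> i)) (\<phi> i) x - kernel_op (P (\<theta> i)) (\<phi> i) z) 0 < b / 4"
      by (rule tendstoD[OF diag]) (use b in simp)
    then obtain m where m: "\<And>i. i \<ge> m \<Longrightarrow> \<bar>kernel_op (P (\<theta> i)) (\<phi> i) x - kernel_op (P (\<theta> i)) (\<phi> i) z\<bar> < b / 4"
      by (auto simp: eventually_sequentially)
    have "b / 4 \<le> kernel_op (P (\<theta> i)) (\<phi> i) x" if "i \<ge> m" for i
      using m[OF that] \<theta>(3)[of i] by linarith
    then show ?thesis unfolding A_def by auto
  qed
  have "\<exists>S. closed S \<and> S \<noteq> {} \<and> (\<forall>s\<in>T. measure (P s z) (- S) = 0) \<and>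
      (\<forall>V. open V \<longrightarrow> V \<inter> S \<noteq> {} \<longrightarrow> (\<exists>s\<in>T. measure (P s z) V > 0))"
    by (rule charged_support[of z]) blast
  then obtain S where S: "closed S" "S \<noteq> {}" "\<And>s. s \<in> T \<Longrightarrow> measure (P s z) (- S) = 0"
    "\<And>V. open V \<Longrightarrow> V \<inter> S \<noteq> {} \<Longrightarrow> \<exists>s\<in>T. measure (P s z) V > 0"
    by auto
  have "S \<subseteq> (\<Union>m. A m)" using covA by blast
  then have "\<exists>m V. open V \<and> V \<inter> S \<noteq> {} \<and> V \<inter> S \<subseteq> A m"
    by (rule baire_closed_cover[OF S(1,2) clA]) blast
  then obtain m V where V: "open V" "V \<inter> S \<noteq> {}" "V \<inter> S \<subseteq> A m" by blast
  obtain s where s: "s \<in> T" "measure (P s z) V > 0" using S(4)[OF V(1,2)] by blast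
  obtain \<alpha> where \<alpha>: "\<alpha> > 0" "\<forall>\<^sub>F t in at_top_in T. \<alpha> \<le> measure (P t z) V"
    by (rule charged_open_recurrent[OF rec V(1) s])
  (* Wait until the time t - \<theta> i, at which V is charged, then run for \<theta> i time units. *)
  have big: "\<forall>\<^sub>F t in at_top_in T. b / 4 * \<alpha> \<le> kernel_op (P t) (\<phi> i) z" if i: "i \<ge> m" for i
    using eventually_shift[OF \<theta>(1)[of i] \<alpha>(2)]
  proof eventually_elim
    case (elim t)
    then have t: "t - \<theta> i \<in> T" "\<alpha> \<le> measure (P (t - \<theta> i) z) V" by auto
    interpret prob_space "P (t - \<theta> i) z" by (rule M_1D[OF kernel_M_1[OF t(1)]])
    have sets: "V \<in> events" "- S \<in> events" "V \<inter> S \<in> events"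
      using V(1) S(1) M_1D(2)[OF kernel_M_1[OF t(1)], of z] by auto
    have "measure (P (t - \<theta> i) z) V \<le> measure (P (t - \<theta> i) z) ((V \<inter> S) \<union> - S)"
      using sets by (intro finite_measure_mono) auto
    also have "\<dots> \<le> measure (P (t - \<theta> i) z) (V \<inter> S) + measure (P (t - \<theta> i) z) (- S)"
      using sets by (intro measure_Un_le)
    finally have "\<alpha> \<le> measure (P (t - \<theta> i) z) (V \<inter> S)" using S(3)[OF t(1)] t(2) by simp
    then have "b / 4 * \<alpha> \<le> b / 4 * measure (P (t - \<theta> i) z) (V \<inter> S)" using b by simp
    also have "\<dots> = (\<integral>x. b / 4 * indicator (V \<inter> S) x \<partial>P (t - \<theta> i) z)"
      unfolding integral_mult_right_zero expectation_indicator[OF kernel_M_1[OF t(1)]] ..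
    also have "\<dots> \<le> kernel_op (P (t - \<theta> i)) (kernel_op (P (\<theta> i)) (\<phi> i)) z"
      unfolding kernel_op_def[of "P (t - \<theta> i)"]
    proof (intro expectation_mono kernel_M_1 t(1) B_b_times B_b_const B_b_indicator op_B_b \<theta>(1) \<phi>B)
      show "V \<inter> S \<in> sets borel" using V(1) S(1) by auto
      fix x
      show "b / 4 * indicator (V \<inter> S) x \<le> kernel_op (P (\<theta> i)) (\<phi> i) x"
        using V(3) i op_nn[of "\<theta> i" i x] unfolding A_def by (auto simp: indicator_def)
    qed
    also have "\<dots> = kernel_op (P t) (\<phi> i) z" unfolding op_split(1)[OF \<theta>(1) t(1) \<phi>B] ..
    finally show ?case .
  qed
  have "b / 4 * \<alpha> > 0" using b \<alpha> by simp
  then obtain k where k: "real k * (b / 4 * \<alpha>) > 1" using reals_Archimedean3 by blast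
  have "\<forall>\<^sub>F t in at_top_in T. \<forall>i\<in>{m..<m + k}. b / 4 * \<alpha> \<le> kernel_op (P t) (\<phi> i) z"
    by (rule eventually_ball_finite) (use big in auto)
  then have "\<forall>\<^sub>F t in at_top_in T. t \<in> T \<and> (\<forall>i\<in>{m..<m + k}. b / 4 * \<alpha> \<le> kernel_op (P t) (\<phi> i) z)"
    using eventually_in_T by eventually_elim auto
  then obtain t where t: "t \<in> T" "\<And>i. i \<in> {m..<m + k} \<Longrightarrow> b / 4 * \<alpha> \<le> kernel_op (P t) (\<phi> i) z"
    using at_top_in_nonbot by (metis (mono_tags, lifting) eventually_happens')
  have "real k * (b / 4 * \<alpha>) = (\<Sum>i\<in>{m..<m + k}. b / 4 * \<alpha>)" by simp
  also have "\<dots> \<le> (\<Sum>i\<in>{m..<m + k}. kernel_op (P t) (\<phi> i) z)" by (intro sum_mono t)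
  also have "\<dots> \<le> (\<Sum>i. kernel_op (P t) (\<phi> i) z)"
    using sums_summable[OF bsum[OF t(1), where I = UNIV and x = z]] by (intro sum_le_suminf) (auto simp: op_nn)
  also have "\<dots> = kernel_op (P t) (\<lambda>x. \<Sum>i. \<phi> i x) z"
    using sums_unique[OF bsum[OF t(1), where I = UNIV and x = z]] by simp
  also have "\<dots> \<le> 1"
  proof -
    have "(\<lambda>x. \<Sum>i. \<phi> i x) \<in> B_b" using bs(1)[where J = UNIV] by (intro C_b_B_b L_b_C_b) simp
    moreover have "\<bar>\<Sum>i. \<phi> i x\<bar> \<le> 1" for x using bs(3)[where x = x] suminf_nonneg[OF bs(2)[where x = x] nn] by simp
    ultimately show ?thesis using op_bound[OF t(1), of "\<lambda>x. \<Sum>i. \<phi> i x" 1 z] by simp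
  qed
  finally show False using k by simp
qed

end

section \<open>The invariant measure\<close>

text \<open>
  The tail of the sequence from \<open>m\<close> on stays close to the finite set \<open>F m\<close>, and only finitely many
  terms precede it, so the range is totally bounded.
\<close>

lemma shrinking_net_convergent:
  fixes X :: "nat \<Rightarrow> 'a::complete_space"
  assumes F: "\<And>m::nat. finite (F m)" "\<And>m. F m \<noteq> {}"
    and near: "\<And>m n. m \<le> n \<Longrightarrow> infdist (X n) (F m) < 1 / real (Suc m)"
  obtains l and r :: "nat \<Rightarrow> nat" where "strict_mono r" "(X \<circ> r) \<longlonglongrightarrow> l"
proof -
  have "\<exists>k. finite k \<and> closure (range X) \<subseteq> (\<Union>x\<in>k. ball x e)" if e: "e > 0" for e
  proof -
    obtain m where m: "1 / real (Suc m) < e / 2" using e nat_approx_posE[of "e / 2"] by auto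
    define k where "k = F m \<union> X ` {..<m}"
    have "range X \<subseteq> (\<Union>x\<in>k. cball x (e / 2))"
    proof safe
      fix n
      show "X n \<in> (\<Union>x\<in>k. cball x (e / 2))"
      proof (cases "n < m")
        case True then show ?thesis using e unfolding k_def by (intro UN_I[of "X n"]) auto
      next
        case False
        then have "infdist (X n) (F m) < 1 / real (Suc m)" by (intro near) simp
        then have "Inf (dist (X n) ` F m) < 1 / real (Suc m)" unfolding infdist_notempty[OF F(2)] .
        from cInf_lessD[OF _ this] F(2)[of m] obtain d where "d \<in> dist (X n) ` F m" "d < 1 / real (Suc m)"
          by auto
        then obtain y where "y \<in> F m" "dist (X n) y < 1 / real (Suc m)" by auto
        then show ?thesis using m unfolding k_def by (intro UN_I[of y]) (auto simp: dist_commute)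
      qed
    qed
    moreover have "finite k" unfolding k_def using F(1) by simp
    ultimately have "closure (range X) \<subseteq> (\<Union>x\<in>k. cball x (e / 2))"
      by (intro closure_minimal closed_UN) auto
    also have "\<dots> \<subseteq> (\<Union>x\<in>k. ball x e)" using e by (auto simp: dist_commute)
    finally show ?thesis using \<open>finite k\<close> by blast
  qed
  then have "compact (closure (range X))"
    unfolding compact_eq_totally_bounded by (simp add: complete_eq_closed)
  moreover have "\<forall>n. X n \<in> closure (range X)" by (auto intro: closure_subset[THEN subsetD])
  ultimately have "\<exists>l\<in>closure (range X). \<exists>r. strict_mono (r :: nat \<Rightarrow> nat) \<and> (X \<circ> r) \<longlonglongrightarrow> l"
    unfolding compact_def by simp
  then obtain l and r :: "nat \<Rightarrow> nat" where "strict_mono r" "(X \<circ> r) \<longlonglongrightarrow> l" by auto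
  then show ?thesis by (rule that)
qed

context markov_feller
begin

text \<open>
  A Dini argument on the almost compact set left by tightness.  Outside exceptional sets \<open>H m\<close> of
  summable asymptotic mass, points are close to finite nets of all scales.  If \<open>f n\<close> were not small
  off the first \<open>n\<close> exceptional sets for any \<open>n\<close>, the offending points would accumulate at a point
  where the limit of \<open>f\<close> is not zero.  Only finitely many exceptional sets are used at a time,
  because the time after which tightness takes effect depends on the scale.
\<close>

theorem asymptotically_smooth:
  fixes f :: "nat \<Rightarrow> 'a \<Rightarrow> real"
  assumes rec: "recurrent_at z" and ec: "eventually_continuous_at z"
    and f: "\<And>n. f n \<in> C_b" "\<And>x. decseq (\<lambda>n. f n x)" "\<And>x. (\<lambda>n. f n x) \<longlonglongrightarrow> 0" and e: "e > 0"
  shows "\<exists>n. \<forall>\<^sub>F t in at_top_in T. kernel_op (P t) (f n) z \<le> e"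
proof -
  obtain D :: "'a set" where D: "countable D" "\<And>U. open U \<Longrightarrow> U \<noteq> {} \<Longrightarrow> \<exists>d\<in>D. d \<in> U"
    using countable_dense_exists[where 'a = 'a] by metis
  have "D \<noteq> {}" using D(2)[of UNIV] by auto
  define q where "q = from_nat_into D"
  have q: "\<exists>i. q i \<in> U" if "open U" "U \<noteq> {}" for U
    using D(2)[OF that] from_nat_into_surj[OF D(1)] unfolding q_def by metis
  obtain C where C: "C > 0" "\<And>x. \<bar>f 0 x\<bar> \<le> C" using C_b_bound[OF f(1)] by blast
  have f0: "0 \<le> f n x" for n x using decseq_ge[OF f(2,3)] .
  have fC: "f n x \<le> C" for n x using decseqD[OF f(2), of 0 n x] C(2)[of x] by auto
  (* The weights add up to at most e / 2 after multiplication by the bound C. *)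
  define b where "b m = e / 2 / C * (1/2) ^ Suc m" for m :: nat
  have b: "b m > 0" for m using e C unfolding b_def by simp
  have "\<exists>j. \<forall>\<^sub>F t in at_top_in T. measure (P t z) {x. infdist x (q ` {..j}) \<ge> 1 / real (Suc m)} < b m" for m
  proof -
    define \<eta> where "\<eta> = 1 / real (Suc m) / 2"
    have \<eta>: "\<eta> > 0" "1 / real (Suc m) = 2 * \<eta>" unfolding \<eta>_def by (simp_all del: of_nat_Suc)
    show ?thesis unfolding \<eta>(2)
      by (rule asymptotically_tight[OF rec ec]) (use q b \<eta>(1) in auto)
  qed
  then obtain J where J: "\<And>m. \<forall>\<^sub>F t in at_top_in T.
      measure (P t z) {x. infdist x (q ` {..J m}) \<ge> 1 / real (Suc m)} < b m" by metis
  define F where "F m = q ` {..J m}" for m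
  define H where "H m = {x. infdist x (F m) \<ge> 1 / real (Suc m)}" for m
  have clH: "closed (H m)" for m unfolding H_def by (intro closed_Collect_le continuous_intros)
  have "\<exists>n. \<forall>x. x \<notin> (\<Union>m\<le>n. H m) \<longrightarrow> f n x < e / 2"
  proof (rule ccontr)
    assume "\<not> ?thesis"
    then have "\<forall>n. \<exists>x. x \<notin> (\<Union>m\<le>n. H m) \<and> e / 2 \<le> f n x" by (simp add: not_less)
    then obtain X where X: "\<And>n. X n \<notin> (\<Union>m\<le>n. H m)" "\<And>n. e / 2 \<le> f n (X n)" by metis
    have near: "infdist (X n) (F m) < 1 / real (Suc m)" if "m \<le> n" for m n
      using X(1)[of n] that unfolding H_def by (auto simp: not_le)
    have "\<exists>l r. strict_mono (r :: nat \<Rightarrow> nat) \<and> (X \<circ> r) \<longlonglongrightarrow> l"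
      by (rule shrinking_net_convergent[of F X]) (use near in \<open>auto simp: F_def\<close>)
    then obtain l and r :: "nat \<Rightarrow> nat" where r: "strict_mono r" "(X \<circ> r) \<longlonglongrightarrow> l" by blast
    have "e / 2 \<le> f j l" for j
    proof -
      have "isCont (f j) l" using C_b_cont[OF f(1), of UNIV] by (simp add: continuous_on_eq_continuous_at)
      from isCont_tendsto_compose[OF this r(2)] have lim: "(\<lambda>n. f j ((X \<circ> r) n)) \<longlonglongrightarrow> f j l" .
      have "e / 2 \<le> f j ((X \<circ> r) n)" if "n \<ge> j" for n
      proof -
        have "j \<le> r n" using seq_suble[OF r(1), of n] that by simp
        then have "f (r n) (X (r n)) \<le> f j (X (r n))" by (rule decseqD[OF f(2)])
        then show ?thesis using X(2)[of "r n"] by simp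
      qed
      then show ?thesis by (intro LIMSEQ_le_const[OF lim]) blast
    qed
    then have "e / 2 \<le> 0" by (intro LIMSEQ_le_const[OF f(3)]) auto
    then show False using e by simp
  qed
  then obtain n where n: "\<And>x. x \<notin> (\<Union>m\<le>n. H m) \<Longrightarrow> f n x < e / 2" by blast
  have "\<forall>\<^sub>F t in at_top_in T. \<forall>m\<in>{..n}. measure (P t z) (H m) < b m"
    by (rule eventually_ball_finite) (use J in \<open>auto simp: H_def F_def\<close>)
  with eventually_in_T have "\<forall>\<^sub>F t in at_top_in T. kernel_op (P t) (f n) z \<le> e"
  proof eventually_elim
    case (elim t)
    define G where "G x = e / 2 + (\<Sum>m\<le>n. C * indicator (H m) x)" for x
    have iB: "(\<lambda>x. C * indicator (H m) x) \<in> B_b" for m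
      by (intro B_b_times B_b_const B_b_indicator borel_closed clH)
    have int: "integrable (P t z) (\<lambda>x. C * indicator (H m) x)" for m
      by (intro B_b_integrable kernel_M_1 elim iB)
    have int': "integrable (P t z) (\<lambda>_. e / 2)" by (intro B_b_integrable kernel_M_1 elim B_b_const)
    have "kernel_op (P t) (f n) z \<le> (\<integral>x. G x \<partial>P t z)"
      unfolding kernel_op_def
    proof (rule integral_mono)
      show "integrable (P t z) (f n)" by (intro B_b_integrable kernel_M_1 elim C_b_B_b f)
      show "integrable (P t z) G" unfolding G_def
        by (intro Bochner_Integration.integrable_add Bochner_Integration.integrable_sum int int')
      show "f n x \<le> G x" for x
      proof (cases "x \<in> (\<Union>m\<le>n. H m)")
        case True
        then obtain m where m: "m \<le> n" "x \<in> H m" by auto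
        have "C * indicator (H m) x \<le> (\<Sum>m\<le>n. C * indicator (H m) x)"
          by (rule member_le_sum) (use m C in auto)
        then show ?thesis using fC[of n x] m(2) e unfolding G_def by simp
      next
        case False
        have "0 \<le> (\<Sum>m\<le>n. C * indicator (H m) x)" using C by (intro sum_nonneg) auto
        then show ?thesis using n[OF False] unfolding G_def by linarith
      qed
    qed
    also have "\<dots> = e / 2 + (\<Sum>m\<le>n. C * measure (P t z) (H m))"
      unfolding G_def Bochner_Integration.integral_add[OF int' Bochner_Integration.integrable_sum[OF int]]
        Bochner_Integration.integral_sum[OF int] integral_mult_right_zero
        expectation_indicator[OF kernel_M_1[OF elim(1)]] expectation_const[OF kernel_M_1[OF elim(1)]] ..
    also have "\<dots> \<le> e / 2 + (\<Sum>m\<le>n. C * b m)"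
      using elim C by (intro add_left_mono sum_mono mult_left_mono) (auto simp: less_imp_le)
    also have "(\<Sum>m\<le>n. C * b m) = e / 2 * (\<Sum>m\<le>n. (1/2) ^ Suc m)"
      using C unfolding b_def sum_distrib_left by (intro sum.cong) auto
    also have "(\<Sum>m\<le>n. (1/2) ^ Suc m) \<le> (1::real)"
    proof -
      have "(\<Sum>m\<le>n. (1/2::real) ^ Suc m) \<le> (\<Sum>m. (1/2) ^ Suc m)"
        using sums_summable[OF power_half_series] by (intro sum_le_suminf) auto
      then show ?thesis using sums_unique[OF power_half_series] by simp
    qed
    finally show ?case using e by (simp add: mult_left_le)
  qed
  then show ?thesis ..
qed

text \<open>
  Along a suitable subfilter the laws \<open>P t z\<close> converge on all bounded continuous functions, and the
  limit functional is smooth, hence a measure.  It is invariant because starting from \<open>P s z\<close> instead of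
  \<open>z\<close> amounts to evolving \<open>kernel_op (P s) f\<close> from \<open>z\<close>, and by \<open>forgetting\<close> the change of
  starting law is invisible in the limit.
\<close>

theorem invariant_measure_exists:
  assumes rec: "recurrent_at z" and ec: "eventually_continuous_at z"
  shows "\<exists>\<mu>. invariant_measure T P \<mu>"
proof -
  define g where "g t f = (if t \<in> T \<and> f \<in> C_b then kernel_op (P t) f z else 0)" for t and f :: "'a \<Rightarrow> real"
  have "\<forall>f. \<exists>C. \<forall>t. \<bar>g t f\<bar> \<le> C"
  proof
    fix f :: "'a \<Rightarrow> real"
    show "\<exists>C. \<forall>t. \<bar>g t f\<bar> \<le> C"
    proof (cases "f \<in> C_b")
      case True
      then obtain C where C: "C > 0" "\<And>x. \<bar>f x\<bar> \<le> C" using C_b_bound by blast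
      have "\<bar>g t f\<bar> \<le> C" for t
        using op_bound[OF _ C_b_B_b[OF True] C(2), of t z] C(1) unfolding g_def by auto
      then show ?thesis by blast
    qed (auto simp: g_def)
  qed
  then obtain C where C: "\<And>t f. \<bar>g t f\<bar> \<le> C f" by metis
  have "\<exists>G\<le>at_top_in T. G \<noteq> bot \<and> (\<forall>f. \<exists>l. ((\<lambda>t. g t f) \<longlongrightarrow> l) G)"
    by (rule convergent_subfilter[where g = g, OF at_top_in_nonbot C]) blast
  then obtain G \<Lambda> where G: "G \<le> at_top_in T" "G \<noteq> bot" and \<Lambda>0: "\<And>f. ((\<lambda>t. g t f) \<longlongrightarrow> \<Lambda> f) G"
    by metis
  have GT: "\<forall>\<^sub>F t in G. t \<in> T" using G(1) eventually_in_T by (rule filter_leD)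
  have \<Lambda>: "((\<lambda>t. kernel_op (P t) f z) \<longlongrightarrow> \<Lambda> f) G" if "f \<in> C_b" for f
  proof (rule Lim_transform_eventually[OF \<Lambda>0[of f]])
    show "\<forall>\<^sub>F t in G. g t f = kernel_op (P t) f z" using GT by eventually_elim (simp add: g_def that)
  qed
  have uniq: "\<Lambda> f = l" if "f \<in> C_b" "((\<lambda>t. kernel_op (P t) f z) \<longlongrightarrow> l) G" for f l
    using tendsto_unique[OF G(2) \<Lambda>[OF that(1)] that(2)] .
  interpret daniell_functional \<Lambda>
  proof
    fix f h :: "'a \<Rightarrow> real" assume fh: "f \<in> C_b" "h \<in> C_b"
    show "\<Lambda> (\<lambda>x. f x + h x) = \<Lambda> f + \<Lambda> h"
    proof (rule uniq[OF C_b_add[OF fh]], rule Lim_transform_eventually[OF tendsto_add[OF \<Lambda>[OF fh(1)] \<Lambda>[OF fh(2)]]])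
      show "\<forall>\<^sub>F t in G. kernel_op (P t) f z + kernel_op (P t) h z = kernel_op (P t) (\<lambda>x. f x + h x) z"
        using GT by eventually_elim
          (simp add: kernel_op_def B_b_integrable[OF kernel_M_1] C_b_B_b fh)
    qed
  next
    fix f :: "'a \<Rightarrow> real" and c assume f: "f \<in> C_b"
    show "\<Lambda> (\<lambda>x. c * f x) = c * \<Lambda> f"
      by (rule uniq[OF C_b_cmult[OF f]]) (use tendsto_mult_left[OF \<Lambda>[OF f], of c] in \<open>simp add: kernel_op_def\<close>)
  next
    fix f h :: "'a \<Rightarrow> real" assume fh: "f \<in> C_b" "h \<in> C_b" "\<And>x. f x \<le> h x"
    show "\<Lambda> f \<le> \<Lambda> h"
    proof (rule tendsto_le[OF G(2) \<Lambda>[OF fh(2)] \<Lambda>[OF fh(1)]])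
      show "\<forall>\<^sub>F t in G. kernel_op (P t) f z \<le> kernel_op (P t) h z"
        using GT by eventually_elim (intro op_mono C_b_B_b fh)
    qed
  next
    show "\<Lambda> (\<lambda>_. 1) = 1"
    proof (rule uniq[OF C_b_const], rule tendsto_eventually)
      show "\<forall>\<^sub>F t in G. kernel_op (P t) (\<lambda>_. 1) z = 1"
        using GT by eventually_elim (unfold kernel_op_def, rule expectation_const[OF kernel_M_1])
    qed
  next
    fix F :: "nat \<Rightarrow> 'a \<Rightarrow> real"
    assume F: "\<And>n. F n \<in> C_b" "\<And>x. decseq (\<lambda>n. F n x)" "\<And>x. (\<lambda>n. F n x) \<longlonglongrightarrow> 0"
    have F0: "0 \<le> F n x" for n x using decseq_ge[OF F(2,3)] .
    have nonneg: "0 \<le> \<Lambda> (F n)" for n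
    proof (rule tendsto_lowerbound[OF \<Lambda>[OF F(1)] _ G(2)])
      show "\<forall>\<^sub>F t in G. 0 \<le> kernel_op (P t) (F n) z"
        by (intro always_eventually allI) (simp add: kernel_op_def integral_nonneg_AE F0)
    qed
    show "(\<lambda>n. \<Lambda> (F n)) \<longlonglongrightarrow> 0"
    proof (rule LIMSEQ_I)
      fix e :: real assume e: "e > 0"
      obtain n where n: "\<forall>\<^sub>F t in at_top_in T. kernel_op (P t) (F n) z \<le> e / 2"
        using asymptotically_smooth[OF rec ec F, of "e / 2"] e by auto
      have "\<Lambda> (F k) \<le> e / 2" if "k \<ge> n" for k
      proof (rule tendsto_upperbound[OF \<Lambda>[OF F(1)] _ G(2)])
        show "\<forall>\<^sub>F t in G. kernel_op (P t) (F k) z \<le> e / 2"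
          using GT filter_leD[OF G(1) n]
        proof eventually_elim
          case (elim t)
          have "kernel_op (P t) (F k) z \<le> kernel_op (P t) (F n) z"
            using decseqD[OF F(2) that] by (intro op_mono elim C_b_B_b F)
          then show ?case using elim by simp
        qed
      qed
      then have "\<forall>k\<ge>n. norm (\<Lambda> (F k) - 0) < e" using nonneg e by force
      then show "\<exists>n. \<forall>k\<ge>n. norm (\<Lambda> (F k) - 0) < e" ..
    qed
  qed
  obtain \<mu> where \<mu>: "\<mu> \<in> M_1" "\<And>f. f \<in> C_b \<Longrightarrow> (\<integral>x. f x \<partial>\<mu>) = \<Lambda> f"
    using representation by blast
  have "dual_op (P s) \<mu> = \<mu>" if s: "s \<in> T" for s
  proof (rule M_1_eqI[OF dual_M_1[OF s \<mu>(1)] \<mu>(1)])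
    fix f :: "'a \<Rightarrow> real" assume f: "f \<in> L_b"
    have fC: "f \<in> C_b" by (rule L_b_C_b[OF f])
    have fB: "f \<in> B_b" by (rule C_b_B_b[OF fC])
    (* Compare the starting laws P s z and the point mass at z. *)
    have "\<Lambda> (kernel_op (P s) f) = \<Lambda> f"
    proof (rule uniq[OF op_C_b[OF s fC]])
      have "((\<lambda>t. (\<integral>x. kernel_op (P t) f x \<partial>P s z) - (\<integral>x. kernel_op (P t) f x \<partial>return borel z)) \<longlongrightarrow> 0) G"
        by (rule tendsto_mono[OF G(1) forgetting[OF rec ec f kernel_M_1[OF s] return_M_1]])
      from tendsto_add[OF this \<Lambda>[OF fC]]
      have lim: "((\<lambda>t. (\<integral>x. kernel_op (P t) f x \<partial>P s z) - (\<integral>x. kernel_op (P t) f x \<partial>return borel z)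
          + kernel_op (P t) f z) \<longlongrightarrow> \<Lambda> f) G" by simp
      show "((\<lambda>t. kernel_op (P t) (kernel_op (P s) f) z) \<longlongrightarrow> \<Lambda> f) G"
      proof (rule Lim_transform_eventually[OF lim])
        show "\<forall>\<^sub>F t in G. (\<integral>x. kernel_op (P t) f x \<partial>P s z) - (\<integral>x. kernel_op (P t) f x \<partial>return borel z)
            + kernel_op (P t) f z = kernel_op (P t) (kernel_op (P s) f) z"
          using GT
        proof eventually_elim
          case (elim t)
          have "(\<integral>x. kernel_op (P t) f x \<partial>P s z) = kernel_op (P s) (kernel_op (P t) f) z"
            by (simp add: kernel_op_def)
          also have "\<dots> = kernel_op (P t) (kernel_op (P s) f) z"
            using op_add[OF elim s fB] op_add[OF s elim fB] by (simp add: add.commute)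
          finally show ?case by (simp add: expectation_return op_B_b elim fB)
        qed
      qed
    qed
    then show "(\<integral>x. f x \<partial>dual_op (P s) \<mu>) = (\<integral>x. f x \<partial>\<mu>)"
      using expectation_dual[OF s \<mu>(1) fB] \<mu>(2)[OF op_C_b[OF s fC]] \<mu>(2)[OF fC] by simp
  qed
  then show ?thesis using \<mu>(1) unfolding invariant_measure_def by blast
qed

section \<open>Asymptotic stability\<close>

theorem asymptotically_stableI:
  assumes rec: "recurrent_at z" and ec: "eventually_continuous_at z"
  shows "asymptotically_stable T P"
proof -
  obtain \<mu> where \<mu>: "invariant_measure T P \<mu>" using invariant_measure_exists[OF rec ec] by blast
  have M: "\<mu>' \<in> M_1" if "invariant_measure T P \<mu>'" for \<mu>' using that unfolding invariant_measure_def by blast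
  have inv: "(\<integral>x. kernel_op (P t) f x \<partial>\<mu>') = (\<integral>x. f x \<partial>\<mu>')"
    if "invariant_measure T P \<mu>'" "t \<in> T" "f \<in> L_b" for \<mu>' t f
    using expectation_dual[OF that(2) M[OF that(1)] C_b_B_b[OF L_b_C_b[OF that(3)]]] that
    unfolding invariant_measure_def by simp
  have conv: "((\<lambda>t. \<integral>x. kernel_op (P t) f x \<partial>\<nu>) \<longlongrightarrow> (\<integral>x. f x \<partial>\<mu>)) (at_top_in T)" if "\<nu> \<in> M_1" "f \<in> L_b" for \<nu> f
  proof -
    from tendsto_add[OF forgetting[OF rec ec that(2,1) M[OF \<mu>]] tendsto_const[of "\<integral>x. f x \<partial>\<mu>"]]
    have "((\<lambda>t. (\<integral>x. kernel_op (P t) f x \<partial>\<nu>) - (\<integral>x. kernel_op (P t) f x \<partial>\<mu>) + (\<integral>x. f x \<partial>\<mu>))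
        \<longlongrightarrow> (\<integral>x. f x \<partial>\<mu>)) (at_top_in T)" by simp
    then show ?thesis
    proof (rule Lim_transform_eventually)
      show "\<forall>\<^sub>F t in at_top_in T. (\<integral>x. kernel_op (P t) f x \<partial>\<nu>) - (\<integral>x. kernel_op (P t) f x \<partial>\<mu>) + (\<integral>x. f x \<partial>\<mu>)
          = (\<integral>x. kernel_op (P t) f x \<partial>\<nu>)"
        using eventually_in_T by eventually_elim (simp add: inv[OF \<mu> _ that(2)])
    qed
  qed
  have "\<mu>' = \<mu>" if \<mu>': "invariant_measure T P \<mu>'" for \<mu>'
  proof (rule M_1_eqI[OF M[OF \<mu>'] M[OF \<mu>]])
    fix f :: "'a \<Rightarrow> real" assume f: "f \<in> L_b"
    have "((\<lambda>t. \<integral>x. kernel_op (P t) f x \<partial>\<mu>') \<longlongrightarrow> (\<integral>x. f x \<partial>\<mu>')) (at_top_in T)"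
    proof (rule tendsto_eventually)
      show "\<forall>\<^sub>F t in at_top_in T. (\<integral>x. kernel_op (P t) f x \<partial>\<mu>') = (\<integral>x. f x \<partial>\<mu>')"
        using eventually_in_T by eventually_elim (rule inv[OF \<mu>' _ f])
    qed
    then show "(\<integral>x. f x \<partial>\<mu>') = (\<integral>x. f x \<partial>\<mu>)"
      using tendsto_unique[OF at_top_in_nonbot _ conv[OF M[OF \<mu>'] f]] by blast
  qed
  moreover have "converges_weakly (\<lambda>t. dual_op (P t) \<nu>) \<mu> (at_top_in T)" if \<nu>: "\<nu> \<in> M_1" for \<nu>
  proof (rule converges_weakly_lipschitzI)
    show "\<forall>\<^sub>F t in at_top_in T. dual_op (P t) \<nu> \<in> M_1"
      using eventually_in_T by eventually_elim (rule dual_M_1[OF _ \<nu>])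
    show "\<mu> \<in> M_1" by (rule M[OF \<mu>])
    fix f :: "'a \<Rightarrow> real" assume f: "f \<in> L_b"
    show "((\<lambda>t. \<integral>x. f x \<partial>dual_op (P t) \<nu>) \<longlongrightarrow> (\<integral>x. f x \<partial>\<mu>)) (at_top_in T)"
    proof (rule Lim_transform_eventually[OF conv[OF \<nu> f]])
      show "\<forall>\<^sub>F t in at_top_in T. (\<integral>x. kernel_op (P t) f x \<partial>\<nu>) = (\<integral>x. f x \<partial>dual_op (P t) \<nu>)"
        using eventually_in_T
        by eventually_elim (rule expectation_dual[OF _ \<nu> C_b_B_b[OF L_b_C_b[OF f]], symmetric])
    qed
  qed
  ultimately show ?thesis using \<mu> unfolding asymptotically_stable_def by blast
qed

lemma stable_tendsto:
  assumes \<mu>: "\<forall>\<nu>\<in>M_1. converges_weakly (\<lambda>t. dual_op (P t) \<nu>) \<mu> (at_top_in T)" and f: "f \<in> C_b"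
  shows "((\<lambda>t. kernel_op (P t) f x) \<longlongrightarrow> (\<integral>x. f x \<partial>\<mu>)) (at_top_in T)"
proof (rule Lim_transform_eventually)
  show "((\<lambda>t. \<integral>y. f y \<partial>dual_op (P t) (return borel x)) \<longlongrightarrow> (\<integral>x. f x \<partial>\<mu>)) (at_top_in T)"
    using \<mu> return_M_1[of x] f unfolding converges_weakly_def by blast
  show "\<forall>\<^sub>F t in at_top_in T. (\<integral>y. f y \<partial>dual_op (P t) (return borel x)) = kernel_op (P t) f x"
    using eventually_in_T
    by eventually_elim (simp add: expectation_dual return_M_1 C_b_B_b[OF f] expectation_return op_B_b)
qed

lemma stable_imp_eventually_continuous:
  assumes "asymptotically_stable T P" shows "eventually_continuous T P"
  unfolding eventually_continuous_def
proof (intro allI ballI)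
  obtain \<mu> where \<mu>: "\<forall>\<nu>\<in>M_1. converges_weakly (\<lambda>t. dual_op (P t) \<nu>) \<mu> (at_top_in T)"
    using assms unfolding asymptotically_stable_def by blast
  fix z and f :: "'a \<Rightarrow> real" assume f: "f \<in> L_b"
  have "Limsup (at_top_in T) (\<lambda>t. ereal \<bar>kernel_op (P t) f x - kernel_op (P t) f z\<bar>) = 0" for x
  proof (rule lim_imp_Limsup[OF at_top_in_nonbot])
    have "((\<lambda>t. \<bar>kernel_op (P t) f x - kernel_op (P t) f z\<bar>) \<longlongrightarrow> \<bar>(\<integral>x. f x \<partial>\<mu>) - (\<integral>x. f x \<partial>\<mu>)\<bar>) (at_top_in T)"
      by (intro tendsto_intros stable_tendsto[OF \<mu>] L_b_C_b f)
    then show "((\<lambda>t. ereal \<bar>kernel_op (P t) f x - kernel_op (P t) f z\<bar>) \<longlongrightarrow> 0) (at_top_in T)"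
      by (simp add: zero_ereal_def)
  qed
  then show "((\<lambda>x. Limsup (at_top_in T) (\<lambda>t. ereal \<bar>kernel_op (P t) f x - kernel_op (P t) f z\<bar>)) \<longlongrightarrow> 0) (at z)"
    by simp
qed

text \<open>
  Otherwise the space would be covered by null balls, and by countably many of them.
\<close>

lemma support_point_exists:
  fixes \<mu> :: "'a measure"
  assumes \<mu>: "\<mu> \<in> M_1"
  obtains z where "\<And>\<epsilon>. \<epsilon> > 0 \<Longrightarrow> measure \<mu> (ball z \<epsilon>) > 0"
proof (rule ccontr)
  interpret prob_space \<mu> by (rule M_1D[OF \<mu>])
  assume "\<not> thesis"
  then have "\<forall>z. \<exists>\<epsilon>>0. measure \<mu> (ball z \<epsilon>) = 0"
    using that by (metis measure_nonneg order_le_less)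
  then obtain \<epsilon> where \<epsilon>: "\<And>z. \<epsilon> z > 0" "\<And>z. measure \<mu> (ball z (\<epsilon> z)) = 0" by metis
  obtain \<F>' where \<F>': "\<F>' \<subseteq> range (\<lambda>z. ball z (\<epsilon> z))" "countable \<F>'" "\<Union>\<F>' = \<Union>(range (\<lambda>z. ball z (\<epsilon> z)))"
    using Lindelof[of "range (\<lambda>z. ball z (\<epsilon> z))"] by blast
  have "U \<in> null_sets \<mu>" if "U \<in> \<F>'" for U
    using that \<F>'(1) \<epsilon>(2) M_1D(2)[OF \<mu>] by (auto simp: null_sets_def emeasure_eq_measure)
  then have "\<Union>\<F>' \<in> null_sets \<mu>" using null_sets_UN'[OF \<F>'(2), of id] by simp
  moreover have "\<Union>(range (\<lambda>z. ball z (\<epsilon> z))) = UNIV" using \<epsilon>(1) by (auto intro: centre_in_ball[THEN iffD2])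
  ultimately show False
    using prob_space M_1D(3)[OF \<mu>] \<F>'(3) by (simp add: null_sets_def emeasure_eq_measure)
qed

lemma stable_imp_lower_bound:
  assumes "asymptotically_stable T P"
  shows "\<exists>z. \<forall>\<epsilon>>0. (INF x. Liminf (at_top_in T) (\<lambda>t. ereal (measure (P t x) (ball z \<epsilon>)))) > 0"
proof -
  obtain \<mu> where inv: "invariant_measure T P \<mu>"
    and conv: "\<forall>\<nu>\<in>M_1. converges_weakly (\<lambda>t. dual_op (P t) \<nu>) \<mu> (at_top_in T)"
    using assms unfolding asymptotically_stable_def by blast
  have \<mu>: "\<mu> \<in> M_1" using inv unfolding invariant_measure_def by blast
  obtain z where z: "\<And>\<epsilon>. \<epsilon> > 0 \<Longrightarrow> measure \<mu> (ball z \<epsilon>) > 0" using support_point_exists[OF \<mu>] by blast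
  have "(INF x. Liminf (at_top_in T) (\<lambda>t. ereal (measure (P t x) (ball z \<epsilon>)))) > 0" if \<epsilon>: "\<epsilon> > 0" for \<epsilon>
  proof -
    have "\<exists>h. (\<forall>n. h n \<in> L_b) \<and> (\<forall>n x. 0 \<le> h n x) \<and> (\<forall>n x. h n x \<le> 1) \<and> (\<forall>n x. x \<notin> ball z \<epsilon> \<longrightarrow> h n x = 0) \<and>
        (\<forall>x. (\<lambda>n. h n x) \<longlonglongrightarrow> indicator (ball z \<epsilon>) x)"
      by (rule open_approx_lipschitz[OF open_ball[of z \<epsilon>]]) metis
    then obtain h :: "nat \<Rightarrow> 'a \<Rightarrow> real" where h: "\<And>n. h n \<in> L_b" "\<And>n x. 0 \<le> h n x"
      "\<And>n x. h n x \<le> 1" "\<And>n x. x \<notin> ball z \<epsilon> \<Longrightarrow> h n x = 0" "\<And>x. (\<lambda>n. h n x) \<longlonglongrightarrow> indicator (ball z \<epsilon>) x"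
      by metis
    have hC: "h n \<in> C_b" for n by (intro L_b_C_b h)
    have "(\<lambda>n. \<integral>x. h n x \<partial>\<mu>) \<longlonglongrightarrow> (\<integral>x. indicator (ball z \<epsilon>) x \<partial>\<mu>)"
      by (rule expectation_dominated[OF \<mu> C_b_B_b[OF hC], where C = 1])
        (use h in \<open>auto intro!: borel_measurable_indicator\<close>)
    then have "(\<lambda>n. \<integral>x. h n x \<partial>\<mu>) \<longlonglongrightarrow> measure \<mu> (ball z \<epsilon>)" unfolding expectation_indicator[OF \<mu>] .
    from order_tendstoD(1)[OF this z[OF \<epsilon>]] obtain n where n: "0 < (\<integral>x. h n x \<partial>\<mu>)"
      by (auto simp: eventually_sequentially)
    have "ereal ((\<integral>x. h n x \<partial>\<mu>) / 2) \<le> Liminf (at_top_in T) (\<lambda>t. ereal (measure (P t x) (ball z \<epsilon>)))" for x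
    proof (rule Liminf_bounded)
      have "\<forall>\<^sub>F t in at_top_in T. (\<integral>x. h n x \<partial>\<mu>) / 2 < kernel_op (P t) (h n) x"
        using stable_tendsto[OF conv hC, of n x] n by (intro order_tendstoD) auto
      with eventually_in_T
      show "\<forall>\<^sub>F t in at_top_in T. ereal ((\<integral>x. h n x \<partial>\<mu>) / 2) \<le> ereal (measure (P t x) (ball z \<epsilon>))"
      proof eventually_elim
        case (elim t)
        have "h n y \<le> indicator (ball z \<epsilon>) y" for y using h(3)[of n y] h(4)[of y n] by (cases "y \<in> ball z \<epsilon>") auto
        then have "kernel_op (P t) (h n) x \<le> kernel_op (P t) (indicator (ball z \<epsilon>)) x"
          by (intro op_mono elim C_b_B_b[OF hC] B_b_indicator) auto
        then show ?case using elim op_indicator[OF elim(1)] by simp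
      qed
    qed
    then have "ereal ((\<integral>x. h n x \<partial>\<mu>) / 2) \<le> (INF x. Liminf (at_top_in T) (\<lambda>t. ereal (measure (P t x) (ball z \<epsilon>))))"
      by (rule INF_greatest)
    moreover have "0 < ereal ((\<integral>x. h n x \<partial>\<mu>) / 2)" using n by simp
    ultimately show ?thesis by (rule less_le_trans[rotated])
  qed
  then show ?thesis by blast
qed

end

theorem theorem3p1:
  fixes T :: "real set" and P :: "real \<Rightarrow> 'a::polish_space \<Rightarrow> 'a measure"
  assumes "T = {0..} \<or> T = real ` {1..}"
    and "markov_feller_semigroup T P"
  shows "asymptotically_stable T P \<longleftrightarrow>
    eventually_continuous T P \<and>
    (\<exists>z. \<forall>\<epsilon>>0. (INF x. Liminf (at_top_in T) (\<lambda>t. ereal (measure (P t x) (ball z \<epsilon>)))) > 0)"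
proof -
  interpret markov_feller T P by unfold_locales (rule assms)+
  show ?thesis
    using asymptotically_stableI recurrent_atI eventually_continuous_atI
      stable_imp_eventually_continuous stable_imp_lower_bound by blast
qed

end
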